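(* The linear map $C_\mu\mapsto K_\mu$ (for all partitions $\mu$) induces an isomorphism of graded rings $\operatorname{gr}\mathcal{Z}\to\operatorname{gr}\mathcal{H}$.
   Context: Partitions: finite non-increasing sequences of positive integers; $\mathcal P$ is the set of all partitions (including $\emptyset$); $|\lambda|$ is the sum of the parts, $\ell(\lambda)$ the number of parts, $\mathrm{wt}(\lambda)=|\lambda|+\ell(\lambda)$. $\mathcal B$ is the ring of integer-valued polynomials in one variable with rational coefficients. Ring $\mathcal Z$: The stable cycle type of $x\in S_n$ is the partition obtained from its cycle type by subtracting 1 from every part (and discarding zeros). $C_\mu(n)\in\mathbb Z[S_n]$ is the sum of all permutations in $S_n$ of stable cycle type $\mu$; those with $\mathrm{wt}(\mu)\le n$ form a $\mathbb Z$-basis of the center of $\mathbb Z[S_n]$. Write $C_\lambda(n)C_\mu(n)=\sum_\nu a^\nu_{\lambda\mu}(n)C_\nu(n)$. By Farahat–Higman, $a_{\lambda\mu}^\nu(n)=0$ if $|\nu|>|\lambda|+|\mu|$, there are $a^\nu_{\lambda\mu}\in\mathcal B$ whose value at $n$ is the structure constant for all $n\ge \mathrm{wt}(\nu)$, and these are constants when $|\nu|=|\lambda|+|\mu|$. The universal ring $\mathcal Z$ is the free $\mathcal B$-module on symbols $C_\mu$, $\mu\in\mathcal P$, with product $C_\lambda C_\mu=\sum_{|\nu|\le|\lambda|+|\mu|}a^\nu_{\lambda\mu}C_\nu$. Ring $\mathcal H$: $B_n\subset S_{2n}$ is the centralizer of $t=(1\,2)(3\,4)\cdots(2n-1\,2n)$.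 For $w\in S_{2n}$ let $\varGamma(w)$ be the multigraph on $\{1,\dots,2n\}$ with, for each $k=1,\dots,n$, an edge joining $2k-1,2k$ and an edge joining $w^{-1}(2k-1),w^{-1}(2k)$; it is a disjoint union of cycles of lengths $2\rho_1\ge2\rho_2\ge\cdots$. The partition $(\rho_1,\rho_2,\dots)$ of $n$ is the coset type of $w$, and subtracting 1 from each part (discarding zeros) gives its stable coset type. $\mathcal H_n$ is the ring of $B_n$-biinvariant functions $S_{2n}\to\mathbb Z$ with product $(f*g)(x)=\frac1{|B_n|}\sum_{y}f(xy^{-1})g(y)$; $K_\mu(n)\in\mathcal H_n$ is the indicator function of the set of $w\in S_{2n}$ of stable coset type $\mu$; those with $\mathrm{wt}(\mu)\le n$ form a $\mathbb Z$-basis. Write $K_\lambda(n)K_\mu(n)=\sum_\nu b^\nu_{\lambda\mu}(n)K_\nu(n)$. Then $b^\nu_{\lambda\mu}(n)=0$ if $|\nu|>|\lambda|+|\mu|$, and for $|\nu|\le|\lambda|+|\mu|$ there is a unique $f^\nu_{\lambda\mu}\in\mathcal B$ with $b^\nu_{\lambda\mu}(n)=f^\nu_{\lambda\mu}(n)$ for all $n\ge\mathrm{wt}(\nu)$. The universal Hecke ring $\mathcal H$ is the free $\mathcal B$-module on symbols $K_\mu$, $\mu\in\mathcal P$, with product $K_\lambda K_\mu=\sum_{|\nu|\le|\lambda|+|\mu|}f^\nu_{\lambda\mu}K_\nu$. Gradings: $\mathcal Z$ (resp. $\mathcal H$) is filtered by $F_k=$ the $\mathcal B$-span of the $C_\mu$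 (resp. $K_\mu$) with $|\mu|\le k$; $\operatorname{gr}\mathcal Z$ and $\operatorname{gr}\mathcal H$ are the associated graded rings, and the classes of $C_\mu$, $K_\mu$ in degree $|\mu|$ are denoted by the same symbols. *)

theory Defs
  imports
    "HOL-Algebra.Algebra"
    "HOL-Computational_Algebra.Polynomial"
    "HOL-Combinatorics.Orbits"
    "HOL-Library.Multiset"
    "HOL-Library.Poly_Mapping"
begin

section \<open>Partitions and integer-valued polynomials\<close>

text \<open>A partition is encoded by the multiset of its parts, so that \<open>\<bar>\<alpha>\<bar>\<close> is
  \<^term>\<open>sum_mset \<alpha>\<close> and the number of parts is \<^term>\<open>size \<alpha>\<close>.\<close>

definition partitions :: "nat multiset set" where
  "partitions = {\<alpha>. 0 \<notin># \<alpha>}"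

definition wt :: "nat multiset \<Rightarrow> nat" where
  "wt \<alpha> = sum_mset \<alpha> + size \<alpha>"

definition stable :: "nat multiset \<Rightarrow> nat multiset" where
  "stable \<rho> = filter_mset (\<lambda>i. i \<noteq> 0) (image_mset (\<lambda>i. i - 1) \<rho>)"

definition int_valued :: "rat poly set" where
  "int_valued = {p. \<forall>m::int. poly p (of_int m) \<in> \<int>}"

section \<open>Structure constants of the centers of the symmetric group rings\<close>

definition cycle_type :: "nat \<Rightarrow> (nat \<Rightarrow> nat) \<Rightarrow> nat multiset" where
  "cycle_type n x = image_mset card (mset_set (Orbits.orbit x ` {1..n}))"

text \<open>An element of the group ring \<open>\<int>[G]\<close> is represented by its coefficient function,
  which vanishes outside \<^term>\<open>carrier G\<close>.\<close>

definition convolution ::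
    "('g, 'm) monoid_scheme \<Rightarrow> ('g \<Rightarrow> int) \<Rightarrow> ('g \<Rightarrow> int) \<Rightarrow> 'g \<Rightarrow> int" where
  "convolution G f g = (\<lambda>x. if x \<in> carrier G
     then (\<Sum>y\<in>carrier G. f (x \<otimes>\<^bsub>G\<^esub> inv\<^bsub>G\<^esub> y) * g y) else 0)"

definition class_sum :: "nat \<Rightarrow> nat multiset \<Rightarrow> (nat \<Rightarrow> nat) \<Rightarrow> int" where
  "class_sum n \<mu> = (\<lambda>x. if x \<in> carrier (sym_group n) \<and> stable (cycle_type n x) = \<mu>
     then 1 else 0)"

text \<open>The coefficients of \<open>u\<close> with respect to the basis \<open>e \<nu>\<close>, where \<open>\<nu>\<close> runs over the
  partitions of weight at most \<open>n\<close>.\<close>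

definition basis_coeffs ::
    "nat \<Rightarrow> (nat multiset \<Rightarrow> 'x \<Rightarrow> int) \<Rightarrow> ('x \<Rightarrow> int) \<Rightarrow> nat multiset \<Rightarrow> int" where
  "basis_coeffs n e u = (THE c.
     (\<forall>\<nu>. \<not> (\<nu> \<in> partitions \<and> wt \<nu> \<le> n) \<longrightarrow> c \<nu> = 0) \<and>
     u = (\<lambda>x. \<Sum>\<nu> \<in> {\<nu> \<in> partitions. wt \<nu> \<le> n}. c \<nu> * e \<nu> x))"

definition a_num :: "nat \<Rightarrow> nat multiset \<Rightarrow> nat multiset \<Rightarrow> nat multiset \<Rightarrow> int" where
  "a_num n \<alpha> \<mu> =
     basis_coeffs n (class_sum n) (convolution (sym_group n) (class_sum n \<alpha>) (class_sum n \<mu>))"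

definition interpolant :: "(nat \<Rightarrow> int) \<Rightarrow> nat \<Rightarrow> rat poly" where
  "interpolant s N =
     (THE p. p \<in> int_valued \<and> (\<forall>n\<ge>N. poly p (of_nat n) = of_int (s n)))"

definition a_poly :: "nat multiset \<Rightarrow> nat multiset \<Rightarrow> nat multiset \<Rightarrow> rat poly" where
  "a_poly \<alpha> \<mu> \<nu> = interpolant (\<lambda>n. a_num n \<alpha> \<mu> \<nu>) (wt \<nu>)"

section \<open>Structure constants of the Hecke rings\<close>

definition t_perm :: "nat \<Rightarrow> nat \<Rightarrow> nat" where
  "t_perm n i = (if i \<in> {1..2 * n} then (if odd i then i + 1 else i - 1) else i)"

definition hyperoctahedral :: "nat \<Rightarrow> (nat \<Rightarrow> nat) set" where
  "hyperoctahedral n = {w \<in> carrier (sym_group (2 * n)). w \<circ> t_perm n = t_perm n \<circ> w}"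

text \<open>The multigraph on \<open>{1..2n}\<close> is given by the multiset of its edges, so a double
  edge has multiplicity two.\<close>

definition coset_graph :: "nat \<Rightarrow> (nat \<Rightarrow> nat) \<Rightarrow> nat set multiset" where
  "coset_graph n w = (\<Sum>k\<in>{1..n}.
     {#{2 * k - 1, 2 * k}, {inv_into UNIV w (2 * k - 1), inv_into UNIV w (2 * k)}#})"

definition graph_components :: "nat \<Rightarrow> nat set multiset \<Rightarrow> nat set set" where
  "graph_components m E = {1..m} // {(a, b) \<in> {1..m} \<times> {1..m}. {a, b} \<in># E}\<^sup>*"

text \<open>The components are cycles; the length of a cycle is its number of vertices (two for a
  double edge), and it is twice the corresponding part of the coset type. In the quotient
  above the reflexive closure also relates points outside \<open>{1..m}\<close>, but these do not
  contribute a class.\<close>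

definition coset_type :: "nat \<Rightarrow> (nat \<Rightarrow> nat) \<Rightarrow> nat multiset" where
  "coset_type n w =
     image_mset (\<lambda>S. card S div 2) (mset_set (graph_components (2 * n) (coset_graph n w)))"

definition double_coset_fun :: "nat \<Rightarrow> nat multiset \<Rightarrow> (nat \<Rightarrow> nat) \<Rightarrow> int" where
  "double_coset_fun n \<mu> =
     (\<lambda>w. if w \<in> carrier (sym_group (2 * n)) \<and> stable (coset_type n w) = \<mu> then 1 else 0)"

text \<open>On biinvariant functions the division is exact: the summand
  \<open>f (x y\<^sup>-\<^sup>1) g y\<close> depends only on the coset of \<open>y\<close> modulo left multiplication by the
  hyperoctahedral group.\<close>

definition hecke_mult ::
    "nat \<Rightarrow> ((nat \<Rightarrow> nat) \<Rightarrow> int) \<Rightarrow> ((nat \<Rightarrow> nat) \<Rightarrow> int) \<Rightarrow> (nat \<Rightarrow> nat) \<Rightarrow> int" where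
  "hecke_mult n f g =
     (\<lambda>x. convolution (sym_group (2 * n)) f g x div int (card (hyperoctahedral n)))"

definition b_num :: "nat \<Rightarrow> nat multiset \<Rightarrow> nat multiset \<Rightarrow> nat multiset \<Rightarrow> int" where
  "b_num n \<alpha> \<mu> = basis_coeffs n (double_coset_fun n)
     (hecke_mult n (double_coset_fun n \<alpha>) (double_coset_fun n \<mu>))"

definition f_poly :: "nat multiset \<Rightarrow> nat multiset \<Rightarrow> nat multiset \<Rightarrow> rat poly" where
  "f_poly \<alpha> \<mu> \<nu> = interpolant (\<lambda>n. b_num n \<alpha> \<mu> \<nu>) (wt \<nu>)"

section \<open>The universal rings\<close>

text \<open>Both universal rings have the same underlying module, free over the integer-valued
  polynomials; only their structure constants differ. The basis symbol \<open>C\<^sub>\<mu>\<close>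
  (respectively \<open>K\<^sub>\<mu>\<close>) is \<open>symb \<mu>\<close>.\<close>

type_synonym univ = "nat multiset \<Rightarrow>\<^sub>0 rat poly"

definition symb :: "nat multiset \<Rightarrow> univ" where
  "symb \<mu> = Poly_Mapping.single \<mu> 1"

definition scale :: "rat poly \<Rightarrow> univ \<Rightarrow> univ" where
  "scale p f = Poly_Mapping.map (\<lambda>q. p * q) f"

definition univ_carrier :: "univ set" where
  "univ_carrier = {f. Poly_Mapping.keys f \<subseteq> partitions \<and>
     (\<forall>\<mu>. Poly_Mapping.lookup f \<mu> \<in> int_valued)}"

definition symb_mult ::
    "(nat multiset \<Rightarrow> nat multiset \<Rightarrow> nat multiset \<Rightarrow> rat poly) \<Rightarrow>
     nat multiset \<Rightarrow> nat multiset \<Rightarrow> univ" where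
  "symb_mult c \<alpha> \<mu> =
     (\<Sum>\<nu> \<in> {\<nu> \<in> partitions. sum_mset \<nu> \<le> sum_mset \<alpha> + sum_mset \<mu>}.
        scale (c \<alpha> \<mu> \<nu>) (symb \<nu>))"

definition univ_ring ::
    "(nat multiset \<Rightarrow> nat multiset \<Rightarrow> nat multiset \<Rightarrow> rat poly) \<Rightarrow> univ ring" where
  "univ_ring c = \<lparr>carrier = univ_carrier,
     monoid.mult = (\<lambda>f g. \<Sum>\<alpha>\<in>Poly_Mapping.keys f. \<Sum>\<mu>\<in>Poly_Mapping.keys g.
       scale (Poly_Mapping.lookup f \<alpha> * Poly_Mapping.lookup g \<mu>) (symb_mult c \<alpha> \<mu>)),
     one = symb {#}, ring.zero = 0, add = (+)\<rparr>"

definition univ_Z :: "univ ring" where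
  "univ_Z = univ_ring a_poly"

definition univ_H :: "univ ring" where
  "univ_H = univ_ring f_poly"

definition univ_filt :: "nat \<Rightarrow> univ set" where
  "univ_filt k = {f \<in> univ_carrier. \<forall>\<mu>\<in>Poly_Mapping.keys f. sum_mset \<mu> \<le> k}"

text \<open>The linear map \<open>C\<^sub>\<mu> \<mapsto> K\<^sub>\<mu>\<close>. Since the two symbols have the same encoding, it is
  the identity on the underlying module.\<close>

definition C_to_K :: "univ \<Rightarrow> univ" where
  "C_to_K f = (\<Sum>\<mu>\<in>Poly_Mapping.keys f. scale (Poly_Mapping.lookup f \<mu>) (symb \<mu>))"

section \<open>Graded rings and associated graded rings\<close>

definition graded_ring :: "('a, 'm) ring_scheme \<Rightarrow> (nat \<Rightarrow> 'a set) \<Rightarrow> bool" where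
  "graded_ring R D \<longleftrightarrow> ring R \<and>
     (\<forall>k. additive_subgroup (D k) R) \<and>
     (\<forall>i j. \<forall>x\<in>D i. \<forall>y\<in>D j. x \<otimes>\<^bsub>R\<^esub> y \<in> D (i + j)) \<and>
     \<one>\<^bsub>R\<^esub> \<in> D 0 \<and>
     (\<forall>x\<in>carrier R. \<exists>!d. (\<forall>k. d k \<in> D k) \<and> finite {k. d k \<noteq> \<zero>\<^bsub>R\<^esub>} \<and>
        x = finsum R d {k. d k \<noteq> \<zero>\<^bsub>R\<^esub>})"

definition graded_ring_iso ::
    "('a, 'm) ring_scheme \<Rightarrow> (nat \<Rightarrow> 'a set) \<Rightarrow>
     ('b, 'n) ring_scheme \<Rightarrow> (nat \<Rightarrow> 'b set) \<Rightarrow> ('a \<Rightarrow> 'b) \<Rightarrow> bool" where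
  "graded_ring_iso R D S E h \<longleftrightarrow> graded_ring R D \<and> graded_ring S E \<and>
     h \<in> ring_iso R S \<and> (\<forall>k. h ` D k = E k)"

text \<open>\<open>filt_pred R F k\<close> is \<open>F\<^sub>k\<^sub>-\<^sub>1\<close>, with \<open>F\<^sub>-\<^sub>1 = 0\<close>.\<close>

definition filt_pred :: "('a, 'm) ring_scheme \<Rightarrow> (nat \<Rightarrow> 'a set) \<Rightarrow> nat \<Rightarrow> 'a set" where
  "filt_pred R F k = (case k of 0 \<Rightarrow> {\<zero>\<^bsub>R\<^esub>} | Suc j \<Rightarrow> F j)"

definition gr_piece :: "('a, 'm) ring_scheme \<Rightarrow> (nat \<Rightarrow> 'a set) \<Rightarrow> nat \<Rightarrow> 'a set monoid" where
  "gr_piece R F k = (R\<lparr>carrier := F k\<rparr>) A_Mod (filt_pred R F k)"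

text \<open>The class in degree \<open>k\<close> of an element of \<open>F\<^sub>k\<close>. The zero of the piece of degree \<open>j\<close>
  is the coset \<open>F\<^sub>j\<^sub>-\<^sub>1\<close>.\<close>

definition gr_class ::
    "('a, 'm) ring_scheme \<Rightarrow> (nat \<Rightarrow> 'a set) \<Rightarrow> nat \<Rightarrow> 'a \<Rightarrow> nat \<Rightarrow> 'a set" where
  "gr_class R F k a =
     (\<lambda>j. if j = k then filt_pred R F k +>\<^bsub>R\<^esub> a else filt_pred R F j)"

text \<open>Additively the associated graded ring is the direct sum of the pieces. The operation
  of a piece is addition of cosets, so \<^const>\<open>finprod\<close> is a sum of cosets; the summand
  with index \<open>i\<close> is the product \<open>F\<^sub>i / F\<^sub>i\<^sub>-\<^sub>1 \<times> F\<^sub>k\<^sub>-\<^sub>i / F\<^sub>k\<^sub>-\<^sub>i\<^sub>-\<^sub>1 \<rightarrow> F\<^sub>k / F\<^sub>k\<^sub>-\<^sub>1\<close>.\<close>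

definition gr_ring ::
    "('a, 'm) ring_scheme \<Rightarrow> (nat \<Rightarrow> 'a set) \<Rightarrow> (nat \<Rightarrow> 'a set) ring" where
  "gr_ring R F = \<lparr>carrier = carrier (sum_group UNIV (gr_piece R F)),
     monoid.mult = (\<lambda>x y k. finprod (gr_piece R F k)
        (\<lambda>i. rcoset_mult R (filt_pred R F k) (x i) (y (k - i))) {..k}),
     one = gr_class R F 0 \<one>\<^bsub>R\<^esub>,
     ring.zero = \<one>\<^bsub>sum_group UNIV (gr_piece R F)\<^esub>,
     add = (\<otimes>\<^bsub>sum_group UNIV (gr_piece R F)\<^esub>)\<rparr>"

definition gr_deg ::
    "('a, 'm) ring_scheme \<Rightarrow> (nat \<Rightarrow> 'a set) \<Rightarrow> nat \<Rightarrow> (nat \<Rightarrow> 'a set) set" where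
  "gr_deg R F k =
     {x \<in> carrier (gr_ring R F). \<forall>j. j \<noteq> k \<longrightarrow> x j = \<one>\<^bsub>gr_piece R F j\<^esub>}"

text \<open>The map induced on associated graded rings by an additive map \<open>h\<close> into \<open>(S, G)\<close> that
  respects the filtrations: the coset of \<open>a\<close> goes to the coset of \<open>h a\<close>.\<close>

definition gr_map ::
    "('b, 'n) ring_scheme \<Rightarrow> (nat \<Rightarrow> 'b set) \<Rightarrow> ('a \<Rightarrow> 'b) \<Rightarrow>
     (nat \<Rightarrow> 'a set) \<Rightarrow> nat \<Rightarrow> 'b set" where
  "gr_map S G h x = (\<lambda>k. \<Union>a\<in>x k. filt_pred S G k +>\<^bsub>S\<^esub> h a)"

end

(* Two perfect matchings of {1..2n} play for the Hecke ring the role of a permutation for the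
   center: a matching m is encoded by the permutation p = t m, where t is the standard matching,
   and the cycle type of p is the coset type with every part doubled. The structure constants
   then count factorizations of a fixed permutation, in S_n or within the set of these p. Sorting
   the factorizations by their supports shows that the counts are integral combinations of
   binomial coefficients in n.

   In top degree, |nu| = |alpha| + |mu|, such a factorization of q = x y is geodesic for the
   length N - (number of orbits). Counting the sets of points that are invariant under x and y
   shows that then every set invariant under q is invariant under both factors. Taking q to act
   on the odd numbers as z and on the even numbers as the inverse of z, the factors preserve the
   odd numbers, and their restrictions to the odd numbers are precisely the factorizations of z
   in S_n. So the top structure constants agree, and these are the only ones that survive in the
   associated graded rings. *)

theory Submission
  imports Defs
begin

section \<open>Orbits and conjugacy of permutations\<close>

text \<open>Each structure constant hides behind two definite descriptions, one for the basis
  coefficients and one for the interpolating polynomial. Existence and uniqueness have to be settled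
  before anything else can be said; hence the insistence on counts that depend only on the type of
  the element factored, and on counts valid for every n at once. For the latter, types are computed
  from moved points alone, so that one set of factors serves all n.

  The field with two elements is behind the counting of invariant sets: they form a vector space
  whose dimension is the number of orbits. The equality case of a dimension formula thereby replaces
  any decomposition into transpositions.

  Associativity of the polynomial constants is proved in top degree only, by counting triple
  factorizations in S_n, and is carried to the Hecke side by the equality of the constants. The
  graded Hecke ring thus becomes a ring without any study of associativity for double
  cosets.\<close>

definition stype :: "('a \<Rightarrow> 'a) \<Rightarrow> nat multiset" where
  "stype x = image_mset (\<lambda>S. card S - 1) (mset_set (orbit x ` {i. x i \<noteq> i}))"

lemma permutation_orbit_eq:
  assumes "permutation x" "b \<in> orbit x a"
  shows "orbit x b = orbit x a"
  using orbit_cyclic_eq3[OF cyclic_on_orbit'[OF assms(1), of a] assms(2)] .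

lemma permutes_imp_permutation_finite:
  "finite V \<Longrightarrow> x permutes V \<Longrightarrow> permutation x"
  using permutation_permutes by blast

lemma finite_orbit_permutation: "permutation x \<Longrightarrow> finite (orbit x a)"
  using finite_orbit permutation_self_in_orbit by metis

lemma disjoint_orbits:
  assumes "permutation x" "S \<in> orbit x ` V" "S' \<in> orbit x ` V" "S \<noteq> S'"
  shows "S \<inter> S' = {}"
  using assms permutation_orbit_eq[OF assms(1)] by blast

lemma Union_orbits:
  assumes "finite V" "x permutes V"
  shows "\<Union> (orbit x ` V) = V"
proof -
  have "a \<in> orbit x a" for a
    using assms permutation_self_in_orbit permutes_imp_permutation_finite by metis
  moreover have "orbit x a \<subseteq> V" if "a \<in> V" for a
    using assms that permutes_orbit_subset by fast
  ultimately show ?thesis by blast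
qed

lemma card_orbit_eq_1_iff:
  assumes "permutation x"
  shows "card (orbit x a) = 1 \<longleftrightarrow> x a = a"
  by (metis assms card_1_singletonE orbit_eq_singleton_iff permutation_self_in_orbit singletonD
      card.empty card.insert empty_iff finite.emptyI One_nat_def)

lemma card_orbit_pos:
  assumes "permutation x"
  shows "card (orbit x a) > 0"
  using assms finite_orbit_permutation orbit_nonempty card_gt_0_iff by metis

lemma moved_subset: "x permutes V \<Longrightarrow> {i. x i \<noteq> i} \<subseteq> V"
  by (auto simp: permutes_def)

lemma stable_orbits:
  assumes "finite V" "x permutes V"
  shows "stable (image_mset card (mset_set (orbit x ` V))) = stype x"
proof -
  have p: "permutation x" using assms permutes_imp_permutation_finite by metis
  have "{S \<in> orbit x ` V. Suc 0 < card S} = orbit x ` {i. x i \<noteq> i}"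
  proof -
    have "Suc 0 < card (orbit x a) \<longleftrightarrow> x a \<noteq> a" for a
      using card_orbit_eq_1_iff[OF p, of a] card_orbit_pos[OF p, of a] by auto
    moreover have "x a \<noteq> a \<Longrightarrow> a \<in> V" for a using moved_subset[OF assms(2)] by blast
    ultimately show ?thesis by blast
  qed
  then show ?thesis using assms
    by (simp add: stable_def stype_def filter_mset_image_mset multiset.map_comp comp_def)
qed

lemma stable_cycle_type:
  "x permutes {1..n} \<Longrightarrow> stable (cycle_type n x) = stype x"
  unfolding cycle_type_def by (rule stable_orbits) auto

lemma card_eq_sum_orbits:
  assumes "finite V" "x permutes V"
  shows "card V = (\<Sum>S\<in>orbit x ` V. card S)"
proof -
  have p: "permutation x" using assms permutes_imp_permutation_finite by metis
  have "card (\<Union> (orbit x ` V)) = (\<Sum>S\<in>orbit x ` V. card S)"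
    using disjoint_orbits[OF p] finite_orbit_permutation[OF p]
    by (intro card_Union_disjoint) (auto simp: pairwise_def disjnt_def)
  then show ?thesis using Union_orbits[OF assms] by simp
qed

lemma permutes_moved: "x permutes V \<Longrightarrow> x permutes {i. x i \<noteq> i}"
  by (auto simp: permutes_def)

text \<open>An orbit of size r contributes r - 1 to the size and 1 to the number of parts. The
  weight is thus the number of points a permutation really uses, which is why
  \<open>wt \<nu> \<le> n\<close> is the condition for type \<nu> to occur in S_n.\<close>

lemma wt_stype:
  assumes "permutation x"
  shows "wt (stype x) = card {i. x i \<noteq> i}"
proof -
  let ?M = "{i. x i \<noteq> i}"
  have f: "finite ?M" using assms unfolding permutation by simp
  have pm: "x permutes ?M" using assms permutation_permutes permutes_moved by blast
  have "wt (stype x) = (\<Sum>S\<in>orbit x ` ?M. card S - 1) + card (orbit x ` ?M)"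
    by (simp add: wt_def stype_def sum_unfold_sum_mset)
  also have "\<dots> = (\<Sum>S\<in>orbit x ` ?M. (card S - 1) + 1)" by (simp only: sum.distrib) simp
  also have "\<dots> = (\<Sum>S\<in>orbit x ` ?M. card S)"
    using card_orbit_pos[OF assms] by (intro sum.cong) (auto simp: Suc_leI)
  also have "\<dots> = card ?M" using card_eq_sum_orbits[OF f pm] by simp
  finally show ?thesis .
qed

text \<open>This identifies the size of the type with the usual length, the number of points minus
  the number of orbits. Orbits of fixed points add zero, so any finite V permuted by x may be
  taken.\<close>

lemma sum_mset_stype:
  assumes "finite V" "x permutes V"
  shows "sum_mset (stype x) + card (orbit x ` V) = card V"
proof -
  have p: "permutation x" using assms permutes_imp_permutation_finite by metis
  have "sum_mset (stype x) = (\<Sum>S\<in>orbit x ` {i. x i \<noteq> i}. card S - 1)"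
    by (simp add: stype_def sum_unfold_sum_mset)
  also have "\<dots> = (\<Sum>S\<in>orbit x ` V. card S - 1)"
  proof (rule sum.mono_neutral_left)
    show "orbit x ` {i. x i \<noteq> i} \<subseteq> orbit x ` V" using moved_subset[OF assms(2)] by blast
    show "\<forall>i\<in>orbit x ` V - orbit x ` {i. x i \<noteq> i}. card i - 1 = 0"
    proof
      fix S assume "S \<in> orbit x ` V - orbit x ` {i. x i \<noteq> i}"
      then obtain a where "S = orbit x a" "x a = a" by blast
      then show "card S - 1 = 0" using card_orbit_eq_1_iff[OF p, of a] by simp
    qed
  qed (use assms in auto)
  finally have "sum_mset (stype x) + card (orbit x ` V) = (\<Sum>S\<in>orbit x ` V. (card S - 1) + 1)"
    by (simp only: sum.distrib) simp
  also have "\<dots> = (\<Sum>S\<in>orbit x ` V. card S)"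
    using card_orbit_pos[OF p] by (intro sum.cong) (auto simp: Suc_leI)
  finally show ?thesis using card_eq_sum_orbits[OF assms] by simp
qed

lemma stype_partition: "permutation x \<Longrightarrow> stype x \<in> partitions"
proof -
  assume p: "permutation x"
  have "card (orbit x a) - 1 \<noteq> 0" if "x a \<noteq> a" for a
    using card_orbit_eq_1_iff[OF p, of a] card_orbit_pos[OF p, of a] that by auto
  then show ?thesis
    using p by (force simp: partitions_def stype_def permutation)
qed

lemma wt_stype_le:
  assumes "x permutes {1..n}"
  shows "wt (stype x) \<le> n"
proof -
  have "permutation x" using assms permutes_imp_permutation_finite by blast
  then have "wt (stype x) = card {i. x i \<noteq> i}" by (rule wt_stype)
  also have "\<dots> \<le> card {1..n}" using moved_subset[OF assms] by (intro card_mono) auto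
  finally show ?thesis by simp
qed

lemma stype_eq_empty_iff:
  assumes "permutation x"
  shows "stype x = {#} \<longleftrightarrow> x = id"
proof
  assume "stype x = {#}"
  then have "card {i. x i \<noteq> i} = 0" using wt_stype[OF assms] by (simp add: wt_def)
  then show "x = id" using assms unfolding permutation by auto
qed (simp add: stype_def)

lemma stype_inv:
  assumes "permutation x"
  shows "stype (inv' x) = stype x"
proof -
  have "{i. inv' x i \<noteq> i} = {i. x i \<noteq> i}"
    using assms by (metis (no_types, lifting) bij_inv_eq_iff permutation_bijective)
  moreover have "orbit (inv' x) = orbit x"
    using orbit_inv_eq[OF assms] by blast
  ultimately show ?thesis by (simp add: stype_def)
qed

text \<open>\<open>f\<close> and \<open>g\<close> place a copy of \<open>x\<close> and a copy of \<open>y\<close> side by side inside \<open>z\<close>.\<close>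

lemma stype_embed:
  assumes "finite A" "finite B" "x permutes A" "y permutes B"
    and "inj_on f A" "inj_on g B" "f ` A \<inter> g ` B = {}"
    and zf: "\<And>a. a \<in> A \<Longrightarrow> z (f a) = f (x a)"
    and zg: "\<And>b. b \<in> B \<Longrightarrow> z (g b) = g (y b)"
    and z: "\<And>i. i \<notin> f ` A \<union> g ` B \<Longrightarrow> z i = i"
  shows "stype z = stype x + stype y"
proof -
  have pow: "(z ^^ n) (h a) = h ((u ^^ n) a) \<and> (u ^^ n) a \<in> C"
    if "u permutes C" "a \<in> C" "\<And>a. a \<in> C \<Longrightarrow> z (h a) = h (u a)" for n a h u and C
    using that by (induction n) (auto simp: permutes_in_image)
  have orb: "orbit z (h a) = h ` orbit u a \<and> orbit u a \<subseteq> C"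
    if "u permutes C" "a \<in> C" "\<And>a. a \<in> C \<Longrightarrow> z (h a) = h (u a)" for a h u and C
    using pow[of u C a h] that unfolding orbit_altdef by auto
  have part: "image_mset (\<lambda>S. card S - 1) (mset_set (orbit z ` h ` {i. u i \<noteq> i})) = stype u"
    if "u permutes C" "finite C" "inj_on h C" "\<And>a. a \<in> C \<Longrightarrow> z (h a) = h (u a)" for h u and C
  proof -
    note o = orb[of u C _ h, OF that(1) _ that(4)]
    have sub: "{i. u i \<noteq> i} \<subseteq> C" using moved_subset that by blast
    have "orbit z ` h ` {i. u i \<noteq> i} = image h ` orbit u ` {i. u i \<noteq> i}"
      unfolding image_image using o sub by (intro image_cong) auto
    moreover have inj: "inj_on (image h) (orbit u ` {i. u i \<noteq> i})"
      by (rule inj_on_subset[OF inj_on_image_Pow[OF that(3)]])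
        (use o sub in blast)
    ultimately have "mset_set (orbit z ` h ` {i. u i \<noteq> i})
        = image_mset (image h) (mset_set (orbit u ` {i. u i \<noteq> i}))"
      by (simp add: image_mset_mset_set)
    moreover have "card (h ` S) = card S" if "S \<in> orbit u ` {i. u i \<noteq> i}" for S
    proof -
      have "S \<subseteq> C" using that o sub by blast
      then show ?thesis using \<open>inj_on h C\<close> card_image inj_on_subset by metis
    qed
    moreover have "finite (orbit u ` {i. u i \<noteq> i})"
      using sub \<open>finite C\<close> finite_subset by blast
    ultimately show ?thesis
      by (auto simp: stype_def multiset.map_comp intro!: image_mset_cong)
  qed
  have mA: "{i. x i \<noteq> i} \<subseteq> A" and mB: "{i. y i \<noteq> i} \<subseteq> B"
    using moved_subset assms by metis+
  have moved: "{i. z i \<noteq> i} = f ` {i. x i \<noteq> i} \<union> g ` {i. y i \<noteq> i}"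
  proof (intro equalityI subsetI)
    fix i assume "i \<in> {i. z i \<noteq> i}"
    then have "i \<in> f ` A \<union> g ` B" "z i \<noteq> i" using z by auto
    then show "i \<in> f ` {i. x i \<noteq> i} \<union> g ` {i. y i \<noteq> i}" using zf zg by force
  next
    fix i assume "i \<in> f ` {i. x i \<noteq> i} \<union> g ` {i. y i \<noteq> i}"
    then show "i \<in> {i. z i \<noteq> i}"
    proof
      assume "i \<in> f ` {i. x i \<noteq> i}"
      then obtain a where a: "i = f a" "x a \<noteq> a" "a \<in> A" "x a \<in> A"
        using mA permutes_in_image[OF assms(3)] by blast
      then show ?thesis using zf assms(5) by (auto dest: inj_onD)
    next
      assume "i \<in> g ` {i. y i \<noteq> i}"
      then obtain a where a: "i = g a" "y a \<noteq> a" "a \<in> B" "y a \<in> B"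
        using mB permutes_in_image[OF assms(4)] by blast
      then show ?thesis using zg assms(6) by (auto dest: inj_onD)
    qed
  qed
  have disj: "orbit z ` f ` {i. x i \<noteq> i} \<inter> orbit z ` g ` {i. y i \<noteq> i} = {}"
  proof -
    have "orbit z (f a) \<noteq> orbit z (g b)" if "a \<in> A" "b \<in> B" for a b
    proof -
      have "orbit z (f a) \<subseteq> f ` A" "orbit z (g b) \<subseteq> g ` B"
        using orb[of x A a f, OF assms(3) that(1) zf] orb[of y B b g, OF assms(4) that(2) zg]
        by blast+
      then show ?thesis using assms(7) orbit_nonempty[of z "f a"] by blast
    qed
    then show ?thesis using mA mB by auto
  qed
  have "finite {i. x i \<noteq> i}" "finite {i. y i \<noteq> i}" using mA mB assms finite_subset by metis+
  then have "mset_set (orbit z ` {i. z i \<noteq> i})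
      = mset_set (orbit z ` f ` {i. x i \<noteq> i}) + mset_set (orbit z ` g ` {i. y i \<noteq> i})"
    unfolding moved image_Un using disj by (intro mset_set_Union) auto
  then have "stype z = image_mset (\<lambda>S. card S - 1) (mset_set (orbit z ` f ` {i. x i \<noteq> i}))
      + image_mset (\<lambda>S. card S - 1) (mset_set (orbit z ` g ` {i. y i \<noteq> i}))"
    by (simp add: stype_def)
  then show ?thesis
    using part[of x A f, OF assms(3,1,5) zf] part[of y B g, OF assms(4,2,6) zg] by simp
qed

lemma stype_conj:
  assumes "permutation x" "bij f"
  shows "stype (f \<circ> x \<circ> inv' f) = stype x"
proof -
  obtain A where A: "finite A" "x permutes A" using assms permutation_permutes by blast
  \<comment> \<open>A conjugate is a relabelled copy of x with an empty second copy beside it;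
    \<open>g\<close> is never evaluated.\<close>
  have "stype (f \<circ> x \<circ> inv' f) = stype x + stype (id :: nat \<Rightarrow> nat)"
  proof (rule stype_embed[where A = A and B = "{}" and f = f and g = undefined])
    show "(f \<circ> x \<circ> inv' f) i = i" if "i \<notin> f ` A \<union> undefined ` ({} :: nat set)" for i
    proof -
      have "inv' f i \<notin> A" using that assms by (metis UnI1 bij_inv_eq_iff imageI)
      then show ?thesis using A assms by (simp add: permutes_not_in bij_is_surj surj_f_inv_f)
    qed
  qed (use A assms in \<open>auto simp: bij_is_inj inj_on_def bij_def\<close>)
  then show ?thesis by (simp add: stype_def)
qed

lemma bij_betw_of_image_mset_eq:
  assumes "finite A" "finite B" "image_mset f (mset_set A) = image_mset g (mset_set B)"
  shows "\<exists>h. bij_betw h A B \<and> (\<forall>a\<in>A. g (h a) = f a)"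
  using assms
proof (induction A arbitrary: B rule: finite_induct)
  case empty
  then show ?case by (auto simp: mset_set_empty_iff bij_betw_def)
next
  case (insert a A)
  have "f a \<in># image_mset g (mset_set B)" using insert by (simp flip: insert.prems(2))
  then obtain b where b: "b \<in> B" "g b = f a" using insert by auto
  have "image_mset f (mset_set A) = image_mset g (mset_set (B - {b}))"
  proof -
    have "add_mset (f a) (image_mset f (mset_set A)) = image_mset g (mset_set (insert b (B - {b})))"
      using insert b by (simp add: insert_absorb)
    also have "\<dots> = add_mset (f a) (image_mset g (mset_set (B - {b})))"
      using insert b by (subst mset_set.insert) auto
    finally show ?thesis by simp
  qed
  then obtain h where h: "bij_betw h A (B - {b})" "\<forall>a\<in>A. g (h a) = f a"
    using insert.IH[of "B - {b}"] insert.prems by auto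
  have "bij_betw (h(a := b)) A (B - {b})"
    using h insert by (subst bij_betw_cong[of A _ h]) auto
  then have "bij_betw (h(a := b)) (insert a A) (insert b (B - {b}))"
    using insert.hyps by (intro bij_betw_combine[of _ "{a}" "{b}", simplified])
      (auto simp: bij_betw_def)
  then have "bij_betw (h(a := b)) (insert a A) B" using b by (simp add: insert_absorb)
  moreover have "\<forall>c\<in>insert a A. g ((h(a := b)) c) = f c" using h(2) b(2) insert.hyps by auto
  ultimately show ?case by blast
qed

lemma orbit_enumeration:
  assumes "permutation x"
  shows "bij_betw (\<lambda>i. (x ^^ i) a) {..<card (orbit x a)} (orbit x a)"
    and "(x ^^ card (orbit x a)) a = a"
proof -
  have a: "a \<in> orbit x a" using assms by (rule permutation_self_in_orbit)
  have o: "orbit x a = (\<lambda>n. (x ^^ n) a) ` {0..<funpow_dist1 x a a}"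
    using a by (rule orbit_conv_funpow_dist1)
  have i: "inj_on (\<lambda>n. (x ^^ n) a) {0..<funpow_dist1 x a a}"
    using a by (rule inj_on_funpow_dist1)
  have c: "card (orbit x a) = funpow_dist1 x a a" using o i by (metis card_atLeastLessThan card_image diff_zero)
  show "bij_betw (\<lambda>i. (x ^^ i) a) {..<card (orbit x a)} (orbit x a)"
    unfolding c using o i by (auto simp: bij_betw_def atLeast0LessThan)
  show "(x ^^ card (orbit x a)) a = a"
    unfolding c using a by (rule funpow_dist1_prop)
qed

lemma orbits_isomorphic:
  assumes "permutation x" "permutation y" "card (orbit x a) = card (orbit y b)"
  shows "\<exists>h. bij_betw h (orbit x a) (orbit y b) \<and> (\<forall>c\<in>orbit x a. h (x c) = y (h c))"
proof -
  define m where "m = card (orbit x a)"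
  define e where "e = (\<lambda>i. (x ^^ i) a)"
  define e' where "e' = (\<lambda>i. (y ^^ i) b)"
  have e: "bij_betw e {..<m} (orbit x a)" "e m = a"
    using orbit_enumeration[OF assms(1), of a] by (auto simp: m_def e_def)
  have e': "bij_betw e' {..<m} (orbit y b)" "e' m = b"
    using orbit_enumeration[OF assms(2), of b] assms(3) by (auto simp: m_def e'_def)
  have mpos: "m > 0" using card_orbit_pos[OF assms(1)] m_def by simp
  define h where "h = e' \<circ> inv_into {..<m} e"
  have he: "h (e i) = e' i" if "i < m" for i
    using e that by (simp add: h_def bij_betw_def)
  have "bij_betw h (orbit x a) (orbit y b)"
    unfolding h_def using bij_betw_trans[OF bij_betw_inv_into[OF e(1)] e'(1)] .
  moreover have "h (x c) = y (h c)" if "c \<in> orbit x a" for c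
  proof -
    have "c \<in> e ` {..<m}" using that bij_betw_imp_surj_on[OF e(1)] by simp
    then obtain i where i: "i < m" "c = e i" by blast
    have "x c = e (Suc i)" "y (h c) = e' (Suc i)" using i he by (simp_all add: e_def e'_def)
    note step = this
    show ?thesis
    proof (cases "Suc i < m")
      case True
      then show ?thesis unfolding step by (rule he)
    next
      \<comment> \<open>The cycle closes here: both enumerations return to index 0 because the two
        orbits have the same size m.\<close>
      case False
      then have "Suc i = m" using i by simp
      then have "e (Suc i) = e 0" "e' (Suc i) = e' 0"
        using e(2) e'(2) by (simp_all only: e_def e'_def funpow_0)
      then show ?thesis unfolding step using he[OF mpos] by simp
    qed
  qed
  ultimately show ?thesis by blast
qed

text \<open>Orbits are matched by size, and on each of them the enumerations from base points give
  an equivariant bijection; the pieces glue because orbits are disjoint.\<close>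

lemma permutes_isomorphic:
  assumes "finite V" "finite W" "x permutes V" "y permutes W"
    and "image_mset card (mset_set (orbit x ` V)) = image_mset card (mset_set (orbit y ` W))"
  shows "\<exists>h. bij_betw h V W \<and> (\<forall>a\<in>V. h (x a) = y (h a))"
proof -
  have px: "permutation x" and py: "permutation y"
    using assms permutes_imp_permutation_finite by metis+
  obtain H where H: "bij_betw H (orbit x ` V) (orbit y ` W)"
      "\<forall>S\<in>orbit x ` V. card (H S) = card S"
    using bij_betw_of_image_mset_eq[OF _ _ assms(5)] assms by auto
  have "\<forall>S\<in>orbit x ` V. \<exists>h. bij_betw h S (H S) \<and> (\<forall>c\<in>S. h (x c) = y (h c))"
  proof
    fix S assume S: "S \<in> orbit x ` V"
    then obtain a where a: "S = orbit x a" by blast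
    have "H S \<in> orbit y ` W" using S bij_betwE[OF H(1)] by blast
    then obtain b where b: "H S = orbit y b" by blast
    show "\<exists>h. bij_betw h S (H S) \<and> (\<forall>c\<in>S. h (x c) = y (h c))"
      using orbits_isomorphic[OF px py, of a b] a b H S by auto
  qed
  then obtain k where k: "\<And>S. S \<in> orbit x ` V \<Longrightarrow> bij_betw (k S) S (H S)"
      "\<And>S c. S \<in> orbit x ` V \<Longrightarrow> c \<in> S \<Longrightarrow> k S (x c) = y (k S c)"
    by metis
  define h where "h = (\<lambda>a. k (orbit x a) a)"
  have self: "a \<in> orbit x a" for a using px by (rule permutation_self_in_orbit)
  have "bij_betw h (\<Union> (orbit x ` V)) (\<Union> (orbit y ` W))"
  proof -
    have "bij_betw h (\<Union>S\<in>orbit x ` V. S) (\<Union>S\<in>orbit x ` V. H S)"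
    proof (rule bij_betw_UNION_disjoint)
      show "disjoint_family_on H (orbit x ` V)"
        unfolding disjoint_family_on_def
      proof (intro ballI impI)
        fix S S' assume *: "S \<in> orbit x ` V" "S' \<in> orbit x ` V" "S \<noteq> S'"
        then have "H S \<noteq> H S'"
          using bij_betw_imp_inj_on[OF H(1)] by (auto dest: inj_onD)
        moreover have "H S \<in> orbit y ` W" "H S' \<in> orbit y ` W"
          using * bij_betwE[OF H(1)] by blast+
        ultimately
        show "H S \<inter> H S' = {}" using disjoint_orbits[OF py] by blast
      qed
      fix S assume S: "S \<in> orbit x ` V"
      have "bij_betw h S (H S) \<longleftrightarrow> bij_betw (k S) S (H S)"
        using S permutation_orbit_eq[OF px] by (intro bij_betw_cong) (auto simp: h_def)
      then show "bij_betw h S (H S)" using k(1)[OF S] by simp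
    qed
    moreover have "(\<Union>S\<in>orbit x ` V. H S) = \<Union> (orbit y ` W)"
      unfolding bij_betw_imp_surj_on[OF H(1), symmetric] by blast
    ultimately show ?thesis by simp
  qed
  then have "bij_betw h V W" using Union_orbits assms by metis
  moreover have "h (x a) = y (h a)" if "a \<in> V" for a
  proof -
    have "orbit x (x a) = orbit x a"
      using permutation_orbit_eq[OF px] self orbit.base by metis
    then show ?thesis using k(2)[of "orbit x a" a] that self by (simp add: h_def)
  qed
  ultimately show ?thesis by blast
qed

text \<open>For a fixed total the full type is recoverable: raise every stable part by one and pad
  with ones. The stable type and n together determine the conjugacy class.\<close>

lemma orbit_type_of_stable:
  assumes "0 \<notin># \<rho>"
  shows "\<rho> = image_mset Suc (stable \<rho>) + replicate_mset (sum_mset \<rho> - wt (stable \<rho>)) 1"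
  and "wt (stable \<rho>) \<le> sum_mset \<rho>"
proof -
  have "\<rho> = image_mset Suc (stable \<rho>) + replicate_mset (sum_mset \<rho> - wt (stable \<rho>)) 1
     \<and> wt (stable \<rho>) \<le> sum_mset \<rho>"
    using assms
  proof (induction \<rho>)
    case empty
    then show ?case by (simp add: stable_def wt_def)
  next
    case (add i \<rho>)
    then have IH: "\<rho> = image_mset Suc (stable \<rho>) + replicate_mset (sum_mset \<rho> - wt (stable \<rho>)) 1"
      and le: "wt (stable \<rho>) \<le> sum_mset \<rho>" by auto
    show ?case
    proof (cases "i = 1")
      case True
      then have "stable (add_mset i \<rho>) = stable \<rho>" by (simp add: stable_def)
      have "add_mset 1 \<rho> =
          add_mset 1 (image_mset Suc (stable \<rho>) + replicate_mset (sum_mset \<rho> - wt (stable \<rho>)) 1)"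
        by (rule arg_cong[OF IH])
      also have "\<dots> = image_mset Suc (stable \<rho>)
          + replicate_mset (sum_mset (add_mset 1 \<rho>) - wt (stable \<rho>)) 1"
        using le by (simp add: Suc_diff_le)
      finally have "add_mset 1 \<rho> = \<dots>" .
      then show ?thesis
        unfolding \<open>stable (add_mset i \<rho>) = stable \<rho>\<close>[unfolded True] True
        by (rule conjI) (use le in simp)
    next
      case False
      then have s: "stable (add_mset i \<rho>) = add_mset (i - 1) (stable \<rho>)" and i: "i \<ge> 2"
        using add.prems by (auto simp: stable_def)
      have "add_mset i \<rho> =
          add_mset i (image_mset Suc (stable \<rho>) + replicate_mset (sum_mset \<rho> - wt (stable \<rho>)) 1)"
        by (rule arg_cong[OF IH])
      also have "\<dots> = image_mset Suc (stable (add_mset i \<rho>))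
          + replicate_mset (sum_mset (add_mset i \<rho>) - wt (stable (add_mset i \<rho>))) 1"
        unfolding s using i by (simp add: wt_def)
      finally show ?thesis by (rule conjI) (use s le i in \<open>simp add: wt_def\<close>)
    qed
  qed
  then show "\<rho> = image_mset Suc (stable \<rho>) + replicate_mset (sum_mset \<rho> - wt (stable \<rho>)) 1"
    and "wt (stable \<rho>) \<le> sum_mset \<rho>" by auto
qed

text \<open>Equal stable types on the same V mean equal cycle types, and an equivariant bijection of
  V, extended by the identity, is the conjugating permutation.\<close>

lemma conj_of_stype_eq:
  assumes "finite V" "x permutes V" "y permutes V" "stype x = stype y"
  shows "\<exists>c. c permutes V \<and> y = c \<circ> x \<circ> inv' c"
proof -
  have *: "image_mset card (mset_set (orbit u ` V))
     = image_mset Suc (stype u) + replicate_mset (card V - wt (stype u)) 1" if "u permutes V" for u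
  proof -
    have p: "permutation u" using assms that permutes_imp_permutation_finite by metis
    have "0 \<notin># image_mset card (mset_set (orbit u ` V))"
      using card_orbit_pos[OF p] assms(1) by (auto simp: image_iff)
    moreover have "sum_mset (image_mset card (mset_set (orbit u ` V))) = card V"
      using card_eq_sum_orbits[OF assms(1) that] by (simp add: sum_unfold_sum_mset)
    ultimately show ?thesis
      using orbit_type_of_stable(1) stable_orbits[OF assms(1) that] by metis
  qed
  obtain h where h: "bij_betw h V V" "\<forall>a\<in>V. h (x a) = y (h a)"
    using permutes_isomorphic[OF assms(1,1,2,3)] *[OF assms(2)] *[OF assms(3)] assms(4) by auto
  define c where "c = (\<lambda>a. if a \<in> V then h a else a)"
  have c: "c permutes V"
    unfolding c_def using h(1) by (intro bij_imp_permutes) (auto cong: bij_betw_cong)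
  have "c (x a) = y (c a)" for a
    using h(2) assms(2,3) by (auto simp: c_def permutes_in_image permutes_not_in)
  then have "y = c \<circ> x \<circ> inv' c"
    using c by (auto simp: fun_eq_iff permutes_inverses)
  then show ?thesis using c by blast
qed

lemma stype_cycle_of_list:
  assumes "distinct cs" "length cs = Suc k" "k > 0"
  shows "stype (cycle_of_list cs) = {#k#}"
proof -
  let ?c = "cycle_of_list cs"
  have c: "?c permutes set cs" by (rule cycle_permutes)
  have p: "permutation ?c" using c by (rule permutes_imp_permutation_finite[OF finite_set])
  have "orbit ?c a = set cs" if a: "a \<in> set cs" for a
  proof (intro equalityI subsetI)
    fix b assume "b \<in> set cs"
    then obtain i j where ij: "i < length cs" "j < length cs" "cs ! i = a" "cs ! j = b"
      using a by (auto simp: in_set_conv_nth)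
    \<comment> \<open>Rotating by j - i modulo the length carries position i to position j; the
      length is added so that no subtraction is truncated.\<close>
    define m where "m = j + (length cs - i)"
    have "(?c ^^ m) a = rotate m cs ! i"
      using cyclic_rotation[OF assms(1), of m] ij by (metis nth_map)
    also have "\<dots> = cs ! ((m + i) mod length cs)" using ij by (simp add: nth_rotate add.commute)
    also have "(m + i) mod length cs = j" using ij by (simp add: m_def)
    finally show "b \<in> orbit ?c a" using ij(4) unfolding orbit_altdef_permutation[OF p] by auto
  qed (use permutes_orbit_subset[OF c a] in blast)
  then have "orbit ?c ` set cs = (\<lambda>a. set cs) ` set cs" by (intro image_cong) auto
  also have "\<dots> = {set cs}" using assms(2) by (intro image_constant[of "hd cs"]) (auto intro!: hd_in_set)
  finally show ?thesis
    using stable_orbits[OF _ c] assms distinct_card[OF assms(1)] by (simp add: stable_def)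
qed

lemma ex_stype:
  assumes "\<nu> \<in> partitions"
  shows "\<exists>z. z permutes {1..wt \<nu>} \<and> stype z = \<nu>"
  using assms
proof (induction \<nu>)
  case empty
  have "stype id = {#}" by (simp add: stype_def)
  then show ?case using permutes_id by blast
next
  case (add k \<nu>)
  define s where "s = wt \<nu>"
  obtain z where z: "z permutes {1..s}" "stype z = \<nu>"
    using add by (auto simp: partitions_def s_def)
  have k: "k > 0" using add.prems by (auto simp: partitions_def)
  \<comment> \<open>A part k of the stable type is a cycle on k + 1 points, placed on the first
    points not yet used; the total number of points is then exactly the weight.\<close>
  let ?B = "{s + 1..s + Suc k}"
  define c where "c = cycle_of_list [s + 1..<s + k + 2]"
  have "set [s + 1..<s + k + 2] = ?B" by auto
  then have c: "c permutes ?B" unfolding c_def using cycle_permutes[of "[s + 1..<s + k + 2]"] by simp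
  have sc: "stype c = {#k#}"
    unfolding c_def by (rule stype_cycle_of_list) (use k in auto)
  have "stype (c \<circ> z) = stype z + stype c"
  proof (rule stype_embed[where A = "{1..s}" and B = ?B and f = id and g = id])
    show "(c \<circ> z) (id a) = id (z a)" if "a \<in> {1..s}" for a
    proof -
      have "z a \<notin> ?B" using permutes_in_image[OF z(1), of a] that by auto
      then show ?thesis using permutes_not_in[OF c] by simp
    qed
    show "(c \<circ> z) (id b) = id (c b)" if "b \<in> ?B" for b
    proof -
      have "b \<notin> {1..s}" using that by auto
      then show ?thesis using permutes_not_in[OF z(1)] by simp
    qed
    show "(c \<circ> z) i = i" if "i \<notin> id ` {1..s} \<union> id ` ?B" for i
      using that permutes_not_in[OF z(1), of i] permutes_not_in[OF c, of i] by (simp add: image_id)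
  qed (use z c in auto)
  moreover have "c \<circ> z permutes {1..wt (add_mset k \<nu>)}"
    by (intro permutes_compose permutes_subset[OF z(1)] permutes_subset[OF c]) (auto simp: wt_def s_def)
  ultimately show ?case using z(2) sc by auto
qed

section \<open>Invariant sets and geodesic factorizations\<close>

text \<open>Stated as an equivalence so that closure under symmetric difference, the addition of the
  vector space over the field with two elements, is immediate.\<close>

definition invariant_sets :: "'a set \<Rightarrow> ('a \<Rightarrow> 'a) \<Rightarrow> 'a set set" where
  "invariant_sets V x = {T. T \<subseteq> V \<and> (\<forall>a. x a \<in> T \<longleftrightarrow> a \<in> T)}"

text \<open>Invariant sets are the unions of orbits, so the dimension of this space is the number of
  orbits.\<close>

lemma card_invariant_sets:
  assumes "finite V" "x permutes V"
  shows "card (invariant_sets V x) = 2 ^ card (orbit x ` V)"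
proof -
  have p: "permutation x" using assms permutes_imp_permutation_finite by metis
  have self: "a \<in> orbit x a" for a using p by (rule permutation_self_in_orbit)
  have "bij_betw Union (Pow (orbit x ` V)) (invariant_sets V x)"
  proof (rule bij_betw_byWitness[where f' = "\<lambda>T. orbit x ` T"])
    show "\<forall>\<S>\<in>Pow (orbit x ` V). orbit x ` \<Union> \<S> = \<S>"
    proof
      fix \<S> assume \<S>: "\<S> \<in> Pow (orbit x ` V)"
      have *: "orbit x a = S" if "a \<in> S" "S \<in> \<S>" for a S
        using that \<S> permutation_orbit_eq[OF p] by blast
      show "orbit x ` \<Union> \<S> = \<S>"
      proof (intro equalityI subsetI)
        fix S assume "S \<in> \<S>"
        moreover obtain a where "a \<in> S" using \<open>S \<in> \<S>\<close> \<S> self by blast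
        ultimately show "S \<in> orbit x ` \<Union> \<S>" using * by blast
      qed (use * in blast)
    qed
    show "\<forall>T\<in>invariant_sets V x. \<Union> (orbit x ` T) = T"
    proof
      fix T assume T: "T \<in> invariant_sets V x"
      have "b \<in> T" if "b \<in> orbit x a" "a \<in> T" for a b
        using that T by (induction rule: orbit.induct) (auto simp: invariant_sets_def)
      then show "\<Union> (orbit x ` T) = T" using self by blast
    qed
    show "Union ` Pow (orbit x ` V) \<subseteq> invariant_sets V x"
    proof
      fix T assume "T \<in> Union ` Pow (orbit x ` V)"
      then obtain \<S> where \<S>: "\<S> \<subseteq> orbit x ` V" "T = \<Union> \<S>" by blast
      have "x a \<in> S \<longleftrightarrow> a \<in> S" if S: "S \<in> \<S>" for a S
      proof -
        obtain b where b: "S = orbit x b" using subsetD[OF \<S>(1) S] by (elim imageE)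
        show ?thesis
          using permutation_orbit_eq[OF p, of "x a" b] permutation_orbit_step[OF p, of a] self[of a]
            orbit.step[of a x b] b by auto
      qed
      then have "x a \<in> T \<longleftrightarrow> a \<in> T" for a using \<S> by blast
      moreover have "T \<subseteq> V" using \<S> Union_orbits[OF assms] by blast
      ultimately show "T \<in> invariant_sets V x" by (simp add: invariant_sets_def)
    qed
    show "(`) (orbit x) ` invariant_sets V x \<subseteq> Pow (orbit x ` V)"
      by (auto simp: invariant_sets_def)
  qed
  then have "card (invariant_sets V x) = card (Pow (orbit x ` V))"
    by (simp add: bij_betw_same_card)
  then show ?thesis using assms by (simp add: card_Pow)
qed

text \<open>The invariant sets form subspaces of the space of subsets over the field with two
  elements, and the dimension formula for the sum and intersection of the two subspaces
  gives the bound.\<close>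

lemma card_invariant_sets_Int:
  assumes "finite V"
  shows "card (invariant_sets V x) * card (invariant_sets V y)
    \<le> 2 ^ card V * card (invariant_sets V x \<inter> invariant_sets V y)"
proof -
  define d :: "'a set \<times> 'a set \<Rightarrow> 'a set" where "d = (\<lambda>(T, Y). (T - Y) \<union> (Y - T))"
  let ?A = "invariant_sets V x" and ?B = "invariant_sets V y"
  have sub: "?A \<subseteq> Pow V" "?B \<subseteq> Pow V" by (auto simp: invariant_sets_def)
  then have fin: "finite ?A" "finite ?B" using assms finite_subset by (metis finite_Pow_iff)+
  have dA: "d (T, T') \<in> ?A" if "T \<in> ?A" "T' \<in> ?A" for T T'
    using that by (auto simp: invariant_sets_def d_def)
  have dB: "d (T, T') \<in> ?B" if "T \<in> ?B" "T' \<in> ?B" for T T'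
    using that by (auto simp: invariant_sets_def d_def)
  \<comment> \<open>A nonempty fibre of the symmetric difference is a translate of its kernel, the
    pairs with equal entries; translating by a base point (T0, Y0) embeds it into the
    intersection.\<close>
  have fib: "card {p \<in> ?A \<times> ?B. d p = Z} \<le> card (?A \<inter> ?B)" for Z
  proof (cases "{p \<in> ?A \<times> ?B. d p = Z} = {}")
    case False
    then obtain T0 Y0 where 0: "T0 \<in> ?A" "Y0 \<in> ?B" "d (T0, Y0) = Z" by auto
    show ?thesis
    proof (rule card_inj_on_le[where f = "\<lambda>(T, Y). d (T, T0)"])
      show "inj_on (\<lambda>(T, Y). d (T, T0)) {p \<in> ?A \<times> ?B. d p = Z}"
      proof (rule inj_onI)
        fix p q assume *: "p \<in> {p \<in> ?A \<times> ?B. d p = Z}" "q \<in> {p \<in> ?A \<times> ?B. d p = Z}"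
          "(\<lambda>(T, Y). d (T, T0)) p = (\<lambda>(T, Y). d (T, T0)) q"
        obtain T Y T' Y' where pq: "p = (T, Y)" "q = (T', Y')" by (metis surj_pair)
        have "T = T'" using *(3) by (auto simp: pq d_def)
        moreover have "d (T, Y) = d (T', Y')" using * by (simp add: pq)
        ultimately show "p = q" by (auto simp: pq d_def)
      qed
      show "(\<lambda>(T, Y). d (T, T0)) ` {p \<in> ?A \<times> ?B. d p = Z} \<subseteq> ?A \<inter> ?B"
      proof
        fix W assume "W \<in> (\<lambda>(T, Y). d (T, T0)) ` {p \<in> ?A \<times> ?B. d p = Z}"
        then obtain T Y where XY: "T \<in> ?A" "Y \<in> ?B" "d (T, Y) = Z" "W = d (T, T0)" by auto
        \<comment> \<open>T + Y = T0 + Y0 in the vector space, hence T + T0 = Y + Y0, an element of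
          both families.\<close>
        have "d (T, T0) = d (Y, Y0)"
        proof -
          have "d (T, Y) = d (T0, Y0)" using XY 0 by simp
          then have "(a \<in> T \<longleftrightarrow> a \<notin> Y) \<longleftrightarrow> (a \<in> T0 \<longleftrightarrow> a \<notin> Y0)" for a
            by (auto simp: d_def set_eq_iff)
          then show ?thesis by (auto simp: d_def)
        qed
        then show "W \<in> ?A \<inter> ?B" using dA[OF XY(1) 0(1)] dB[OF XY(2) 0(2)] XY by simp
      qed
      show "finite (?A \<inter> ?B)" using fin by simp
    qed
  next
    case True
    show ?thesis unfolding True by simp
  qed
  have "card ?A * card ?B = card (?A \<times> ?B)" by (simp add: card_cartesian_product)
  also have "\<dots> = (\<Sum>p\<in>?A \<times> ?B. 1)" by simp
  also have "\<dots> = (\<Sum>Z\<in>Pow V. \<Sum>p | p \<in> ?A \<times> ?B \<and> d p = Z. 1)"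
    using fin assms sub by (intro sum.group[symmetric]) (auto simp: d_def)
  also have "\<dots> = (\<Sum>Z\<in>Pow V. card {p \<in> ?A \<times> ?B. d p = Z})" by simp
  also have "\<dots> \<le> (\<Sum>Z\<in>Pow V. card (?A \<inter> ?B))" using fib by (intro sum_mono)
  also have "\<dots> = 2 ^ card V * card (?A \<inter> ?B)" using assms by (simp add: card_Pow)
  finally show ?thesis .
qed

text \<open>What is invariant under x and y is invariant under the product, so the product has at
  least as many orbits as the intersection has dimensions. If the bound is attained, the
  intersection has full dimension, and no set is invariant under the product alone.\<close>

lemma
  assumes "finite V" "x permutes V" "y permutes V"
  shows card_orbits_comp: "card (orbit x ` V) + card (orbit y ` V) \<le> card V + card (orbit (x \<circ> y) ` V)"
    and invariant_sets_comp: "card (orbit x ` V) + card (orbit y ` V) = card V + card (orbit (x \<circ> y) ` V)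
      \<Longrightarrow> invariant_sets V (x \<circ> y) \<subseteq> invariant_sets V x \<inter> invariant_sets V y"
proof -
  let ?A = "invariant_sets V x" and ?B = "invariant_sets V y" and ?C = "invariant_sets V (x \<circ> y)"
  have sub: "?A \<inter> ?B \<subseteq> ?C" by (auto simp: invariant_sets_def)
  have fin: "finite ?C" using assms(1) by (auto simp: invariant_sets_def intro: finite_subset[of _ "Pow V"])
  have xy: "x \<circ> y permutes V" using assms permutes_compose by blast
  have "2 ^ (card (orbit x ` V) + card (orbit y ` V)) = card ?A * card ?B"
    using card_invariant_sets[OF assms(1,2)] card_invariant_sets[OF assms(1,3)]
    by (simp add: power_add)
  also have "\<dots> \<le> 2 ^ card V * card (?A \<inter> ?B)"
    by (rule card_invariant_sets_Int[OF assms(1)])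
  finally have 1: "2 ^ (card (orbit x ` V) + card (orbit y ` V)) \<le> 2 ^ card V * card (?A \<inter> ?B)" .
  also have "\<dots> \<le> 2 ^ card V * card ?C"
    using card_mono[OF fin sub] by simp
  also have "\<dots> = 2 ^ (card V + card (orbit (x \<circ> y) ` V))"
    using card_invariant_sets[OF assms(1) xy] by (simp add: power_add)
  finally show "card (orbit x ` V) + card (orbit y ` V) \<le> card V + card (orbit (x \<circ> y) ` V)"
    by simp
  assume "card (orbit x ` V) + card (orbit y ` V) = card V + card (orbit (x \<circ> y) ` V)"
  then have "2 ^ card V * card ?C \<le> 2 ^ card V * card (?A \<inter> ?B)"
    using 1 card_invariant_sets[OF assms(1) xy] by (simp add: power_add)
  then have "card ?C \<le> card (?A \<inter> ?B)" by simp
  then have "?A \<inter> ?B = ?C" using card_seteq[OF fin sub] by simp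
  then show "?C \<subseteq> ?A \<inter> ?B" by simp
qed

lemma sum_mset_stype_comp:
  assumes "finite V" "x permutes V" "y permutes V"
  shows "sum_mset (stype (x \<circ> y)) \<le> sum_mset (stype x) + sum_mset (stype y)"
  using card_orbits_comp[OF assms] sum_mset_stype[OF assms(1,2)] sum_mset_stype[OF assms(1,3)]
    sum_mset_stype[OF assms(1) permutes_compose[OF assms(3,2)]] by linarith

text \<open>Additivity of lengths is the equality case of the orbit bound. In this form geodesics
  are used later: invariant sets of the product pass to the right factor.\<close>

lemma invariant_of_geodesic:
  assumes "finite V" "x permutes V" "y permutes V"
    and "sum_mset (stype (x \<circ> y)) = sum_mset (stype x) + sum_mset (stype y)"
    and "T \<subseteq> V" "\<And>a. (x \<circ> y) a \<in> T \<longleftrightarrow> a \<in> T"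
  shows "y a \<in> T \<longleftrightarrow> a \<in> T"
proof -
  have "card (orbit x ` V) + card (orbit y ` V) = card V + card (orbit (x \<circ> y) ` V)"
    using assms(4) sum_mset_stype[OF assms(1,2)] sum_mset_stype[OF assms(1,3)]
      sum_mset_stype[OF assms(1) permutes_compose[OF assms(3,2)]] by linarith
  moreover have "T \<in> invariant_sets V (x \<circ> y)" using assms by (simp add: invariant_sets_def)
  ultimately have "T \<in> invariant_sets V y" using invariant_sets_comp[OF assms(1-3)] by blast
  then show ?thesis by (simp add: invariant_sets_def)
qed

section \<open>Integer-valued polynomials and interpolation\<close>

lemma int_valued_add: "p \<in> int_valued \<Longrightarrow> q \<in> int_valued \<Longrightarrow> p + q \<in> int_valued"
  by (simp add: int_valued_def)

lemma int_valued_uminus: "p \<in> int_valued \<Longrightarrow> - p \<in> int_valued"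
  by (simp add: int_valued_def)

lemma int_valued_mult: "p \<in> int_valued \<Longrightarrow> q \<in> int_valued \<Longrightarrow> p * q \<in> int_valued"
  by (simp add: int_valued_def)

lemma int_valued_of_nat: "of_nat k \<in> int_valued"
  by (simp add: int_valued_def of_nat_poly)

lemma int_valued_0 [simp]: "0 \<in> int_valued" and int_valued_1 [simp]: "1 \<in> int_valued"
  by (simp_all add: int_valued_def)

lemma int_valued_sum: "(\<And>i. i \<in> I \<Longrightarrow> p i \<in> int_valued) \<Longrightarrow> sum p I \<in> int_valued"
  by (induction I rule: infinite_finite_induct) (auto intro: int_valued_add)

lemma gbinomial_of_int_in_Ints: "(of_int m :: rat) gchoose r \<in> \<int>"
proof (cases "m \<ge> 0")
  case True
  then have "(of_int m :: rat) = of_nat (nat m)" by simp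
  then show ?thesis by (metis Ints_of_nat binomial_gbinomial)
next
  case False
  \<comment> \<open>Upper negation replaces the negative upper index m by r - m - 1, which is a
    natural number.\<close>
  then have "of_nat r - (of_int m :: rat) - 1 = of_nat (nat (int r - m - 1))" by simp
  then have "(of_int m :: rat) gchoose r = (- 1) ^ r * of_nat (nat (int r - m - 1) choose r)"
    by (metis binomial_gbinomial gbinomial_negated_upper)
  then show ?thesis by simp
qed

text \<open>The polynomial is the binomial coefficient of X - s over r. Integrality is required at
  all integers, also below s, where the generalized binomial coefficient takes over from the
  truncated \<open>n - s\<close>.\<close>

lemma ex_int_valued_binomial:
  "\<exists>p\<in>int_valued. \<forall>n\<ge>s. poly p (of_nat n) = of_nat ((n - s) choose r)"
proof -
  define p :: "rat poly" where
    "p = smult (1 / fact r) (\<Prod>i = 0..<r. [:- of_nat s - of_nat i, 1:])"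
  have p: "poly p x = (x - of_nat s) gchoose r" for x
    by (simp add: p_def poly_prod gbinomial_prod_rev algebra_simps)
  have "p \<in> int_valued"
    using gbinomial_of_int_in_Ints[of "m - int s" r for m] by (simp add: int_valued_def p)
  moreover have "poly p (of_nat n) = of_nat ((n - s) choose r)" if "n \<ge> s" for n
    using that by (simp add: p binomial_gbinomial of_nat_diff)
  ultimately show ?thesis by blast
qed

lemma poly_eq_of_nat_eq:
  fixes p q :: "rat poly"
  assumes "\<And>n. n \<ge> N \<Longrightarrow> poly p (of_nat n) = poly q (of_nat n)"
  shows "p = q"
proof (rule ccontr)
  assume "p \<noteq> q"
  then have "finite {x. poly (p - q) x = 0}" by (intro poly_roots_finite) simp
  moreover have "of_nat ` {N..} \<subseteq> {x. poly (p - q) x = 0}" using assms by auto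
  ultimately have "finite ((of_nat :: nat \<Rightarrow> rat) ` {N..})" using finite_subset by blast
  then have "finite {N..}" by (rule finite_imageD) (simp add: inj_on_def)
  then show False using infinite_Ici[of N] by simp
qed

text \<open>Agreement at infinitely many integers determines a polynomial, so exhibiting one
  solution already evaluates the definite description.\<close>

lemma interpolant_eq:
  assumes "p \<in> int_valued" "\<And>n. n \<ge> N \<Longrightarrow> poly p (of_nat n) = of_int (s n)"
  shows "interpolant s N = p"
  unfolding interpolant_def
  by (rule the_equality) (use assms poly_eq_of_nat_eq[of N _ p] in auto)

section \<open>Counting elements by their supports\<close>

lemma permutation_moving_subset:
  assumes "finite V" "A \<subseteq> U" "A \<subseteq> U'" "U \<subseteq> V" "U' \<subseteq> V" "card U = card U'"
  shows "\<exists>c. c permutes V \<and> (\<forall>i\<in>A. c i = i) \<and> c ` U = U'"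
proof -
  have fin: "finite U" "finite U'" using assms(1,4,5) by (simp_all add: finite_subset)
  have finA: "finite A" using fin(1) assms(2) by (rule finite_subset[rotated])
  have "card (U - A) = card (U' - A)"
    using card_Diff_subset[OF finA assms(2)] card_Diff_subset[OF finA assms(3)] assms(6) by simp
  then obtain f where f: "bij_betw f (U - A) (U' - A)"
    using finite_same_card_bij[of "U - A" "U' - A"] fin by auto
  have "card (V - U) = card (V - U')"
    using card_Diff_subset[OF fin(1) assms(4)] card_Diff_subset[OF fin(2) assms(5)] assms(6) by simp
  then obtain g where g: "bij_betw g (V - U) (V - U')"
    using finite_same_card_bij[of "V - U" "V - U'"] assms(1) by auto
  \<comment> \<open>Three pieces: the identity on A, a bijection from the rest of U to the rest of
    U', and one between the complements in V.\<close>
  define c where "c = (\<lambda>i. if i \<in> U - A then f i else if i \<in> V - U then g i else i)"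
  have cf: "bij_betw c (U - A) (U' - A)"
    using f by (subst bij_betw_cong[of _ _ f]) (auto simp: c_def)
  have cg: "bij_betw c (V - U) (V - U')"
    using g by (subst bij_betw_cong[of _ _ g]) (auto simp: c_def)
  have cA: "bij_betw c A A"
    using assms(2) by (subst bij_betw_cong[of _ _ id]) (auto simp: c_def)
  have "bij_betw c (A \<union> (U - A)) (A \<union> (U' - A))"
    by (rule bij_betw_combine[OF cA cf]) auto
  then have cU: "bij_betw c U U'" using assms by (simp add: Un_absorb1)
  have "bij_betw c (U \<union> (V - U)) (U' \<union> (V - U'))"
    by (rule bij_betw_combine[OF cU cg]) auto
  then have "bij_betw c V V" using assms by (simp add: Un_absorb1)
  then have "c permutes V"
    by (rule bij_imp_permutes) (use assms in \<open>auto simp: c_def\<close>)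
  moreover have "\<forall>i\<in>A. c i = i" using assms(2) by (auto simp: c_def)
  ultimately show ?thesis using cU by (auto simp: bij_betw_def)
qed

text \<open>Sorting the elements of \<open>Y\<close> by the set \<open>D y \<union> {1..s}\<close>, the number of
  elements with \<open>D y \<subseteq> {1..n}\<close> is a combination of the binomial coefficients
  \<open>n - s\<close> over \<open>r\<close> whose coefficients do not depend on \<open>n\<close>.\<close>

lemma ex_int_valued_count:
  fixes D :: "'y \<Rightarrow> nat set"
  assumes fin: "\<And>n. finite {y \<in> Y. D y \<subseteq> {1..n}}"
    and D: "\<And>y. y \<in> Y \<Longrightarrow> finite (D y) \<and> 0 \<notin> D y \<and> card (D y) \<le> R"
    and act: "\<And>c m. c permutes {1..m} \<Longrightarrow> (\<forall>i\<in>{1..s}. c i = i) \<Longrightarrow>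
      \<exists>f. inj_on f Y \<and> f ` Y \<subseteq> Y \<and> (\<forall>y\<in>Y. D (f y) = c ` D y)"
  shows "\<exists>p\<in>int_valued. \<forall>n\<ge>s. poly p (of_nat n) = of_nat (card {y \<in> Y. D y \<subseteq> {1..n}})"
proof -
  define N where "N = (\<lambda>U. card {y \<in> Y. D y \<union> {1..s} = U})"
  have fN: "finite {y \<in> Y. D y \<union> {1..s} = U}" if "U \<subseteq> {1..m}" for U m
    by (rule finite_subset[OF _ fin[of m]]) (use that in auto)
  \<comment> \<open>A permutation that fixes {1..s} pointwise and carries U to U' acts on Y, so the
    count depends only on the size of U; equality follows by exchanging U and U'.\<close>
  have N_le: "N U \<le> N U'" if "{1..s} \<subseteq> U" "{1..s} \<subseteq> U'" "U \<subseteq> {1..m}" "U' \<subseteq> {1..m}"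
      "card U = card U'" for U U' m
  proof -
    have "\<exists>c. c permutes {1..m} \<and> (\<forall>i\<in>{1..s}. c i = i) \<and> c ` U = U'"
      by (rule permutation_moving_subset[OF finite_atLeastAtMost that])
    then obtain c where c: "c permutes {1..m}" "\<forall>i\<in>{1..s}. c i = i" "c ` U = U'" by blast
    obtain f where f: "inj_on f Y" "f ` Y \<subseteq> Y" "\<forall>y\<in>Y. D (f y) = c ` D y"
      using act[OF c(1,2)] by blast
    have "c ` {1..s} = {1..s}" using c(2) by simp
    then have "f ` {y \<in> Y. D y \<union> {1..s} = U} \<subseteq> {y \<in> Y. D y \<union> {1..s} = U'}"
      using f(2,3) c(3) by (auto simp flip: image_Un)
    moreover have "inj_on f {y \<in> Y. D y \<union> {1..s} = U}"
      using f(1) by (rule inj_on_subset) auto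
    ultimately show ?thesis unfolding N_def using fN[OF that(4)] by (intro card_inj_on_le[where f = f])
  qed
  define M where "M = (\<lambda>r. N {1..s + r})"
  have NM: "N U = M (card U - s)" if "{1..s} \<subseteq> U" "U \<subseteq> {1..n}" for U n
  proof -
    have "finite U" using that finite_subset by blast
    then have "card U \<ge> s" using card_mono[OF _ that(1)] by simp
    then have "card U = card {1..s + (card U - s)}" by simp
    moreover have "card U \<le> n" using card_mono[OF _ that(2)] by simp
    ultimately show ?thesis unfolding M_def
      using that \<open>card U \<ge> s\<close> by (intro antisym N_le[where m = n]) auto
  qed
  \<comment> \<open>A support has at most R points, so it cannot fill more than R points beyond
    {1..s}. This bounds the sum independently of n and makes it a polynomial.\<close>
  have M0: "M r = 0" if "r > R" for r
  proof -
    have "D y \<union> {1..s} \<noteq> {1..s + r}" if "y \<in> Y" for y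
    proof
      assume "D y \<union> {1..s} = {1..s + r}"
      then have *: "{1..s + r} \<subseteq> D y \<union> {1..s}" by simp
      have "{s + 1..s + r} \<subseteq> D y"
      proof
        fix i assume "i \<in> {s + 1..s + r}"
        then have "i \<in> {1..s + r}" "i \<notin> {1..s}" by auto
        then show "i \<in> D y" using * by blast
      qed
      then have "r \<le> card (D y)" using card_mono[of "D y" "{s + 1..s + r}"] D[OF that] by simp
      then show False using D[OF that] \<open>r > R\<close> by simp
    qed
    then have "{y \<in> Y. D y \<union> {1..s} = {1..s + r}} = {}" by blast
    then show ?thesis by (simp only: M_def N_def card.empty)
  qed
  have count: "card {y \<in> Y. D y \<subseteq> {1..n}} = (\<Sum>r\<le>R. ((n - s) choose r) * M r)" if "n \<ge> s" for n
  proof -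
    have "card {y \<in> Y. D y \<subseteq> {1..n}} = (\<Sum>y | y \<in> Y \<and> D y \<subseteq> {1..n}. 1)" by simp
    also have "\<dots> = (\<Sum>W\<in>Pow {s + 1..n}. \<Sum>y | y \<in> {y \<in> Y. D y \<subseteq> {1..n}} \<and> D y - {1..s} = W. 1)"
      using fin by (intro sum.group[symmetric]) auto
    also have "\<dots> = (\<Sum>W\<in>Pow {s + 1..n}. M (card W))"
    proof (rule sum.cong[OF refl])
      fix W assume W: "W \<in> Pow {s + 1..n}"
      have "{y. y \<in> {y \<in> Y. D y \<subseteq> {1..n}} \<and> D y - {1..s} = W} = {y \<in> Y. D y \<union> {1..s} = W \<union> {1..s}}"
      proof -
        have "W \<inter> {1..s} = {}" "W \<subseteq> {1..n}" "{1..s} \<subseteq> {1..n}" using W that by auto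
        then have "D y \<subseteq> {1..n} \<and> D y - {1..s} = W \<longleftrightarrow> D y \<union> {1..s} = W \<union> {1..s}" for y by blast
        then show ?thesis by blast
      qed
      then have "(\<Sum>y | y \<in> {y \<in> Y. D y \<subseteq> {1..n}} \<and> D y - {1..s} = W. 1) = N (W \<union> {1..s})"
        by (simp add: N_def)
      also have "\<dots> = M (card (W \<union> {1..s}) - s)" using W that by (intro NM[of _ n]) auto
      also have "card (W \<union> {1..s}) = card W + s"
      proof -
        have "finite W" using W finite_subset by blast
        then have "card (W \<union> {1..s}) = card W + card {1..s}"
          using W by (intro card_Un_disjoint) auto
        then show ?thesis by simp
      qed
      finally show "(\<Sum>y | y \<in> {y \<in> Y. D y \<subseteq> {1..n}} \<and> D y - {1..s} = W. 1) = M (card W)" by simp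
    qed
    also have "\<dots> = (\<Sum>r\<le>n - s. \<Sum>W | W \<in> Pow {s + 1..n} \<and> card W = r. M (card W))"
      by (intro sum.group[symmetric]) (auto dest: card_mono[rotated])
    also have "\<dots> = (\<Sum>r\<le>n - s. ((n - s) choose r) * M r)"
    proof (rule sum.cong[OF refl])
      fix r
      have "(\<Sum>W | W \<in> Pow {s + 1..n} \<and> card W = r. M (card W))
          = (\<Sum>W | W \<subseteq> {s + 1..n} \<and> card W = r. M r)" by (intro sum.cong) auto
      also have "\<dots> = ((n - s) choose r) * M r" using n_subsets[of "{s + 1..n}" r] by simp
      finally show "(\<Sum>W | W \<in> Pow {s + 1..n} \<and> card W = r. M (card W)) = ((n - s) choose r) * M r" .
    qed
    \<comment> \<open>The upper limit can be raised because the binomial coefficient vanishes beyond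
      \<open>n - s\<close>, and then lowered to R because M vanishes beyond R.\<close>
    also have "\<dots> = (\<Sum>r\<le>max R (n - s). ((n - s) choose r) * M r)"
      by (intro sum.mono_neutral_left) auto
    also have "\<dots> = (\<Sum>r\<le>R. ((n - s) choose r) * M r)"
      using M0 by (intro sum.mono_neutral_right) auto
    finally show ?thesis .
  qed
  obtain b where b: "\<And>r. b r \<in> int_valued"
      "\<And>r n. n \<ge> s \<Longrightarrow> poly (b r) (of_nat n) = of_nat ((n - s) choose r)"
    using ex_int_valued_binomial[of s] by metis
  have "(\<Sum>r\<le>R. b r * of_nat (M r)) \<in> int_valued"
    by (intro int_valued_sum int_valued_mult b int_valued_of_nat)
  moreover have "poly (\<Sum>r\<le>R. b r * of_nat (M r)) (of_nat n) = of_nat (card {y \<in> Y. D y \<subseteq> {1..n}})"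
    if "n \<ge> s" for n
    unfolding count[OF that] using that by (simp add: poly_sum b)
  ultimately show ?thesis by blast
qed

text \<open>A function that is constant on the level sets of \<open>ty\<close> is the combination of
  their indicators with its own values as coefficients. Every index is the type of some element of
  S, so evaluation there forces the coefficient.\<close>

lemma basis_coeffs_eq:
  assumes e: "\<And>\<nu>. e \<nu> = (\<lambda>x. if x \<in> S \<and> ty x = \<nu> then 1 else 0)"
    and ty: "ty ` S = {\<nu> \<in> partitions. wt \<nu> \<le> n}"
    and fin: "finite (ty ` S)"
    and u0: "\<And>x. x \<notin> S \<Longrightarrow> u x = 0"
    and u: "\<And>x y. x \<in> S \<Longrightarrow> y \<in> S \<Longrightarrow> ty x = ty y \<Longrightarrow> u x = u y"
    and x: "x \<in> S"
  shows "basis_coeffs n e u (ty x) = u x"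
proof -
  let ?P = "\<lambda>c. (\<forall>\<nu>. \<not> (\<nu> \<in> partitions \<and> wt \<nu> \<le> n) \<longrightarrow> c \<nu> = 0) \<and>
     u = (\<lambda>x. \<Sum>\<nu> \<in> {\<nu> \<in> partitions. wt \<nu> \<le> n}. c \<nu> * e \<nu> x)"
  have ev: "(\<Sum>\<nu> \<in> ty ` S. c \<nu> * e \<nu> x) = (if x \<in> S then c (ty x) else 0)" for c x
    using fin by (auto simp: e if_distrib[of "\<lambda>t. _ * t"] cong: if_cong)
  define c0 where "c0 = (\<lambda>\<nu>. if \<nu> \<in> ty ` S then u (inv_into S ty \<nu>) else 0)"
  have c0: "c0 (ty x) = u x" if "x \<in> S" for x
    unfolding c0_def using that u[of "inv_into S ty (ty x)" x] by (simp add: inv_into_into f_inv_into_f)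
  have "?P c0"
    unfolding ty[symmetric] using c0 u0 by (auto simp: ev fun_eq_iff) (auto simp: c0_def ty)
  moreover have "c = c0" if "?P c" for c
  proof
    fix \<nu>
    have uc: "u x = (if x \<in> S then c (ty x) else 0)" for x
      using that unfolding ty[symmetric] by (metis (no_types, lifting) ev)
    show "c \<nu> = c0 \<nu>"
    proof (cases "\<nu> \<in> ty ` S")
      case True
      then obtain x where "x \<in> S" "\<nu> = ty x" by blast
      then show ?thesis using uc[of x] c0 by simp
    next
      case False
      then have "c \<nu> = 0" using that ty by blast
      then show ?thesis using False by (simp add: c0_def)
    qed
  qed
  ultimately have "basis_coeffs n e u = c0" unfolding basis_coeffs_def by (rule the_equality)
  then show ?thesis using c0 x by simp
qed

section \<open>Factorizations in symmetric groups\<close>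

definition conjugate :: "('a \<Rightarrow> 'a) \<Rightarrow> ('a \<Rightarrow> 'a) \<Rightarrow> 'a \<Rightarrow> 'a" where
  "conjugate c x = c \<circ> x \<circ> inv' c"

lemma conjugate_apply: "bij c \<Longrightarrow> conjugate c x (c a) = c (x a)"
  by (simp add: conjugate_def bij_is_inj)

lemma conjugate_comp: "bij c \<Longrightarrow> conjugate c (x \<circ> y) = conjugate c x \<circ> conjugate c y"
  by (auto simp: conjugate_def fun_eq_iff bij_is_inj)

lemma conjugate_inv:
  assumes "bij c" "bij x"
  shows "conjugate c (inv' x) = inv' (conjugate c x)"
  using assms by (simp add: conjugate_def o_inv_distrib bij_comp bij_imp_bij_inv inv_inv_eq comp_assoc)

lemma inj_conjugate: "bij c \<Longrightarrow> inj (conjugate c)"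
  by (rule injI) (metis bij_is_inj conjugate_apply ext injD)

lemma conjugate_permutes:
  "c permutes V \<Longrightarrow> x permutes V \<Longrightarrow> conjugate c x permutes V"
  unfolding conjugate_def by (intro permutes_compose permutes_inv)

lemma conjugate_permutation:
  "permutation c \<Longrightarrow> permutation x \<Longrightarrow> permutation (conjugate c x)"
  unfolding conjugate_def by (intro permutation_compose permutation_inverse)

lemma stype_conjugate: "permutation x \<Longrightarrow> bij c \<Longrightarrow> stype (conjugate c x) = stype x"
  unfolding conjugate_def by (rule stype_conj)

lemma moved_conjugate:
  assumes "bij c"
  shows "{i. conjugate c x i \<noteq> i} = c ` {i. x i \<noteq> i}"
proof (intro equalityI subsetI)
  fix i assume "i \<in> {i. conjugate c x i \<noteq> i}"
  then have "x (inv' c i) \<noteq> inv' c i" "i = c (inv' c i)"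
    using assms by (auto simp: conjugate_def bij_is_surj surj_f_inv_f)
  then show "i \<in> c ` {i. x i \<noteq> i}" by blast
qed (use assms in \<open>auto simp: conjugate_apply bij_is_inj inj_eq\<close>)

lemma conjugate_eq_self:
  assumes "bij c" "\<And>i. c (x i) = x (c i)"
  shows "conjugate c x = x"
proof
  fix i
  show "conjugate c x i = x i"
    using assms by (simp add: conjugate_def bij_is_surj surj_f_inv_f)
qed

lemma conjugate_fixed:
  assumes "bij c" "x permutes A" "\<And>i. i \<in> A \<Longrightarrow> c i = i"
  shows "conjugate c x = x"
proof (rule conjugate_eq_self[OF assms(1)])
  fix i
  show "c (x i) = x (c i)"
  proof (cases "i \<in> A")
    case True
    then show ?thesis using assms(3) permutes_in_image[OF assms(2)] by simp
  next
    case False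
    have "c i \<notin> A"
    proof
      assume "c i \<in> A"
      then have "c (c i) = c i" by (rule assms(3))
      then have "c i = i" using bij_is_inj[OF assms(1)] by (simp add: inj_eq)
      then show False using False \<open>c i \<in> A\<close> by simp
    qed
    then show ?thesis using False permutes_not_in[OF assms(2)] by simp
  qed
qed

lemma permutation_bij: "permutation x \<Longrightarrow> bij x"
  unfolding permutation by simp

text \<open>Conjugation is injective, hence the bound; used for two conjugate elements in both
  orders it yields equality of counts.\<close>

lemma conjugate_stable_set:
  assumes "c permutes V" "S \<subseteq> {y. y permutes V}"
    "\<And>y. y permutes V \<Longrightarrow> y \<in> S \<Longrightarrow> conjugate c y \<in> S'" "finite S'"
  shows "card S \<le> card S'"
  using assms inj_conjugate[OF permutes_bij[OF assms(1)]]
  by (intro card_inj_on_le[where f = "conjugate c"]) (auto intro: inj_on_subset)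

lemma ex_stype_le:
  assumes "\<nu> \<in> partitions" "wt \<nu> \<le> n"
  shows "\<exists>z. z permutes {1..n} \<and> stype z = \<nu>"
proof -
  obtain z where z: "z permutes {1..wt \<nu>}" "stype z = \<nu>" using ex_stype[OF assms(1)] by blast
  have "z permutes {1..n}" using z(1) by (rule permutes_subset) (use assms(2) in auto)
  then show ?thesis using z(2) by blast
qed

lemma permutes_nat_permutation: "x permutes {1..n::nat} \<Longrightarrow> permutation x"
  by (rule permutes_imp_permutation_finite[OF finite_atLeastAtMost])

lemma stype_image: "stype ` {x. x permutes {1..n}} = {\<nu> \<in> partitions. wt \<nu> \<le> n}"
proof (intro equalityI subsetI)
  fix \<nu> assume "\<nu> \<in> stype ` {x. x permutes {1..n}}"
  then obtain x where "x permutes {1..n}" "\<nu> = stype x" by blast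
  then show "\<nu> \<in> {\<nu> \<in> partitions. wt \<nu> \<le> n}"
    using wt_stype_le[of x n] stype_partition[of x] permutes_nat_permutation[of x n] by simp
next
  fix \<nu> assume "\<nu> \<in> {\<nu> \<in> partitions. wt \<nu> \<le> n}"
  then show "\<nu> \<in> stype ` {x. x permutes {1..n}}" using ex_stype_le[of \<nu> n] by auto
qed

lemma finite_types: "finite {\<nu> \<in> partitions. wt \<nu> \<le> n}"
  unfolding stype_image[symmetric] by (simp add: finite_permutations)

text \<open>Every part k is at least 1, so it contributes k + 1 \<le> 2k to the weight. Bounded size
  thus gives bounded weight, and twice the size serves as a threshold for n.\<close>

lemma wt_le: "\<nu> \<in> partitions \<Longrightarrow> wt \<nu> \<le> 2 * sum_mset \<nu>"
proof (induction \<nu>)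
  case (add k \<nu>)
  then have "k > 0" "\<nu> \<in> partitions" by (auto simp: partitions_def)
  then show ?case using add by (simp add: wt_def)
qed (simp add: wt_def)

lemma finite_partitions: "finite {\<nu> \<in> partitions. sum_mset \<nu> \<le> k}"
  by (rule finite_subset[OF _ finite_types[of "2 * k"]]) (use wt_le in fastforce)

text \<open>Isolates the dependence on n in the moved points. That 0 is fixed is recorded
  separately, as part of the description of the factors that does not mention n.\<close>

lemma permutes_nat_iff:
  fixes y :: "nat \<Rightarrow> nat"
  shows "y permutes {1..n} \<longleftrightarrow> permutation y \<and> y 0 = 0 \<and> {i. y i \<noteq> i} \<subseteq> {1..n}"
proof
  assume y: "y permutes {1..n}"
  show "permutation y \<and> y 0 = 0 \<and> {i. y i \<noteq> i} \<subseteq> {1..n}"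
    using permutes_nat_permutation[OF y] permutes_not_in[OF y, of 0] moved_subset[OF y] by simp
next
  assume y: "permutation y \<and> y 0 = 0 \<and> {i. y i \<noteq> i} \<subseteq> {1..n}"
  then obtain A where "y permutes A" using permutation_permutes by blast
  then have "y permutes {i. y i \<noteq> i}" by (rule permutes_moved)
  then show "y permutes {1..n}" using y by (auto elim: permutes_subset)
qed

section \<open>Factorization counts and the structure constants of the centers\<close>

definition factorizations ::
    "nat \<Rightarrow> nat multiset \<Rightarrow> nat multiset \<Rightarrow> (nat \<Rightarrow> nat) \<Rightarrow> (nat \<Rightarrow> nat) set" where
  "factorizations n \<alpha> \<mu> z = {y. y permutes {1..n} \<and> stype (z \<circ> inv' y) = \<alpha> \<and> stype y = \<mu>}"

lemma finite_factorizations: "finite (factorizations n \<alpha> \<mu> z)"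
  by (rule finite_subset[OF _ finite_permutations[of "{1..n}"]]) (auto simp: factorizations_def)

lemma card_factorizations_conjugate:
  assumes "c permutes {1..n}" "z permutes {1..n}"
  shows "card (factorizations n \<alpha> \<mu> z) \<le> card (factorizations n \<alpha> \<mu> (conjugate c z))"
proof (rule conjugate_stable_set[OF assms(1)])
  fix y assume y: "y permutes {1..n}" "y \<in> factorizations n \<alpha> \<mu> z"
  have c: "bij c" using assms permutes_bij by blast
  have "conjugate c z \<circ> inv' (conjugate c y) = conjugate c (z \<circ> inv' y)"
    using c permutes_bij[OF y(1)] by (simp add: conjugate_comp conjugate_inv)
  moreover have "permutation (z \<circ> inv' y)"
    using assms y by (intro permutes_nat_permutation[of _ n] permutes_compose permutes_inv)
  ultimately show "conjugate c y \<in> factorizations n \<alpha> \<mu> (conjugate c z)"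
    using y c assms conjugate_permutes[OF assms(1) y(1)] permutes_nat_permutation
    by (auto simp: factorizations_def stype_conjugate)
next
  show "finite (factorizations n \<alpha> \<mu> (conjugate c z))" by (rule finite_factorizations)
qed (auto simp: factorizations_def)

lemma class_sum_eq:
  "class_sum n \<mu> = (\<lambda>x. if x \<in> {x. x permutes {1..n}} \<and> stype x = \<mu> then 1 else 0)"
  by (auto simp: class_sum_def sym_group_carrier stable_cycle_type fun_eq_iff)

lemma convolution_class_sum:
  "convolution (sym_group n) (class_sum n \<alpha>) (class_sum n \<mu>) x =
    (if x permutes {1..n} then int (card (factorizations n \<alpha> \<mu> x)) else 0)"
proof (cases "x permutes {1..n}")
  case True
  have "convolution (sym_group n) (class_sum n \<alpha>) (class_sum n \<mu>) x =
      (\<Sum>y | y permutes {1..n}. class_sum n \<alpha> (x \<circ> inv' y) * class_sum n \<mu> y)"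
    using True
    by (auto simp: convolution_def sym_group_carrier sym_group_mult intro!: sum.cong)
  also have "\<dots> = (\<Sum>y | y permutes {1..n}. if y \<in> factorizations n \<alpha> \<mu> x then 1 else 0)"
    using True permutes_compose[OF permutes_inv]
    by (intro sum.cong) (auto simp: class_sum_eq factorizations_def)
  also have "\<dots> = (\<Sum>y\<in>{y. y permutes {1..n}} \<inter> factorizations n \<alpha> \<mu> x. 1)"
    by (rule sum.inter_restrict[symmetric]) (simp add: finite_permutations)
  also have "{y. y permutes {1..n}} \<inter> factorizations n \<alpha> \<mu> x = factorizations n \<alpha> \<mu> x"
    by (auto simp: factorizations_def)
  finally show ?thesis using True by simp
qed (simp add: convolution_def sym_group_carrier)

lemma a_num_stype:
  assumes "z permutes {1..n}"
  shows "a_num n \<alpha> \<mu> (stype z) = int (card (factorizations n \<alpha> \<mu> z))"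
proof -
  have "basis_coeffs n (class_sum n) (convolution (sym_group n) (class_sum n \<alpha>) (class_sum n \<mu>)) (stype z)
     = convolution (sym_group n) (class_sum n \<alpha>) (class_sum n \<mu>) z"
  proof (rule basis_coeffs_eq[where S = "{x. x permutes {1..n}}"])
    show "finite (stype ` {x. x permutes {1..n}})" by (simp add: finite_permutations)
    have le: "card (factorizations n \<alpha> \<mu> x) \<le> card (factorizations n \<alpha> \<mu> y)"
      if "x permutes {1..n}" "y permutes {1..n}" "stype x = stype y" for x y
    proof -
      have "\<exists>c. c permutes {1..n} \<and> y = c \<circ> x \<circ> inv' c"
        using conj_of_stype_eq[OF finite_atLeastAtMost that] .
      then obtain c where "c permutes {1..n}" "y = c \<circ> x \<circ> inv' c" by blast
      then show ?thesis using card_factorizations_conjugate[of c n x \<alpha> \<mu>] that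
        by (simp add: conjugate_def)
    qed
    show "convolution (sym_group n) (class_sum n \<alpha>) (class_sum n \<mu>) x
        = convolution (sym_group n) (class_sum n \<alpha>) (class_sum n \<mu>) y"
      if "x \<in> {x. x permutes {1..n}}" "y \<in> {x. x permutes {1..n}}" "stype x = stype y" for x y
      using that le[of x y] le[of y x] by (simp add: convolution_class_sum)
    show "z \<in> {x. x permutes {1..n}}" using assms by simp
  qed (rule class_sum_eq stype_image | simp add: convolution_class_sum)+
  then show ?thesis using assms by (simp add: a_num_def convolution_class_sum)
qed

text \<open>z is realized on the fewest possible points, {1..wt \<nu>}, so the formula holds from n
  = \<open>wt \<nu>\<close> on. Y collects the right factors for all n at once; those lying in S_n
  are the ones whose moved points are at most n.\<close>

lemma a_poly_interpolates:
  assumes "\<nu> \<in> partitions"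
  shows "a_poly \<alpha> \<mu> \<nu> \<in> int_valued"
    and "n \<ge> wt \<nu> \<Longrightarrow> poly (a_poly \<alpha> \<mu> \<nu>) (of_nat n) = of_int (a_num n \<alpha> \<mu> \<nu>)"
proof -
  define s where "s = wt \<nu>"
  obtain z where z: "z permutes {1..s}" "stype z = \<nu>" using ex_stype[OF assms] s_def by blast
  have pz: "permutation z" using z permutes_nat_permutation by blast
  define Y where "Y = {y. permutation y \<and> y 0 = 0 \<and> stype (z \<circ> inv' y) = \<alpha> \<and> stype y = \<mu>}"
  have Yn: "{y \<in> Y. {i. y i \<noteq> i} \<subseteq> {1..n}} = factorizations n \<alpha> \<mu> z" for n
    unfolding Y_def factorizations_def permutes_nat_iff by blast
  have "\<exists>p\<in>int_valued. \<forall>n\<ge>s. poly p (of_nat n) = of_nat (card {y \<in> Y. {i. y i \<noteq> i} \<subseteq> {1..n}})"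
  proof (rule ex_int_valued_count)
    show "finite {y \<in> Y. {i. y i \<noteq> i} \<subseteq> {1..n}}" for n
      unfolding Yn by (rule finite_factorizations)
    show "finite {i. y i \<noteq> i} \<and> 0 \<notin> {i. y i \<noteq> i} \<and> card {i. y i \<noteq> i} \<le> wt \<mu>" if "y \<in> Y" for y
      using that wt_stype[of y] by (auto simp: Y_def permutation)
    fix c m assume c: "c permutes {1..m::nat}" "\<forall>i\<in>{1..s}. c i = i"
    have bc: "bij c" and pc: "permutation c" using c permutes_bij permutes_nat_permutation by blast+
    \<comment> \<open>c fixes every point that z can move, so conjugation by c keeps z and sends
      right factors of z to right factors of z.\<close>
    have cz: "conjugate c z = z" by (rule conjugate_fixed[OF bc z(1)]) (use c(2) in blast)
    have "conjugate c y \<in> Y" if "y \<in> Y" for y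
    proof -
      have y: "permutation y" "bij y" "y 0 = 0" using that permutation_bij by (auto simp: Y_def)
      have "z \<circ> inv' (conjugate c y) = conjugate c (z \<circ> inv' y)"
        using y bc cz by (simp add: conjugate_comp conjugate_inv)
      moreover have "c 0 = 0" using permutes_not_in[OF c(1), of 0] by simp
      then have "conjugate c y 0 = 0" using conjugate_apply[OF bc, of y 0] y by simp
      moreover have "permutation (z \<circ> inv' y)"
        using pz y by (intro permutation_compose permutation_inverse)
      ultimately show ?thesis
        using that y bc pc by (simp add: Y_def stype_conjugate conjugate_permutation)
    qed
    then show "\<exists>f. inj_on f Y \<and> f ` Y \<subseteq> Y \<and> (\<forall>y\<in>Y. {i. f y i \<noteq> i} = c ` {i. y i \<noteq> i})"
      using inj_conjugate[OF bc] moved_conjugate[OF bc]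
      by (intro exI[of _ "conjugate c"]) (auto intro: inj_on_subset)
  qed
  then obtain p where p: "p \<in> int_valued"
      "\<And>n. n \<ge> s \<Longrightarrow> poly p (of_nat n) = of_nat (card (factorizations n \<alpha> \<mu> z))"
    unfolding Yn by blast
  have pa: "poly p (of_nat n) = of_int (a_num n \<alpha> \<mu> \<nu>)" if "n \<ge> s" for n
    using p(2)[OF that] a_num_stype[of z n \<alpha> \<mu>] permutes_subset[OF z(1), of "{1..n}"] that z(2) by simp
  have "a_poly \<alpha> \<mu> \<nu> = p"
    unfolding a_poly_def using pa p(1) s_def by (intro interpolant_eq) auto
  then show "a_poly \<alpha> \<mu> \<nu> \<in> int_valued"
    and "n \<ge> wt \<nu> \<Longrightarrow> poly (a_poly \<alpha> \<mu> \<nu>) (of_nat n) = of_int (a_num n \<alpha> \<mu> \<nu>)"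
    using p(1) pa s_def by auto
qed

lemma a_num_vanishes:
  assumes "\<nu> \<in> partitions" "wt \<nu> \<le> n" "sum_mset \<nu> > sum_mset \<alpha> + sum_mset \<mu>"
  shows "a_num n \<alpha> \<mu> \<nu> = 0"
proof -
  obtain z where z: "z permutes {1..n}" "stype z = \<nu>" using ex_stype_le[OF assms(1,2)] by blast
  have "factorizations n \<alpha> \<mu> z = {}"
  proof (rule ccontr)
    assume "factorizations n \<alpha> \<mu> z \<noteq> {}"
    then obtain y where y: "y permutes {1..n}" "stype (z \<circ> inv' y) = \<alpha>" "stype y = \<mu>"
      by (auto simp: factorizations_def)
    have "z = (z \<circ> inv' y) \<circ> y" using y(1) by (auto simp: fun_eq_iff permutes_inverses)
    then have "sum_mset \<nu> \<le> sum_mset \<alpha> + sum_mset \<mu>"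
      using sum_mset_stype_comp[OF finite_atLeastAtMost permutes_compose[OF permutes_inv[OF y(1)] z(1)] y(1)]
        y z by simp
    then show False using assms by simp
  qed
  then show ?thesis using a_num_stype[OF z(1), of \<alpha> \<mu>] z(2) by simp
qed

text \<open>Turns a sum over intermediate types, as it arises from multiplying two structure
  constants, into a sum over the intermediate elements themselves.\<close>

lemma sum_card_by_type:
  assumes "finite S" "\<And>w. w \<in> S \<Longrightarrow> h w permutes {1..n}"
  shows "(\<Sum>\<nu> | \<nu> \<in> partitions \<and> wt \<nu> \<le> n. g \<nu> * int (card {w \<in> S. stype (h w) = \<nu>}))
    = (\<Sum>w\<in>S. g (stype (h w)))"
proof -
  have "(\<Sum>w\<in>S. g (stype (h w)))
      = (\<Sum>\<nu>\<in>{\<nu> \<in> partitions. wt \<nu> \<le> n}. \<Sum>w | w \<in> S \<and> stype (h w) = \<nu>. g (stype (h w)))"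
    using assms stype_image[of n] finite_types[of n] by (intro sum.group[symmetric]) auto
  also have "\<dots> = (\<Sum>\<nu>\<in>{\<nu> \<in> partitions. wt \<nu> \<le> n}. g \<nu> * int (card {w \<in> S. stype (h w) = \<nu>}))"
    by (intro sum.cong) auto
  finally show ?thesis by simp
qed

text \<open>Both sides count the factorizations \<open>z = x y w\<close> with factors of types
  \<open>\<alpha>\<close>, \<open>\<mu>\<close> and \<open>\<kappa>\<close>.\<close>

lemma a_num_assoc:
  assumes "z permutes {1..n}"
  shows "(\<Sum>\<nu> | \<nu> \<in> partitions \<and> wt \<nu> \<le> n. a_num n \<alpha> \<mu> \<nu> * a_num n \<nu> \<kappa> (stype z))
    = (\<Sum>\<nu> | \<nu> \<in> partitions \<and> wt \<nu> \<le> n. a_num n \<mu> \<kappa> \<nu> * a_num n \<alpha> \<nu> (stype z))"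
proof -
  define S where "S = {w. w permutes {1..n} \<and> stype w = \<kappa>}"
  define S' where "S' = {v. v permutes {1..n} \<and> stype (z \<circ> inv' v) = \<alpha>}"
  have fin: "finite S" "finite S'"
    by (auto simp: S_def S'_def intro: finite_subset[OF _ finite_permutations[of "{1..n}"]])
  have comp: "z \<circ> inv' w permutes {1..n}" if "w permutes {1..n}" for w
    using assms that by (intro permutes_compose permutes_inv)
  have "(\<Sum>\<nu> | \<nu> \<in> partitions \<and> wt \<nu> \<le> n. a_num n \<alpha> \<mu> \<nu> * a_num n \<nu> \<kappa> (stype z))
      = (\<Sum>\<nu> | \<nu> \<in> partitions \<and> wt \<nu> \<le> n. a_num n \<alpha> \<mu> \<nu> * int (card {w \<in> S. stype (z \<circ> inv' w) = \<nu>}))"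
    using a_num_stype[OF assms]
    by (intro sum.cong) (auto simp: factorizations_def S_def intro: arg_cong[where f = card])
  also have "\<dots> = (\<Sum>w\<in>S. a_num n \<alpha> \<mu> (stype (z \<circ> inv' w)))"
    by (rule sum_card_by_type) (use fin comp in \<open>auto simp: S_def\<close>)
  also have "\<dots> = (\<Sum>w\<in>S. int (card (factorizations n \<alpha> \<mu> (z \<circ> inv' w))))"
    using comp by (intro sum.cong) (auto simp: S_def a_num_stype)
  also have "\<dots> = int (card (Sigma S (\<lambda>w. factorizations n \<alpha> \<mu> (z \<circ> inv' w))))"
    using fin finite_factorizations by (simp add: card_SigmaI)
  also have "card (Sigma S (\<lambda>w. factorizations n \<alpha> \<mu> (z \<circ> inv' w)))
      = card (Sigma S' (\<lambda>v. factorizations n \<mu> \<kappa> v))"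
  \<comment> \<open>The pair (w, y) lists the last and the middle factor; v = y w merges these
    two.\<close>
  proof (rule bij_betw_same_card, rule bij_betw_byWitness[where f = "\<lambda>(w, y). (y \<circ> w, w)"
        and f' = "\<lambda>(v, w). (w, v \<circ> inv' w)"])
    show "\<forall>p\<in>Sigma S (\<lambda>w. factorizations n \<alpha> \<mu> (z \<circ> inv' w)).
        (\<lambda>(v, w). (w, v \<circ> inv' w)) ((\<lambda>(w, y). (y \<circ> w, w)) p) = p"
      by (auto simp: S_def comp_assoc permutes_inv_o)
    show "\<forall>p\<in>Sigma S' (\<lambda>v. factorizations n \<mu> \<kappa> v).
        (\<lambda>(w, y). (y \<circ> w, w)) ((\<lambda>(v, w). (w, v \<circ> inv' w)) p) = p"
      by (auto simp: factorizations_def comp_assoc permutes_inv_o)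
    have inv: "inv' (y \<circ> w) = inv' w \<circ> inv' y" if "y permutes {1..n}" "w permutes {1..n}" for y w
      using that by (simp add: o_inv_distrib permutes_bij)
    show "(\<lambda>(w, y). (y \<circ> w, w)) ` Sigma S (\<lambda>w. factorizations n \<alpha> \<mu> (z \<circ> inv' w))
        \<subseteq> Sigma S' (\<lambda>v. factorizations n \<mu> \<kappa> v)"
      by (auto simp: S_def S'_def factorizations_def inv comp_assoc permutes_inv_o intro!: permutes_compose)
    have "z \<circ> inv' w \<circ> inv' (v \<circ> inv' w) = z \<circ> inv' v"
      if "v permutes {1..n}" "w permutes {1..n}" for v w
    proof -
      have "inv' (v \<circ> inv' w) = w \<circ> inv' v"
        using that inv[OF that(1) permutes_inv[OF that(2)]] by (simp add: permutes_inv_inv)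
      then have "z \<circ> inv' w \<circ> inv' (v \<circ> inv' w) = z \<circ> (inv' w \<circ> w) \<circ> inv' v" by (simp add: comp_assoc)
      then show ?thesis using that by (simp add: permutes_inv_o)
    qed
    then show "(\<lambda>(v, w). (w, v \<circ> inv' w)) ` Sigma S' (\<lambda>v. factorizations n \<mu> \<kappa> v)
        \<subseteq> Sigma S (\<lambda>w. factorizations n \<alpha> \<mu> (z \<circ> inv' w))"
      by (auto simp: S_def S'_def factorizations_def intro!: permutes_compose permutes_inv)
  qed
  also have "int (card (Sigma S' (\<lambda>v. factorizations n \<mu> \<kappa> v)))
      = (\<Sum>v\<in>S'. int (card (factorizations n \<mu> \<kappa> v)))"
    using fin finite_factorizations by (simp add: card_SigmaI)
  also have "\<dots> = (\<Sum>v\<in>S'. a_num n \<mu> \<kappa> (stype v))"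
    by (intro sum.cong) (auto simp: S'_def a_num_stype)
  also have "\<dots> = (\<Sum>\<nu> | \<nu> \<in> partitions \<and> wt \<nu> \<le> n. a_num n \<mu> \<kappa> \<nu> * int (card {v \<in> S'. stype v = \<nu>}))"
    by (rule sum_card_by_type[symmetric]) (use fin in \<open>auto simp: S'_def\<close>)
  also have "\<dots> = (\<Sum>\<nu> | \<nu> \<in> partitions \<and> wt \<nu> \<le> n. a_num n \<mu> \<kappa> \<nu> * a_num n \<alpha> \<nu> (stype z))"
    using a_num_stype[OF assms]
    by (intro sum.cong) (auto simp: factorizations_def S'_def intro!: arg_cong[where f = card])
  finally show ?thesis .
qed

text \<open>When three lengths add up exactly, so do those of the partial products: an intermediate
  \<nu> that is too large is killed by the first constant, one that is too small by the second. The
  associativity at fixed n therefore restricts to top constants.\<close>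

lemma a_poly_top_assoc:
  assumes "\<alpha> \<in> partitions" "\<mu> \<in> partitions" "\<kappa> \<in> partitions" "\<tau> \<in> partitions"
    and deg: "sum_mset \<tau> = sum_mset \<alpha> + sum_mset \<mu> + sum_mset \<kappa>"
  shows "(\<Sum>\<nu> | \<nu> \<in> partitions \<and> sum_mset \<nu> = sum_mset \<alpha> + sum_mset \<mu>. a_poly \<alpha> \<mu> \<nu> * a_poly \<nu> \<kappa> \<tau>)
    = (\<Sum>\<nu> | \<nu> \<in> partitions \<and> sum_mset \<nu> = sum_mset \<mu> + sum_mset \<kappa>. a_poly \<mu> \<kappa> \<nu> * a_poly \<alpha> \<nu> \<tau>)"
    (is "?l = ?r")
proof (rule poly_eq_of_nat_eq)
  let ?S = "\<lambda>k. {\<nu>. \<nu> \<in> partitions \<and> sum_mset \<nu> = k}"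
  \<comment> \<open>Beyond this threshold every partition of size at most |\<tau>| has weight at
    most n, so all constants involved are the values of their polynomials at n.\<close>
  fix n assume n: "n \<ge> 2 * sum_mset \<tau>"
  have small: "wt \<nu> \<le> n" if "\<nu> \<in> partitions" "sum_mset \<nu> \<le> sum_mset \<tau>" for \<nu>
    using wt_le[OF that(1)] that(2) n by linarith
  obtain z where z: "z permutes {1..n}" "stype z = \<tau>"
    using ex_stype_le[OF assms(4) small[OF assms(4)]] by auto
  have restrict: "(\<Sum>\<nu>\<in>?S k. g \<nu>) = (\<Sum>\<nu> | \<nu> \<in> partitions \<and> wt \<nu> \<le> n. g \<nu>)"
    if "k \<le> sum_mset \<tau>" "\<And>\<nu>. \<lbrakk>\<nu> \<in> partitions; wt \<nu> \<le> n; sum_mset \<nu> \<noteq> k\<rbrakk> \<Longrightarrow> g \<nu> = 0"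
    for g :: "nat multiset \<Rightarrow> int" and k
    using that small by (intro sum.mono_neutral_left finite_types) auto
  have "(\<Sum>\<nu>\<in>?S (sum_mset \<alpha> + sum_mset \<mu>). a_num n \<alpha> \<mu> \<nu> * a_num n \<nu> \<kappa> \<tau>)
      = (\<Sum>\<nu> | \<nu> \<in> partitions \<and> wt \<nu> \<le> n. a_num n \<alpha> \<mu> \<nu> * a_num n \<nu> \<kappa> \<tau>)"
  proof (rule restrict)
    fix \<nu> assume \<nu>: "\<nu> \<in> partitions" "wt \<nu> \<le> n" "sum_mset \<nu> \<noteq> sum_mset \<alpha> + sum_mset \<mu>"
    then consider "sum_mset \<nu> > sum_mset \<alpha> + sum_mset \<mu>" | "sum_mset \<tau> > sum_mset \<nu> + sum_mset \<kappa>"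
      using deg by linarith
    then show "a_num n \<alpha> \<mu> \<nu> * a_num n \<nu> \<kappa> \<tau> = 0"
      using a_num_vanishes \<nu> small assms(4) by cases auto
  qed (use deg in simp)
  also have "\<dots> = (\<Sum>\<nu> | \<nu> \<in> partitions \<and> wt \<nu> \<le> n. a_num n \<mu> \<kappa> \<nu> * a_num n \<alpha> \<nu> \<tau>)"
    using a_num_assoc[OF z(1)] z(2) by simp
  also have "\<dots> = (\<Sum>\<nu>\<in>?S (sum_mset \<mu> + sum_mset \<kappa>). a_num n \<mu> \<kappa> \<nu> * a_num n \<alpha> \<nu> \<tau>)"
  proof (rule restrict[symmetric])
    fix \<nu> assume \<nu>: "\<nu> \<in> partitions" "wt \<nu> \<le> n" "sum_mset \<nu> \<noteq> sum_mset \<mu> + sum_mset \<kappa>"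
    then consider "sum_mset \<nu> > sum_mset \<mu> + sum_mset \<kappa>" | "sum_mset \<tau> > sum_mset \<alpha> + sum_mset \<nu>"
      using deg by linarith
    then show "a_num n \<mu> \<kappa> \<nu> * a_num n \<alpha> \<nu> \<tau> = 0"
      using a_num_vanishes \<nu> small assms(4) by cases auto
  qed (use deg in simp)
  finally have eq: "(\<Sum>\<nu>\<in>?S (sum_mset \<alpha> + sum_mset \<mu>). a_num n \<alpha> \<mu> \<nu> * a_num n \<nu> \<kappa> \<tau>)
      = (\<Sum>\<nu>\<in>?S (sum_mset \<mu> + sum_mset \<kappa>). a_num n \<mu> \<kappa> \<nu> * a_num n \<alpha> \<nu> \<tau>)" .
  have "poly ?l (of_nat n) = of_int (\<Sum>\<nu>\<in>?S (sum_mset \<alpha> + sum_mset \<mu>). a_num n \<alpha> \<mu> \<nu> * a_num n \<nu> \<kappa> \<tau>)"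
    "poly ?r (of_nat n) = of_int (\<Sum>\<nu>\<in>?S (sum_mset \<mu> + sum_mset \<kappa>). a_num n \<mu> \<kappa> \<nu> * a_num n \<alpha> \<nu> \<tau>)"
    using a_poly_interpolates(2) small assms by (simp_all add: poly_sum)
  then show "poly ?l (of_nat n) = poly ?r (of_nat n)" unfolding eq by simp
qed

text \<open>A factor of empty type is the identity, which leaves a single candidate for the
  factorization; it has the required type exactly when z has type \<mu>.\<close>

lemma a_poly_unit:
  assumes "\<mu> \<in> partitions" "\<nu> \<in> partitions"
  shows "a_poly {#} \<mu> \<nu> = (if \<nu> = \<mu> then 1 else 0)" and "a_poly \<mu> {#} \<nu> = (if \<nu> = \<mu> then 1 else 0)"
proof -
  have "a_num n {#} \<mu> \<nu> = (if \<nu> = \<mu> then 1 else 0) \<and> a_num n \<mu> {#} \<nu> = (if \<nu> = \<mu> then 1 else 0)"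
    if "n \<ge> wt \<nu>" for n
  proof -
    have "\<exists>z. z permutes {1..n} \<and> stype z = \<nu>" by (rule ex_stype_le[OF assms(2) that])
    then obtain z where z: "z permutes {1..n}" "stype z = \<nu>" by blast
    have "z \<circ> inv' y = id \<longleftrightarrow> y = z" if "y permutes {1..n}" for y
      using that by (metis comp_assoc comp_id id_comp permutes_inv_o(1,2))
    moreover have "stype (z \<circ> inv' y) = {#} \<longleftrightarrow> z \<circ> inv' y = id" if "y permutes {1..n}" for y
      using stype_eq_empty_iff[OF permutes_nat_permutation[OF permutes_compose[OF permutes_inv[OF that] z(1)]]] .
    ultimately have "factorizations n {#} \<mu> z = (if \<nu> = \<mu> then {z} else {})"
      using z by (auto simp: factorizations_def)
    moreover have "stype y = {#} \<longleftrightarrow> y = id" if "y permutes {1..n}" for y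
      using that permutes_nat_permutation stype_eq_empty_iff by blast
    then have "factorizations n \<mu> {#} z = (if \<nu> = \<mu> then {id} else {})"
      using z permutes_id[of "{1..n}"] by (auto simp: factorizations_def)
    ultimately show ?thesis
      using a_num_stype[OF z(1), of "{#}" \<mu>] a_num_stype[OF z(1), of \<mu> "{#}"] z(2) by auto
  qed
  then show "a_poly {#} \<mu> \<nu> = (if \<nu> = \<mu> then 1 else 0)" and "a_poly \<mu> {#} \<nu> = (if \<nu> = \<mu> then 1 else 0)"
    unfolding a_poly_def by (auto intro!: interpolant_eq)
qed

section \<open>Matchings as reversible permutations\<close>

text \<open>The standard matching for all n simultaneously, with 0 as its fixed point;
  \<open>t_perm n\<close> agrees with it on {1..2n}. Reversibility can then be stated without
  n.\<close>

definition partner :: "nat \<Rightarrow> nat" where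
  "partner i = (if i = 0 then 0 else if odd i then i + 1 else i - 1)"

lemma partner_simps [simp]:
  "partner 0 = 0" "k > 0 \<Longrightarrow> partner (2 * k - Suc 0) = 2 * k" "partner (2 * k) = 2 * k - Suc 0"
  by (auto simp: partner_def)

lemma partner_partner [simp]: "partner (partner i) = i"
  by (cases "i = 0") (auto simp: partner_def)

lemma partner_eq_iff [simp]: "partner i = partner j \<longleftrightarrow> i = j"
  by (metis partner_partner)

lemma partner_neq: "i > 0 \<Longrightarrow> partner i \<noteq> i"
  by (auto simp: partner_def)

lemma partner_in: "partner i \<in> {1..2 * n} \<longleftrightarrow> i \<in> {1..2 * n}"
  unfolding partner_def by (simp, presburger)

lemma t_perm_eq: "t_perm n i = (if i \<in> {1..2 * n} then partner i else i)"
  by (auto simp: t_perm_def partner_def)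

lemma t_perm_t_perm [simp]: "t_perm n (t_perm n i) = i"
proof (cases "i \<in> {1..2 * n}")
  case True
  then show ?thesis using partner_in[of i n] by (simp only: t_perm_eq if_True partner_partner)
qed (simp only: t_perm_eq if_False)

lemma t_perm_permutes: "t_perm n permutes {1..2 * n}"
proof (rule bij_imp_permutes)
  show "bij_betw (t_perm n) {1..2 * n} {1..2 * n}"
  proof (rule bij_betw_byWitness[where f' = "t_perm n"])
    show "t_perm n ` {1..2 * n} \<subseteq> {1..2 * n}" "t_perm n ` {1..2 * n} \<subseteq> {1..2 * n}"
      using partner_in[of _ n] by (metis image_subsetI t_perm_eq)+
  qed simp_all
  show "t_perm n i = i" if "i \<notin> {1..2 * n}" for i using that by (simp only: t_perm_eq if_False)
qed

lemma nat_pair_cases: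
  fixes i :: nat
  obtains "i = 0" | k where "k > 0" "i = 2 * k - 1" | k where "k > 0" "i = 2 * k"
proof (cases "even i")
  case True
  then show ?thesis using that by (cases "i = 0") (auto elim!: evenE)
next
  case False
  then obtain j where "i = 2 * j + 1" by (auto elim!: oddE)
  then have "i = 2 * Suc j - 1" by simp
  then show ?thesis using that by blast
qed

text \<open>Two permutations side by side, x on the odd numbers \<open>2 * k - 1\<close> and y on
  the even numbers \<open>2 * k\<close>. \<open>spread c c\<close> embeds S_n into the
  hyperoctahedral group, and \<open>spread z (inv' z)\<close> is the standard representative of the
  doubled type of z.\<close>

definition spread :: "(nat \<Rightarrow> nat) \<Rightarrow> (nat \<Rightarrow> nat) \<Rightarrow> nat \<Rightarrow> nat" where
  "spread x y i = (if i = 0 then 0 else if odd i then 2 * x ((i + 1) div 2) - 1 else 2 * y (i div 2))"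

lemma spread_simps:
  "spread x y 0 = 0"
  "k > 0 \<Longrightarrow> spread x y (2 * k - 1) = 2 * x k - 1"
  "k > 0 \<Longrightarrow> spread x y (2 * k - Suc 0) = 2 * x k - Suc 0"
  "k > 0 \<Longrightarrow> spread x y (2 * k) = 2 * y k"
  by (auto simp: spread_def)

lemma permutes_nat_pos: "x permutes {1..n::nat} \<Longrightarrow> x k > 0 \<longleftrightarrow> k > 0"
proof -
  assume x: "x permutes {1..n}"
  have "x 0 = 0" using permutes_not_in[OF x, of 0] by simp
  then show ?thesis using permutes_inj[OF x] by (metis inj_eq neq0_conv)
qed

lemma spread_comp:
  assumes "x permutes {1..n}" "y permutes {1..n}"
  shows "spread x' y' \<circ> spread x y = spread (x' \<circ> x) (y' \<circ> y)"
proof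
  fix i
  show "(spread x' y' \<circ> spread x y) i = spread (x' \<circ> x) (y' \<circ> y) i"
    using permutes_nat_pos[OF assms(1)] permutes_nat_pos[OF assms(2)]
    by (cases i rule: nat_pair_cases) (simp_all add: spread_simps)
qed

lemma spread_id [simp]: "spread id id = id"
proof
  fix i
  show "spread id id i = id i" by (cases i rule: nat_pair_cases) (simp_all add: spread_simps)
qed

lemma spread_permutes:
  assumes "x permutes {1..n}" "y permutes {1..n}"
  shows "spread x y permutes {1..2 * n}"
proof (rule bij_imp_permutes)
  note inv = permutes_inv[OF assms(1)] permutes_inv[OF assms(2)]
  have 1: "spread (inv' x) (inv' y) (spread x y i) = i" for i
    using fun_cong[OF spread_comp[OF assms, of "inv' x" "inv' y"], of i] assms
    by (simp add: permutes_inv_o)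
  have 2: "spread x y (spread (inv' x) (inv' y) i) = i" for i
    using fun_cong[OF spread_comp[OF inv, of x y], of i] assms by (simp add: permutes_inv_o)
  have into: "spread x y i \<in> {1..2 * n}" if "i \<in> {1..2 * n}" "x permutes {1..n}" "y permutes {1..n}" for i x y
    using that(1)
  proof (cases i rule: nat_pair_cases)
    case (2 k)
    then have "x k \<in> {1..n}" using that permutes_in_image[OF that(2), of k] by auto
    then show ?thesis using 2 by (auto simp: spread_simps)
  next
    case (3 k)
    then have "y k \<in> {1..n}" using that permutes_in_image[OF that(3), of k] by auto
    then show ?thesis using 3 by (auto simp: spread_simps)
  qed simp
  show "bij_betw (spread x y) {1..2 * n} {1..2 * n}"
    by (rule bij_betw_byWitness[where f' = "spread (inv' x) (inv' y)"])
      (use 1 2 into[OF _ assms] into[OF _ inv] in auto)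
  fix i assume i: "i \<notin> {1..2 * n}"
  show "spread x y i = i"
  proof (cases i rule: nat_pair_cases)
    case (2 k)
    then have "k \<notin> {1..n}" using i by auto
    then show ?thesis using 2 permutes_not_in[OF assms(1), of k] by (simp add: spread_simps)
  next
    case (3 k)
    then have "k \<notin> {1..n}" using i by auto
    then show ?thesis using 3 permutes_not_in[OF assms(2), of k] by (simp add: spread_simps)
  qed (simp add: spread_simps)
qed

lemma inv_spread:
  assumes "x permutes {1..n}" "y permutes {1..n}"
  shows "inv' (spread x y) = spread (inv' x) (inv' y)"
proof (rule inv_unique_comp)
  note inv = permutes_inv[OF assms(1)] permutes_inv[OF assms(2)]
  show "spread x y \<circ> spread (inv' x) (inv' y) = id"
    using assms by (simp add: spread_comp[OF inv] permutes_inv_o)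
  show "spread (inv' x) (inv' y) \<circ> spread x y = id"
    using assms by (simp add: spread_comp[OF assms] permutes_inv_o)
qed

text \<open>\<open>partner\<close> exchanges 2k - 1 and 2k, hence the two copies. So
  \<open>spread c c\<close> commutes with it, while conjugation by it inverts
  \<open>spread z (inv' z)\<close>.\<close>

lemma partner_spread:
  assumes "x permutes {1..n}" "y permutes {1..n}"
  shows "partner (spread x y i) = spread y x (partner i)"
  using permutes_nat_pos[OF assms(1)] permutes_nat_pos[OF assms(2)]
  by (cases i rule: nat_pair_cases) (simp_all add: spread_simps)

lemma stype_spread:
  assumes "x permutes {1..n}" "y permutes {1..n}"
  shows "stype (spread x y) = stype x + stype y"
proof (rule stype_embed[where A = "{1..n}" and B = "{1..n}" and f = "\<lambda>k. 2 * k - 1" and g = "\<lambda>k. 2 * k"])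
  show "(\<lambda>k. 2 * k - 1) ` {1..n} \<inter> (*) 2 ` {1..n} = {}"
  proof -
    have "2 * a - 1 \<noteq> 2 * b" if "a \<ge> 1" for a b :: nat using that by arith
    then show ?thesis by auto
  qed
  show "spread x y i = i" if "i \<notin> (\<lambda>k. 2 * k - 1) ` {1..n} \<union> (*) 2 ` {1..n}" for i
  proof -
    have "i \<notin> {1..2 * n}"
    proof
      assume "i \<in> {1..2 * n}"
      then show False using that
      proof (cases i rule: nat_pair_cases)
        case (2 k)
        then have "k \<in> {1..n}" using \<open>i \<in> {1..2 * n}\<close> by auto
        then show False using 2 that by blast
      next
        case (3 k)
        then have "k \<in> {1..n}" using \<open>i \<in> {1..2 * n}\<close> by auto
        then show False using 3 that by blast
      qed simp
    qed
    then show ?thesis by (rule permutes_not_in[OF spread_permutes[OF assms]])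
  qed
  show "inj_on (\<lambda>k. 2 * k - 1) {1..n}" by (auto simp: inj_on_def)
  show "spread x y (2 * a - 1) = 2 * x a - 1" if "a \<in> {1..n}" for a
    using that by (intro spread_simps) auto
  show "spread x y (2 * a) = 2 * y a" if "a \<in> {1..n}" for a
    using that by (intro spread_simps) auto
qed (use assms in \<open>auto simp: inj_on_def\<close>)

text \<open>Perfect matchings \<open>m\<close> of \<open>{1..2n}\<close>, viewed as involutions without fixed points, are
  encoded by the permutations \<open>partner \<circ> m\<close>.\<close>

definition reversible :: "(nat \<Rightarrow> nat) \<Rightarrow> bool" where
  "reversible p \<longleftrightarrow> (\<forall>i. partner (p (partner (p i))) = i) \<and> (\<forall>i>0. partner (p i) \<noteq> i)"

text \<open>In other words, \<open>partner\<close> conjugates p to its inverse.\<close>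

lemma reversible_swap: "reversible p \<Longrightarrow> p (partner (p i)) = partner i"
  unfolding reversible_def by (metis partner_partner)

text \<open>The involution property comes from the exchange of the two copies. Fixed points are
  excluded by parity, which \<open>spread z (inv' z)\<close> preserves and \<open>partner\<close>
  changes on positive numbers.\<close>

lemma reversible_spread:
  assumes "z permutes {1..n}"
  shows "reversible (spread z (inv' z))"
  unfolding reversible_def
proof (intro conjI allI impI)
  note inv = permutes_inv[OF assms]
  let ?p = "spread z (inv' z)" and ?q = "spread (inv' z) z"
  fix i
  have "partner (?p (partner (?p i))) = ?q (partner (partner (?p i)))"
    by (rule partner_spread[OF assms inv])
  also have "\<dots> = ?q (?p i)" by simp
  also have "\<dots> = i"
    using fun_cong[OF spread_comp[OF assms inv, of "inv' z" z], of i] assms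
    by (simp add: permutes_inv_o)
  finally show "partner (?p (partner (?p i))) = i" .
  assume i: "i > 0"
  then show "partner (?p i) \<noteq> i"
  proof (cases i rule: nat_pair_cases)
    case (2 k)
    then have "z k > 0" using permutes_nat_pos[OF assms] by simp
    then have "partner (?p i) = 2 * z k" using 2 by (simp add: spread_simps)
    moreover have "2 * z k \<noteq> 2 * k - 1" using 2 by presburger
    ultimately show ?thesis using 2 by metis
  next
    case (3 k)
    then have "inv' z k > 0" using permutes_nat_pos[OF inv] by simp
    then have "partner (?p i) = 2 * inv' z k - 1" using 3 by (simp add: spread_simps)
    moreover have "2 * inv' z k - 1 \<noteq> 2 * k" using \<open>inv' z k > 0\<close> by presburger
    ultimately show ?thesis using 3 by metis
  qed simp
qed

lemma reversible_funpow:
  assumes "reversible p"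
  shows "partner ((p ^^ j) (partner ((p ^^ j) x))) = x"
proof (induction j arbitrary: x)
  case (Suc j)
  have "(p ^^ Suc j) (partner ((p ^^ Suc j) x)) = (p ^^ j) (p (partner (p ((p ^^ j) x))))"
    by (simp add: funpow_swap1)
  also have "\<dots> = (p ^^ j) (partner ((p ^^ j) x))" using reversible_swap[OF assms] by simp
  finally show ?case using Suc by simp
qed simp

text \<open>Cancelling p turns a relation p^j x = \<open>partner x\<close> into p^(j-2) (p x) =
  \<open>partner (p x)\<close>. This descent ends at j = 0 or j = 1, where it contradicts that
  neither \<open>partner\<close> nor the encoded matching has a positive fixed point.\<close>

lemma partner_funpow_neq:
  assumes "reversible p" "inj p" "p 0 = 0" "x > 0"
  shows "partner ((p ^^ j) x) \<noteq> x"
  using assms(4)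
proof (induction j arbitrary: x rule: less_induct)
  case (less j)
  consider "j = 0" | "j = 1" | k where "j = Suc (Suc k)" by (metis One_nat_def not0_implies_Suc)
  then show ?case
  proof cases
    case 1
    then show ?thesis using partner_neq less.prems by simp
  next
    case 2
    then show ?thesis using assms(1) less.prems by (simp add: reversible_def)
  next
    case (3 k)
    have px: "p x > 0" using assms(2,3) less.prems by (metis inj_eq neq0_conv)
    show ?thesis
    proof
      assume "partner ((p ^^ j) x) = x"
      then have "p (p ((p ^^ k) x)) = partner x" using 3 by (metis comp_apply funpow.simps(2) partner_partner)
      then have "p ((p ^^ k) (p x)) = p (partner (p x))"
        by (simp add: funpow_swap1 reversible_swap[OF assms(1)])
      then have "(p ^^ k) (p x) = partner (p x)" using assms(2) by (simp add: inj_eq)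
      then have "partner ((p ^^ k) (p x)) = p x" by simp
      then show False using less.IH[of k "p x"] 3 px by simp
    qed
  qed
qed

text \<open>\<open>partner\<close> inverts the powers of p as it inverts p, so orbits go to orbits;
  by the descent, none on positive numbers goes to itself. Orbits therefore come in pairs of equal
  size, the source of the doubling of types.\<close>

lemma reversible_orbit:
  assumes "reversible p" "p permutes {1..2 * n}"
  shows "orbit p (partner a) = partner ` orbit p a"
    and "a > 0 \<Longrightarrow> partner a \<notin> orbit p a"
proof -
  have perm: "permutation p" using assms(2) by (rule permutes_nat_permutation)
  have sub: "partner ` orbit p b \<subseteq> orbit p (partner b)" for b
  proof
    fix y assume "y \<in> partner ` orbit p b"
    then obtain k where k: "y = partner ((p ^^ k) b)" unfolding orbit_altdef by blast
    then have "(p ^^ k) y = partner b"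
      using reversible_funpow[OF assms(1), of k b] by (metis partner_partner)
    then have "partner b \<in> orbit p y"
      unfolding orbit_altdef_permutation[OF perm] by (metis (mono_tags, lifting) mem_Collect_eq)
    then have "orbit p (partner b) = orbit p y" by (rule permutation_orbit_eq[OF perm])
    then show "y \<in> orbit p (partner b)" using permutation_self_in_orbit[OF perm, of y] by simp
  qed
  show "orbit p (partner a) = partner ` orbit p a"
  proof (intro equalityI sub)
    show "orbit p (partner a) \<subseteq> partner ` orbit p a"
    proof
      fix y assume "y \<in> orbit p (partner a)"
      then have "partner y \<in> orbit p a" using sub[of "partner a"] by auto
      then show "y \<in> partner ` orbit p a" by (metis imageI partner_partner)
    qed
  qed
  assume a: "a > 0"
  show "partner a \<notin> orbit p a"
  proof
    assume "partner a \<in> orbit p a"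
    then obtain k where "partner a = (p ^^ k) a" unfolding orbit_altdef by blast
    then have "partner ((p ^^ k) a) = a" by (metis partner_partner)
    moreover have "p 0 = 0" using permutes_not_in[OF assms(2), of 0] by simp
    ultimately show False
      using partner_funpow_neq[OF assms(1) permutes_inj[OF assms(2)] _ a] by blast
  qed
qed

text \<open>The two orbits of \<open>p\<close> on a component of the graph are exchanged by \<open>partner\<close>; choosing
  one of them on every component (the one with the smaller minimum) and numbering the chosen
  points conjugates \<open>p\<close> into the form \<open>spread z z\<^sup>-\<^sup>1\<close>.\<close>

lemma reversible_normal_form:
  assumes "reversible p" "p permutes {1..2 * n}"
  shows "\<exists>z b. z permutes {1..n} \<and> b permutes {1..2 * n} \<and> (\<forall>i. b (partner i) = partner (b i)) \<and>
    p = conjugate b (spread z (inv' z))"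
proof -
  let ?V = "{1..2 * n}"
  note rp = reversible_swap[OF assms(1)]
  have perm: "permutation p" using assms(2) by (rule permutes_nat_permutation)
  define A where "A = {a \<in> ?V. Min (orbit p a) < Min (orbit p (partner a))}"
  have fo: "finite (orbit p a)" "orbit p a \<noteq> {}" for a
    by (rule finite_orbit_permutation[OF perm], rule orbit_nonempty)
  have Apart: "partner a \<in> A \<longleftrightarrow> a \<notin> A" if "a \<in> ?V" for a
  proof -
    have "Min (orbit p a) \<noteq> Min (orbit p (partner a))"
    proof
      assume "Min (orbit p a) = Min (orbit p (partner a))"
      then have "Min (orbit p a) \<in> orbit p a \<inter> orbit p (partner a)"
        using Min_in[OF fo, of a] Min_in[OF fo, of "partner a"] by simp
      then have "orbit p a = orbit p (partner a)"
        using permutation_orbit_eq[OF perm, of "Min (orbit p a)"] by blast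
      then have "partner a \<in> orbit p a" using permutation_self_in_orbit[OF perm, of "partner a"] by simp
      then show False using reversible_orbit(2)[OF assms] that by simp
    qed
    then show ?thesis using that partner_in[of a n] by (auto simp: A_def)
  qed
  have Ap: "p a \<in> A \<longleftrightarrow> a \<in> A" for a
  proof -
    have "orbit p (p a) = orbit p a" by (rule permutation_orbit_step[OF perm])
    moreover have "orbit p (partner (p a)) = orbit p (partner a)"
      using permutation_orbit_step[OF perm, of "partner (p a)"] rp by simp
    ultimately show ?thesis
      using permutes_in_image[OF assms(2), of a] by (simp only: A_def mem_Collect_eq)
  qed
  have AV: "A \<subseteq> ?V" by (auto simp: A_def)
  have fA: "finite A" using AV by (rule finite_subset) simp
  have cA: "card A = n"
  proof -
    have "partner ` A = ?V - A"
    proof (intro equalityI subsetI)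
      fix i assume "i \<in> partner ` A"
      then obtain a where "a \<in> A" "i = partner a" by blast
      then show "i \<in> ?V - A" using Apart[of a] AV partner_in[of a n] by blast
    next
      fix i assume "i \<in> ?V - A"
      then have "partner i \<in> A" using Apart by blast
      then show "i \<in> partner ` A" by (metis imageI partner_partner)
    qed
    moreover have "card (partner ` A) = card A" by (rule card_image) (simp add: inj_on_def)
    ultimately have "card (?V - A) = card A" by simp
    then have "2 * n = card A + card A"
      using card_Diff_subset[OF fA AV] card_mono[OF _ AV] by simp
    then show ?thesis by simp
  qed
  then obtain \<beta> where \<beta>: "bij_betw \<beta> {1..n} A"
    using finite_same_card_bij[of "{1..n}" A] fA by auto
  have \<beta>in: "\<beta> k \<in> A" if "k \<in> {1..n}" for k using bij_betwE[OF \<beta>] that by blast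
  \<comment> \<open>The chosen points are placed on the odd numbers and their partners on the even
    numbers next to them, which makes b commute with \<open>partner\<close>.\<close>
  define b where "b i = (if i \<in> ?V then (if odd i then \<beta> ((i + 1) div 2) else partner (\<beta> (i div 2))) else i)" for i
  have b1: "b (2 * k - 1) = \<beta> k" and b2: "b (2 * k) = partner (\<beta> k)" if "k \<in> {1..n}" for k
    using that by (auto simp: b_def)
  have bout: "b i = i" if "i \<notin> ?V" for i using that by (auto simp: b_def)
  have cases: "\<exists>k\<in>{1..n}. i = 2 * k - 1 \<or> i = 2 * k" if "i \<in> ?V" for i
    using that by (cases i rule: nat_pair_cases) (auto intro!: bexI)
  have b: "b permutes ?V"
  proof (rule bij_imp_permutes)
    have "b ` ?V \<subseteq> ?V"
    proof
      fix j assume "j \<in> b ` ?V"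
      then obtain i where "i \<in> ?V" "j = b i" by blast
      then obtain k where "k \<in> {1..n}" "j = \<beta> k \<or> j = partner (\<beta> k)" using cases[of i] b1 b2 by blast
      then show "j \<in> ?V" using \<beta>in[of k] AV partner_in[of "\<beta> k" n] by blast
    qed
    moreover have "inj_on b ?V"
    proof (rule inj_onI)
      fix i j assume ij: "i \<in> ?V" "j \<in> ?V" "b i = b j"
      obtain k where k: "k \<in> {1..n}" "i = 2 * k - 1 \<or> i = 2 * k" using cases ij(1) by blast
      obtain l where l: "l \<in> {1..n}" "j = 2 * l - 1 \<or> j = 2 * l" using cases ij(2) by blast
      have ne: "\<beta> k \<noteq> partner (\<beta> l)" "\<beta> l \<noteq> partner (\<beta> k)"
        using Apart[of "\<beta> l"] Apart[of "\<beta> k"] \<beta>in k(1) l(1) AV by (metis subsetD)+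
      have inj: "\<beta> k = \<beta> l \<Longrightarrow> k = l"
        by (rule inj_onD[OF bij_betw_imp_inj_on[OF \<beta>] _ k(1) l(1)])
      show "i = j"
        using k(2) l(2) ij(3) ne inj b1[OF k(1)] b2[OF k(1)] b1[OF l(1)] b2[OF l(1)] by auto
    qed
    ultimately show "bij_betw b ?V ?V" by (simp add: bij_betw_def endo_inj_surj)
  qed (rule bout)
  have bp: "b (partner i) = partner (b i)" for i
  proof (cases "i \<in> ?V")
    case True
    then obtain k where k: "k \<in> {1..n}" "i = 2 * k - 1 \<or> i = 2 * k" using cases by blast
    then have "k > 0" by simp
    then show ?thesis using k b1[OF k(1)] b2[OF k(1)] by auto
  next
    case False
    then have "partner i \<notin> ?V" using partner_in[of i n] by blast
    then show ?thesis by (simp only: bout False not_False_eq_True)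
  qed
  define \<gamma> where "\<gamma> = inv_into {1..n} \<beta>"
  have \<beta>\<gamma>: "\<beta> (\<gamma> a) = a" "\<gamma> a \<in> {1..n}" if "a \<in> A" for a
    using bij_betw_inv_into_right[OF \<beta> that] bij_betwE[OF bij_betw_inv_into[OF \<beta>]] that
    by (auto simp: \<gamma>_def)
  have \<gamma>\<beta>: "\<gamma> (\<beta> k) = k" if "k \<in> {1..n}" for k
    using bij_betw_inv_into_left[OF \<beta> that] by (simp add: \<gamma>_def)
  define z where "z k = (if k \<in> {1..n} then \<gamma> (p (\<beta> k)) else k)" for k
  have \<beta>z: "\<beta> (z k) = p (\<beta> k)" and zin: "z k \<in> {1..n}" if "k \<in> {1..n}" for k
    using \<beta>\<gamma>[of "p (\<beta> k)"] \<beta>in[OF that] Ap that by (auto simp: z_def)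
  have z: "z permutes {1..n}"
  proof (rule bij_imp_permutes)
    have "inj_on z {1..n}"
    proof (rule inj_onI)
      fix k l assume kl: "k \<in> {1..n}" "l \<in> {1..n}" "z k = z l"
      then have "p (\<beta> k) = p (\<beta> l)" using \<beta>z by metis
      then have "\<beta> k = \<beta> l" using permutes_inj[OF assms(2)] by (simp add: inj_eq)
      then show "k = l" using bij_betw_imp_inj_on[OF \<beta>] kl(1,2) by (meson inj_onD)
    qed
    moreover have "z ` {1..n} \<subseteq> {1..n}" using zin by blast
    ultimately show "bij_betw z {1..n} {1..n}" by (simp add: bij_betw_def endo_inj_surj)
  qed (auto simp: z_def)
  have pb: "p (b i) = b (spread z (inv' z) i)" for i
  proof (cases "i \<in> ?V")
    case True
    then obtain k where k: "k \<in> {1..n}" "i = 2 * k - 1 \<or> i = 2 * k" using cases by blast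
    have "k > 0" using k by simp
    from k(2) show ?thesis
    proof
      assume i: "i = 2 * k - 1"
      then show ?thesis using b1[OF k(1)] b1[OF zin[OF k(1)]] \<beta>z[OF k(1)] \<open>k > 0\<close>
        by (simp add: spread_simps)
    next
      assume i: "i = 2 * k"
      \<comment> \<open>On the partners p runs backwards: \<beta> k is p (\<beta> j), and
        reversibility sends the partner of p (\<beta> j) to the partner of \<beta> j.\<close>
      define j where "j = inv' z k"
      have j: "j \<in> {1..n}" "z j = k"
        using permutes_in_image[OF permutes_inv[OF z], of k] k(1) permutes_inverses(1)[OF z]
        by (auto simp: j_def)
      have "p (b i) = p (partner (p (\<beta> j)))" using b2[OF k(1)] i \<beta>z[OF j(1)] j(2) by simp
      also have "\<dots> = b (2 * j)" using rp b2[OF j(1)] by simp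
      also have "\<dots> = b (spread z (inv' z) i)" using i \<open>k > 0\<close> by (simp add: spread_simps j_def)
      finally show ?thesis .
    qed
  next
    case False
    then show ?thesis
      using bout permutes_not_in[OF assms(2) False]
        permutes_not_in[OF spread_permutes[OF z permutes_inv[OF z]] False] by simp
  qed
  have "p = conjugate b (spread z (inv' z))"
  proof
    fix i
    show "p i = conjugate b (spread z (inv' z)) i"
      using pb[of "inv' b i"] permutes_inverses(1)[OF b] by (simp add: conjugate_def)
  qed
  then show ?thesis using z b bp by blast
qed

lemma reversible_conjugate:
  assumes "bij b" "\<And>i. b (partner i) = partner (b i)" "reversible p" "b 0 = 0"
  shows "reversible (conjugate b p)"
  unfolding reversible_def
proof (intro conjI allI impI)
  fix i
  obtain j where j: "i = b j" using assms(1) by (metis bij_pointE)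
  show "partner (conjugate b p (partner (conjugate b p i))) = i"
    using assms(3) unfolding j
    by (simp add: conjugate_apply[OF assms(1)] assms(2)[symmetric] reversible_def)
  assume "i > 0"
  then have "j > 0" using j assms(4) by (cases j) auto
  then have "partner (p j) \<noteq> j" using assms(3) by (simp add: reversible_def)
  then show "partner (conjugate b p i) \<noteq> i"
    unfolding j using bij_is_inj[OF assms(1)]
    by (simp add: conjugate_apply[OF assms(1)] assms(2)[symmetric] inj_eq)
qed

lemma double_mset_inject [simp]: "\<mu> + \<mu> = \<nu> + \<nu> \<longleftrightarrow> \<mu> = (\<nu> :: 'a multiset)"
proof
  assume *: "\<mu> + \<mu> = \<nu> + \<nu>"
  show "\<mu> = \<nu>"
  proof (rule multiset_eqI)
    fix a show "count \<mu> a = count \<nu> a" using arg_cong[OF *, of "\<lambda>m. count m a"] by simp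
  qed
qed simp

lemma stype_double: "z permutes {1..n} \<Longrightarrow> stype (spread z (inv' z)) = stype z + stype z"
  using stype_spread[OF _ permutes_inv] stype_inv[OF permutes_nat_permutation] by simp

lemma conjugate_conjugate:
  "bij b \<Longrightarrow> bij c \<Longrightarrow> conjugate b (conjugate c x) = conjugate (b \<circ> c) x"
  by (simp add: conjugate_def o_inv_distrib comp_assoc)

lemma conjugate_inv_cancel: "bij b \<Longrightarrow> conjugate (inv' b) (conjugate b x) = x"
  by (simp add: conjugate_conjugate bij_imp_bij_inv bij_is_inj) (simp add: conjugate_def)

lemma conjugate_spread:
  assumes "c permutes {1..n}" "x permutes {1..n}" "y permutes {1..n}"
  shows "conjugate (spread c c) (spread x y) = spread (conjugate c x) (conjugate c y)"
proof -
  note inv = permutes_inv[OF assms(1)]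
  show ?thesis
    unfolding conjugate_def inv_spread[OF assms(1,1)]
    by (simp add: spread_comp[OF assms(2,3)] spread_comp[OF inv inv])
qed

text \<open>Normal forms of equal type differ by a conjugation in S_n, which
  \<open>spread c c\<close> lifts to the centralizer of \<open>partner\<close>. Commuting with
  \<open>partner\<close> matters because conjugation then preserves reversibility.\<close>

lemma reversible_conj:
  assumes "reversible p" "p permutes {1..2 * n}" "reversible q" "q permutes {1..2 * n}"
    and "stype p = stype q"
  shows "\<exists>b. b permutes {1..2 * n} \<and> (\<forall>i. b (partner i) = partner (b i)) \<and> q = conjugate b p"
proof -
  obtain z b where z: "z permutes {1..n}" and b: "b permutes {1..2 * n}"
    "\<And>i. b (partner i) = partner (b i)" "p = conjugate b (spread z (inv' z))"
    using reversible_normal_form[OF assms(1,2)] by blast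
  obtain z' b' where z': "z' permutes {1..n}" and b': "b' permutes {1..2 * n}"
    "\<And>i. b' (partner i) = partner (b' i)" "q = conjugate b' (spread z' (inv' z'))"
    using reversible_normal_form[OF assms(3,4)] by blast
  note bij = permutes_bij[OF b(1)] permutes_bij[OF b'(1)]
  have "stype p = stype z + stype z"
    unfolding b(3) using stype_conjugate[OF _ bij(1)] stype_double[OF z]
      permutes_nat_permutation[OF spread_permutes[OF z permutes_inv[OF z]]] by simp
  moreover have "stype q = stype z' + stype z'"
    unfolding b'(3) using stype_conjugate[OF _ bij(2)] stype_double[OF z']
      permutes_nat_permutation[OF spread_permutes[OF z' permutes_inv[OF z']]] by simp
  ultimately have "stype z = stype z'" using assms(5) by simp
  then have "\<exists>c. c permutes {1..n} \<and> z' = c \<circ> z \<circ> inv' c"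
    by (rule conj_of_stype_eq[OF finite_atLeastAtMost z z'])
  then obtain c where c: "c permutes {1..n}" "z' = conjugate c z" by (auto simp: conjugate_def)
  define d where "d = spread c c"
  have d: "d permutes {1..2 * n}" "\<And>i. d (partner i) = partner (d i)"
    using spread_permutes[OF c(1,1)] partner_spread[OF c(1,1)] by (simp_all add: d_def)
  note bd = permutes_bij[OF d(1)]
  have zz: "spread z' (inv' z') = conjugate d (spread z (inv' z))"
    unfolding d_def conjugate_spread[OF c(1) z permutes_inv[OF z]] c(2)
    using permutes_bij[OF c(1)] permutes_bij[OF z] by (simp add: conjugate_inv)
  have "q = conjugate (b' \<circ> d \<circ> inv' b) p"
  proof -
    have "spread z (inv' z) = conjugate (inv' b) p"
      unfolding b(3) by (rule conjugate_inv_cancel[OF bij(1), symmetric])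
    then show ?thesis
      unfolding b'(3) zz using bij bd
      by (simp add: conjugate_conjugate bij_comp bij_imp_bij_inv comp_assoc)
  qed
  moreover have "b' \<circ> d \<circ> inv' b permutes {1..2 * n}"
    by (intro permutes_compose permutes_inv b b' d)
  moreover have "inv' b (partner i) = partner (inv' b i)" for i
  proof -
    have "b (partner (inv' b i)) = partner i" using b(2) permutes_inverses(1)[OF b(1)] by simp
    then show ?thesis using permutes_inverses(2)[OF b(1)] by metis
  qed
  then have "\<forall>i. (b' \<circ> d \<circ> inv' b) (partner i) = partner ((b' \<circ> d \<circ> inv' b) i)"
    using b'(2) d(2) by simp
  ultimately show ?thesis by blast
qed

section \<open>Coset types\<close>

text \<open>\<open>inv' w \<circ> t_perm n \<circ> w\<close> is the matching that joins
  \<open>inv' w (2 * k - 1)\<close> to \<open>inv' w (2 * k)\<close>, the second matching of the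
  coset graph; the permutation applies it and then the standard matching.\<close>

definition hecke_perm :: "nat \<Rightarrow> (nat \<Rightarrow> nat) \<Rightarrow> nat \<Rightarrow> nat" where
  "hecke_perm n w = t_perm n \<circ> inv' w \<circ> t_perm n \<circ> w"

lemma hecke_perm_permutes: "w permutes {1..2 * n} \<Longrightarrow> hecke_perm n w permutes {1..2 * n}"
  unfolding hecke_perm_def by (intro permutes_compose permutes_inv t_perm_permutes)

lemma partner_hecke_perm:
  assumes "w permutes {1..2 * n}"
  shows "i \<in> {1..2 * n} \<Longrightarrow> partner (hecke_perm n w i) = inv' w (partner (w i))"
    and "i \<in> {1..2 * n} \<Longrightarrow> inv' w (partner (w i)) \<in> {1..2 * n}"
    and "i \<notin> {1..2 * n} \<Longrightarrow> hecke_perm n w i = i"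
proof -
  assume i: "i \<in> {1..2 * n}"
  then have "w i \<in> {1..2 * n}" using permutes_in_image[OF assms] by blast
  then have t: "t_perm n (w i) = partner (w i)" "partner (w i) \<in> {1..2 * n}"
    using partner_in[of "w i" n] by (simp_all only: t_perm_eq if_True)
  show in': "inv' w (partner (w i)) \<in> {1..2 * n}"
    using t(2) permutes_in_image[OF permutes_inv[OF assms]] by blast
  have "hecke_perm n w i = t_perm n (inv' w (partner (w i)))" by (simp add: hecke_perm_def t(1))
  also have "\<dots> = partner (inv' w (partner (w i)))" using in' by (simp only: t_perm_eq if_True)
  finally show "partner (hecke_perm n w i) = inv' w (partner (w i))" by simp
next
  assume "i \<notin> {1..2 * n}"
  then show "hecke_perm n w i = i" by (rule permutes_not_in[OF hecke_perm_permutes[OF assms]])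
qed

lemma reversible_hecke_perm:
  assumes "w permutes {1..2 * n}"
  shows "reversible (hecke_perm n w)"
  unfolding reversible_def
proof (intro conjI allI impI)
  note ph = partner_hecke_perm[OF assms]
  fix i
  show "partner (hecke_perm n w (partner (hecke_perm n w i))) = i"
  proof (cases "i \<in> {1..2 * n}")
    case True
    then show ?thesis
      using ph(1)[OF True] ph(1)[OF ph(2)[OF True]] permutes_inverses[OF assms] by simp
  next
    case False
    moreover have "partner i \<notin> {1..2 * n}" using False partner_in by blast
    ultimately show ?thesis using ph(3) by simp
  qed
  assume "i > 0"
  show "partner (hecke_perm n w i) \<noteq> i"
  proof (cases "i \<in> {1..2 * n}")
    case True
    have "w i > 0" using \<open>i > 0\<close> permutes_nat_pos[OF assms] by simp
    then have "partner (w i) \<noteq> w i" by (rule partner_neq)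
    then show ?thesis using ph(1)[OF True] permutes_inverses(1)[OF assms] by metis
  next
    case False
    then show ?thesis using ph(3) partner_neq \<open>i > 0\<close> by simp
  qed
qed

text \<open>Conjugating \<open>spread id z\<close> by \<open>partner\<close> gives
  \<open>spread z id\<close>, which is \<open>spread z (inv' z) \<circ> spread id z\<close>; so the
  inverse of \<open>spread id z\<close>, moved by b, is a preimage. Every reversible permutation can
  thus occur as a right factor in the Hecke product.\<close>

lemma ex_hecke_perm:
  assumes "reversible p" "p permutes {1..2 * n}"
  shows "\<exists>w. w permutes {1..2 * n} \<and> hecke_perm n w = p"
proof -
  obtain z b where z: "z permutes {1..n}" and b: "b permutes {1..2 * n}"
    "\<And>i. b (partner i) = partner (b i)" "p = conjugate b (spread z (inv' z))"
    using reversible_normal_form[OF assms] by blast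
  define g where "g = b \<circ> spread id z"
  have g: "g permutes {1..2 * n}"
    unfolding g_def using b z by (intro permutes_compose spread_permutes permutes_id)
  have pg: "partner (g (partner i)) = p (g i)" for i
  proof -
    have "partner (g (partner i)) = b (partner (spread id z (partner i)))"
      using b(2) by (simp add: g_def)
    also have "\<dots> = b (spread z id i)" using partner_spread[OF permutes_id z, of "partner i"] by simp
    also have "spread z id = spread z (inv' z) \<circ> spread id z"
      using spread_comp[OF permutes_id z, of z "inv' z"] permutes_inv_o(2)[OF z] by simp
    finally show ?thesis
      using b(3) conjugate_apply[OF permutes_bij[OF b(1)]] by (simp add: g_def)
  qed
  define w where "w = inv' g"
  have w: "w permutes {1..2 * n}" unfolding w_def by (rule permutes_inv[OF g])
  have iw: "inv' w = g" unfolding w_def by (rule permutes_inv_inv[OF g])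
  have "hecke_perm n w i = p i" for i
  proof (cases "i \<in> {1..2 * n}")
    case True
    have "partner (hecke_perm n w i) = g (partner (w i))"
      using partner_hecke_perm(1)[OF w True] iw by simp
    then have "hecke_perm n w i = partner (g (partner (w i)))" by (metis partner_partner)
    also have "\<dots> = p (g (w i))" by (rule pg)
    also have "g (w i) = i" using permutes_inverses(1)[OF g] by (simp add: w_def)
    finally show ?thesis .
  next
    case False
    then show ?thesis using partner_hecke_perm(3)[OF w] permutes_not_in[OF assms(2)] by simp
  qed
  then show ?thesis using w by blast
qed

lemma doubleton_eq_pair:
  "(\<exists>k\<in>{1..n}. {a, b} = {2 * k - 1, 2 * k}) \<longleftrightarrow> a \<in> {1..2 * n} \<and> b = partner a"
proof
  assume "\<exists>k\<in>{1..n}. {a, b} = {2 * k - 1, 2 * k}"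
  then obtain k where k: "k \<in> {1..n}" "a = 2 * k - 1 \<and> b = 2 * k \<or> a = 2 * k \<and> b = 2 * k - 1"
    by (auto simp: doubleton_eq_iff)
  then show "a \<in> {1..2 * n} \<and> b = partner a" by auto
next
  assume *: "a \<in> {1..2 * n} \<and> b = partner a"
  then show "\<exists>k\<in>{1..n}. {a, b} = {2 * k - 1, 2 * k}"
  proof (cases a rule: nat_pair_cases)
    case (2 k)
    then have "k \<in> {1..n}" "{a, b} = {2 * k - 1, 2 * k}" using * by auto
    then show ?thesis by blast
  next
    case (3 k)
    then have "k \<in> {1..n}" "{a, b} = {2 * k - 1, 2 * k}" using * by auto
    then show ?thesis by blast
  qed simp
qed

lemma coset_graph_edge:
  assumes "w permutes {1..2 * n}"
  shows "{a, b} \<in># coset_graph n w \<longleftrightarrow>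
    a \<in> {1..2 * n} \<and> (b = partner a \<or> b = partner (hecke_perm n w a))"
proof -
  have w: "inv' w (w i) = i" "w (inv' w i) = i" for i using permutes_inverses[OF assms] by auto
  have img: "{a, b} = {inv' w i, inv' w j} \<longleftrightarrow> {w a, w b} = {i, j}" for i j
  proof
    assume "{a, b} = {inv' w i, inv' w j}"
    then have "w ` {a, b} = w ` {inv' w i, inv' w j}" by simp
    then show "{w a, w b} = {i, j}" using w by simp
  next
    assume "{w a, w b} = {i, j}"
    then have "inv' w ` {w a, w b} = inv' w ` {i, j}" by simp
    then show "{a, b} = {inv' w i, inv' w j}" using w by simp
  qed
  have "{a, b} \<in># coset_graph n w \<longleftrightarrow>
      (\<exists>k\<in>{1..n}. {a, b} = {2 * k - 1, 2 * k}) \<or> (\<exists>k\<in>{1..n}. {w a, w b} = {2 * k - 1, 2 * k})"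
    by (auto simp: coset_graph_def set_mset_sum img)
  also have "\<dots> \<longleftrightarrow> a \<in> {1..2 * n} \<and> b = partner a \<or> a \<in> {1..2 * n} \<and> w b = partner (w a)"
    unfolding doubleton_eq_pair using permutes_in_image[OF assms, of a] by blast
  also have "w b = partner (w a) \<longleftrightarrow> b = inv' w (partner (w a))" using w by metis
  finally show ?thesis using partner_hecke_perm(1)[OF assms, of a] by metis
qed

text \<open>Crossing an edge of the second matching and then one of the first is one step of p.
  Conversely, both kinds of edges stay within an orbit of p together with its image under
  \<open>partner\<close>.\<close>

lemma graph_components_coset_graph:
  assumes "w permutes {1..2 * n}"
  shows "graph_components (2 * n) (coset_graph n w)
    = (\<lambda>a. orbit (hecke_perm n w) a \<union> partner ` orbit (hecke_perm n w) a) ` {1..2 * n}"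
proof -
  let ?V = "{1..2 * n}"
  define p where "p = hecke_perm n w"
  have p: "p permutes ?V" "reversible p"
    using hecke_perm_permutes[OF assms] reversible_hecke_perm[OF assms] by (simp_all add: p_def)
  have perm: "permutation p" using p(1) by (rule permutes_nat_permutation)
  define R where "R = {(a, b) \<in> ?V \<times> ?V. {a, b} \<in># coset_graph n w}"
  have R: "(a, b) \<in> R \<longleftrightarrow> a \<in> ?V \<and> (b = partner a \<or> b = partner (p a))" for a b
    unfolding R_def using coset_graph_edge[OF assms, of a b] partner_in[of a n] partner_in[of "p a" n]
      permutes_in_image[OF p(1), of a] by (auto simp only: p_def)
  have "R\<^sup>* `` {a} = orbit p a \<union> partner ` orbit p a" if a: "a \<in> ?V" for a
  proof (intro equalityI subsetI)
    fix b assume "b \<in> R\<^sup>* `` {a}"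
    then have "(a, b) \<in> R\<^sup>*" by simp
    then show "b \<in> orbit p a \<union> partner ` orbit p a"
    proof (induction rule: rtrancl_induct)
      case base
      show ?case using permutation_self_in_orbit[OF perm] by blast
    next
      case (step y z)
      then have z: "z = partner y \<or> z = partner (p y)" using R by blast
      from step.IH show ?case
      proof
        assume "y \<in> orbit p a"
        then show ?thesis using z orbit.step[of y p a] by blast
      next
        assume "y \<in> partner ` orbit p a"
        then obtain o1 where o1: "o1 \<in> orbit p a" "y = partner o1" by blast
        \<comment> \<open>The second edge at \<open>partner o1\<close> leads back to the predecessor
          of o1, which lies in the same orbit because the orbit is a cycle.\<close>
        obtain o2 where o2: "o2 \<in> orbit p a" "o1 = p o2"
          using o1(1) permutation_self_in_orbit[OF perm, of a] by (cases rule: orbit.cases) auto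
        have "partner (p y) = o2" using o1(2) o2(2) reversible_swap[OF p(2)] by simp
        then show ?thesis using z o1 o2 by auto
      qed
    qed
  next
    have reach: "(a, b) \<in> R\<^sup>*" if "b \<in> orbit p a" for b
      using that
    proof (induction rule: orbit.induct)
      case base
      have "(a, partner (p a)) \<in> R" "(partner (p a), p a) \<in> R"
        using a R partner_in[of "p a" n] permutes_in_image[OF p(1), of a] by auto
      then show ?case by (meson r_into_rtrancl rtrancl_trans)
    next
      case (step b)
      have "b \<in> ?V" using step.hyps permutes_orbit_subset[OF p(1) a] by blast
      then have "(b, partner (p b)) \<in> R" "(partner (p b), p b) \<in> R"
        using R partner_in[of "p b" n] permutes_in_image[OF p(1), of b] by auto
      then show ?case using step.IH by (meson rtrancl.rtrancl_into_rtrancl)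
    qed
    fix b assume "b \<in> orbit p a \<union> partner ` orbit p a"
    then show "b \<in> R\<^sup>* `` {a}"
    proof
      assume "b \<in> partner ` orbit p a"
      then obtain o1 where o1: "o1 \<in> orbit p a" "b = partner o1" by blast
      then have "(o1, b) \<in> R" using R permutes_orbit_subset[OF p(1) a] by blast
      then show ?thesis using reach[OF o1(1)] by (simp add: rtrancl.rtrancl_into_rtrancl)
    qed (use reach in simp)
  qed
  then show ?thesis
    unfolding graph_components_def quotient_def R_def[symmetric] p_def[symmetric] by auto
qed

text \<open>A component is the disjoint union of two orbits of equal size exchanged by
  \<open>partner\<close>, and half its number of vertices is the size of either. So each part of the
  coset type occurs twice as a cycle length.\<close>

lemma cycle_type_hecke_perm:
  assumes "w permutes {1..2 * n}"
  shows "image_mset card (mset_set (orbit (hecke_perm n w) ` {1..2 * n})) = coset_type n w + coset_type n w"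
proof -
  let ?V = "{1..2 * n}"
  define p where "p = hecke_perm n w"
  have p: "p permutes ?V" "reversible p"
    using hecke_perm_permutes[OF assms] reversible_hecke_perm[OF assms] by (simp_all add: p_def)
  have perm: "permutation p" using p(1) by (rule permutes_nat_permutation)
  note orb = reversible_orbit[OF p(2,1)]
  define g where "g = (\<lambda>S. S \<union> partner ` S)"
  have inj: "inj_on partner S" for S by (simp add: inj_on_def)
  have disj: "orbit p a \<inter> partner ` orbit p a = {}" if a: "a \<in> ?V" for a
  proof (rule ccontr)
    assume "orbit p a \<inter> partner ` orbit p a \<noteq> {}"
    then obtain y where y: "y \<in> orbit p a" "partner y \<in> orbit p a" by blast
    have "orbit p y = orbit p a" using permutation_orbit_eq[OF perm y(1)] .
    moreover have "y > 0" using y(1) permutes_orbit_subset[OF p(1) a] by fastforce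
    ultimately show False using orb(2)[of y] y(2) by simp
  qed
  have cardg: "card (g (orbit p a)) div 2 = card (orbit p a)" if "a \<in> ?V" for a
    using finite_orbit_permutation[OF perm] disj[OF that] card_image[OF inj, of "orbit p a"]
    by (simp add: g_def card_Un_disjoint)
  have fib: "{S \<in> orbit p ` ?V. g S = g (orbit p a)} = {orbit p a, orbit p (partner a)}" if a: "a \<in> ?V" for a
  proof (intro equalityI subsetI)
    fix S assume "S \<in> {S \<in> orbit p ` ?V. g S = g (orbit p a)}"
    then obtain b where b: "S = orbit p b" "g (orbit p b) = g (orbit p a)" by blast
    have "b \<in> g (orbit p a)" using b(2) permutation_self_in_orbit[OF perm, of b] by (auto simp: g_def)
    then have "b \<in> orbit p a \<or> b \<in> orbit p (partner a)" by (simp add: g_def orb(1))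
    then show "S \<in> {orbit p a, orbit p (partner a)}" using b(1) permutation_orbit_eq[OF perm] by blast
  next
    fix S assume "S \<in> {orbit p a, orbit p (partner a)}"
    moreover have "g (orbit p (partner a)) = g (orbit p a)"
      by (auto simp: g_def orb(1) image_image)
    moreover have "partner a \<in> ?V" using a partner_in by blast
    ultimately show "S \<in> {S \<in> orbit p ` ?V. g S = g (orbit p a)}" using a by blast
  qed
  have comps: "graph_components (2 * n) (coset_graph n w) = g ` orbit p ` ?V"
    unfolding graph_components_coset_graph[OF assms] p_def[symmetric] g_def by (simp add: image_image)
  have "image_mset card (mset_set (orbit p ` ?V)) = (\<Sum>S\<in>orbit p ` ?V. {#card S#})"
    by (simp add: sum_unfold_sum_mset)
  also have "\<dots> = (\<Sum>C\<in>g ` orbit p ` ?V. \<Sum>S | S \<in> orbit p ` ?V \<and> g S = C. {#card S#})"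
    by (rule sum.group[symmetric]) auto
  also have "\<dots> = (\<Sum>C\<in>g ` orbit p ` ?V. {#card C div 2#} + {#card C div 2#})"
  proof (rule sum.cong[OF refl])
    fix C assume "C \<in> g ` orbit p ` ?V"
    then obtain a where a: "a \<in> ?V" "C = g (orbit p a)" by blast
    have "orbit p a \<noteq> orbit p (partner a)"
      using disj[OF a(1)] orb(1) orbit_nonempty[of p a] by auto
    moreover have "card (orbit p (partner a)) = card (orbit p a)"
      unfolding orb(1) by (rule card_image[OF inj])
    ultimately show "(\<Sum>S | S \<in> orbit p ` ?V \<and> g S = C. {#card S#}) = {#card C div 2#} + {#card C div 2#}"
      unfolding a(2) fib[OF a(1)] using cardg[OF a(1)] by simp
  qed
  also have "\<dots> = coset_type n w + coset_type n w"
    unfolding coset_type_def comps sum.distrib by (simp add: sum_unfold_sum_mset)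
  finally show ?thesis unfolding p_def .
qed

lemma stype_hecke_perm:
  assumes "w permutes {1..2 * n}"
  shows "stype (hecke_perm n w) = stable (coset_type n w) + stable (coset_type n w)"
proof -
  have "stype (hecke_perm n w) = stable (coset_type n w + coset_type n w)"
    using stable_orbits[OF finite_atLeastAtMost hecke_perm_permutes[OF assms]]
    unfolding cycle_type_hecke_perm[OF assms] by simp
  then show ?thesis by (simp add: stable_def)
qed

lemma stable_coset_type_iff:
  "w permutes {1..2 * n} \<Longrightarrow> stable (coset_type n w) = \<mu> \<longleftrightarrow> stype (hecke_perm n w) = \<mu> + \<mu>"
  by (simp add: stype_hecke_perm)

section \<open>Factorization counts and the Hecke product\<close>

definition hecke_factorizations ::
    "nat \<Rightarrow> nat multiset \<Rightarrow> nat multiset \<Rightarrow> (nat \<Rightarrow> nat) \<Rightarrow> (nat \<Rightarrow> nat) set" where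
  "hecke_factorizations n \<alpha> \<mu> q = {p. p permutes {1..2 * n} \<and> reversible p \<and>
     stype (q \<circ> inv' p) = \<alpha> + \<alpha> \<and> stype p = \<mu> + \<mu>}"

lemma finite_hecke_factorizations: "finite (hecke_factorizations n \<alpha> \<mu> q)"
  by (rule finite_subset[OF _ finite_permutations[of "{1..2 * n}"]]) (auto simp: hecke_factorizations_def)

text \<open>Conjugation by \<open>t_perm n \<circ> y \<circ> t_perm n\<close> turns the quotient of
  the two permutations into the permutation of \<open>x \<circ> inv' y\<close>. The first function
  of the convolution may thus be read as a condition on a left factor, which in general is only
  conjugate to a reversible permutation.\<close>

lemma hecke_perm_quotient:
  assumes "x permutes {1..2 * n}" "y permutes {1..2 * n}"
  shows "stype (hecke_perm n (x \<circ> inv' y)) = stype (hecke_perm n x \<circ> inv' (hecke_perm n y))"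
proof -
  let ?t = "t_perm n"
  define c where "c = ?t \<circ> y \<circ> ?t"
  have c: "c permutes {1..2 * n}" unfolding c_def
    by (intro permutes_compose t_perm_permutes assms)
  have tt: "inv' ?t = ?t" by (rule inv_unique_comp) (simp_all add: fun_eq_iff)
  note bijs = permutes_bij[OF assms(1)] permutes_bij[OF assms(2)] permutes_bij[OF t_perm_permutes[of n]]
  note inv = o_inv_distrib bij_comp bij_imp_bij_inv inv_inv_eq bijs
  have 1: "inv' (hecke_perm n y) = inv' y \<circ> ?t \<circ> y \<circ> ?t"
    unfolding hecke_perm_def by (simp add: inv tt comp_assoc)
  have 2: "inv' (x \<circ> inv' y) = y \<circ> inv' x" by (simp add: inv)
  have 3: "inv' c = ?t \<circ> inv' y \<circ> ?t" unfolding c_def by (simp add: inv tt comp_assoc)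
  have "conjugate c (hecke_perm n x \<circ> inv' (hecke_perm n y)) = hecke_perm n (x \<circ> inv' y)"
    unfolding conjugate_def 1 3
    by (rule ext) (simp add: hecke_perm_def 2 c_def permutes_inverses[OF assms(2)])
  moreover have "hecke_perm n x \<circ> inv' (hecke_perm n y) permutes {1..2 * n}"
    by (intro permutes_compose permutes_inv hecke_perm_permutes assms)
  ultimately show ?thesis
    using stype_conjugate[OF permutes_nat_permutation permutes_bij[OF c]] by metis
qed

lemma hyperoctahedral_iff:
  "h \<in> hyperoctahedral n \<longleftrightarrow> h permutes {1..2 * n} \<and> h \<circ> t_perm n = t_perm n \<circ> h"
  by (simp add: hyperoctahedral_def sym_group_carrier)

text \<open>x and y yield the same second matching precisely when \<open>x \<circ> inv' y\<close>
  commutes with the standard one, so the fibres are cosets of the hyperoctahedral group.\<close>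

lemma card_hecke_perm_fiber:
  assumes "y permutes {1..2 * n}"
  shows "card {x. x permutes {1..2 * n} \<and> hecke_perm n x = hecke_perm n y} = card (hyperoctahedral n)"
proof (rule bij_betw_same_card, rule bij_betw_byWitness[where f = "\<lambda>x. x \<circ> inv' y" and f' = "\<lambda>h. h \<circ> y"])
  let ?t = "t_perm n"
  show "\<forall>x\<in>{x. x permutes {1..2 * n} \<and> hecke_perm n x = hecke_perm n y}. x \<circ> inv' y \<circ> y = x"
    by (simp add: fun_eq_iff permutes_inverses[OF assms])
  show "\<forall>h\<in>hyperoctahedral n. h \<circ> y \<circ> inv' y = h"
    by (simp add: fun_eq_iff permutes_inverses[OF assms])
  show "(\<lambda>x. x \<circ> inv' y) ` {x. x permutes {1..2 * n} \<and> hecke_perm n x = hecke_perm n y} \<subseteq> hyperoctahedral n"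
  proof
    fix h assume "h \<in> (\<lambda>x. x \<circ> inv' y) ` {x. x permutes {1..2 * n} \<and> hecke_perm n x = hecke_perm n y}"
    then obtain x where x: "x permutes {1..2 * n}" "hecke_perm n x = hecke_perm n y" "h = x \<circ> inv' y" by blast
    have *: "inv' x (?t (x i)) = inv' y (?t (y i))" for i
      using fun_cong[OF x(2), of i] by (simp add: hecke_perm_def) (metis t_perm_t_perm)
    have "?t (x (inv' y i)) = x (inv' y (?t i))" for i
      using *[of "inv' y i"] permutes_inverses(1)[OF assms] permutes_inverses(1)[OF x(1)] by metis
    then show "h \<in> hyperoctahedral n"
      unfolding hyperoctahedral_iff x(3)
      using permutes_compose[OF permutes_inv[OF assms] x(1)] by (simp add: fun_eq_iff)
  qed
  show "(\<lambda>h. h \<circ> y) ` hyperoctahedral n \<subseteq> {x. x permutes {1..2 * n} \<and> hecke_perm n x = hecke_perm n y}"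
  proof
    fix x assume "x \<in> (\<lambda>h. h \<circ> y) ` hyperoctahedral n"
    then obtain h where h: "h permutes {1..2 * n}" "h \<circ> ?t = ?t \<circ> h" "x = h \<circ> y"
      by (auto simp: hyperoctahedral_iff)
    have "inv' x = inv' y \<circ> inv' h"
      unfolding h(3) by (rule o_inv_distrib[OF permutes_bij[OF h(1)] permutes_bij[OF assms]])
    moreover have "?t (h i) = h (?t i)" for i using fun_cong[OF h(2), of i] by simp
    ultimately have "hecke_perm n x = hecke_perm n y"
      unfolding hecke_perm_def h(3) by (simp add: fun_eq_iff permutes_inverses[OF h(1)])
    then show "x \<in> {x. x permutes {1..2 * n} \<and> hecke_perm n x = hecke_perm n y}"
      using permutes_compose[OF assms h(1)] h(3) by simp
  qed
qed

text \<open>The convolution summand depends on y only through \<open>hecke_perm n y\<close>. Each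
  admissible value is attained on a full coset, so the sum is a multiple of the order of the
  hyperoctahedral group and the division is exact.\<close>

lemma hecke_mult_double_coset_fun:
  "hecke_mult n (double_coset_fun n \<alpha>) (double_coset_fun n \<mu>) w =
    (if w permutes {1..2 * n} then int (card (hecke_factorizations n \<alpha> \<mu> (hecke_perm n w))) else 0)"
proof (cases "w permutes {1..2 * n}")
  case True
  let ?S = "{y. y permutes {1..2 * n}}" and ?H = "hecke_factorizations n \<alpha> \<mu> (hecke_perm n w)"
  have fin: "finite ?S" by (simp add: finite_permutations)
  have iff: "double_coset_fun n \<alpha> (w \<circ> inv' y) * double_coset_fun n \<mu> y = (if hecke_perm n y \<in> ?H then 1 else 0)"
    if "y \<in> ?S" for y
  proof -
    have y: "y permutes {1..2 * n}" using that by simp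
    have wy: "w \<circ> inv' y permutes {1..2 * n}" by (intro permutes_compose permutes_inv True y)
    show ?thesis
      using y wy stable_coset_type_iff[OF y] stable_coset_type_iff[OF wy] hecke_perm_quotient[OF True y]
        reversible_hecke_perm[OF y] hecke_perm_permutes[OF y]
      by (simp add: double_coset_fun_def sym_group_carrier hecke_factorizations_def)
  qed
  have "convolution (sym_group (2 * n)) (double_coset_fun n \<alpha>) (double_coset_fun n \<mu>) w
      = (\<Sum>y\<in>?S. double_coset_fun n \<alpha> (w \<circ> inv' y) * double_coset_fun n \<mu> y)"
    using True by (auto simp: convolution_def sym_group_carrier sym_group_mult intro!: sum.cong)
  also have "\<dots> = (\<Sum>y\<in>?S. if hecke_perm n y \<in> ?H then 1 else 0)"
    by (rule sum.cong[OF refl iff])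
  also have "\<dots> = (\<Sum>y | y \<in> ?S \<and> hecke_perm n y \<in> ?H. 1)"
    by (rule sum.inter_filter[OF fin, symmetric])
  also have "\<dots> = (\<Sum>p\<in>?H. \<Sum>y | y \<in> {y \<in> ?S. hecke_perm n y \<in> ?H} \<and> hecke_perm n y = p. 1)"
    by (rule sum.group[symmetric]) (use fin finite_hecke_factorizations in auto)
  also have "\<dots> = (\<Sum>p\<in>?H. int (card (hyperoctahedral n)))"
  proof (rule sum.cong[OF refl])
    fix p assume p: "p \<in> ?H"
    then obtain y where y: "y permutes {1..2 * n}" "hecke_perm n y = p"
      using ex_hecke_perm[of p n] by (auto simp: hecke_factorizations_def)
    have "{x. x \<in> {y \<in> ?S. hecke_perm n y \<in> ?H} \<and> hecke_perm n x = p}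
        = {x. x permutes {1..2 * n} \<and> hecke_perm n x = hecke_perm n y}" using p y by auto
    then show "(\<Sum>y | y \<in> {y \<in> ?S. hecke_perm n y \<in> ?H} \<and> hecke_perm n y = p. 1) = int (card (hyperoctahedral n))"
      using card_hecke_perm_fiber[OF y(1)] by simp
  qed
  also have "\<dots> = int (card (hyperoctahedral n)) * int (card ?H)" by simp
  finally have c: "convolution (sym_group (2 * n)) (double_coset_fun n \<alpha>) (double_coset_fun n \<mu>) w
      = int (card (hyperoctahedral n)) * int (card ?H)" .
  have "hyperoctahedral n \<subseteq> ?S" by (auto simp: hyperoctahedral_iff)
  then have "finite (hyperoctahedral n)" using fin by (rule finite_subset)
  moreover have "id \<in> hyperoctahedral n" using permutes_id by (auto simp: hyperoctahedral_iff)
  ultimately have "card (hyperoctahedral n) > 0" by (auto simp: card_gt_0_iff)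
  then show ?thesis using True by (simp add: hecke_mult_def c)
qed (simp add: hecke_mult_def convolution_def sym_group_carrier)

lemma card_hecke_factorizations_conjugate:
  assumes "b permutes {1..2 * n}" "\<forall>i. b (partner i) = partner (b i)" "q permutes {1..2 * n}"
  shows "card (hecke_factorizations n \<alpha> \<mu> q) \<le> card (hecke_factorizations n \<alpha> \<mu> (conjugate b q))"
proof (rule conjugate_stable_set[OF assms(1)])
  fix p assume p: "p permutes {1..2 * n}" "p \<in> hecke_factorizations n \<alpha> \<mu> q"
  have b: "bij b" "b 0 = 0" using permutes_bij[OF assms(1)] permutes_not_in[OF assms(1), of 0] by auto
  have "conjugate b q \<circ> inv' (conjugate b p) = conjugate b (q \<circ> inv' p)"
    using b permutes_bij[OF p(1)] by (simp add: conjugate_comp conjugate_inv)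
  moreover have "permutation (q \<circ> inv' p)"
    using assms(3) p(1) by (intro permutes_nat_permutation[of _ "2 * n"] permutes_compose permutes_inv)
  ultimately show "conjugate b p \<in> hecke_factorizations n \<alpha> \<mu> (conjugate b q)"
    using p(2) b(1) conjugate_permutes[OF assms(1) p(1)] permutes_nat_permutation[OF p(1)]
      reversible_conjugate[OF b(1) _ _ b(2), of p] assms(2)
    by (simp add: hecke_factorizations_def stype_conjugate)
next
  show "finite (hecke_factorizations n \<alpha> \<mu> (conjugate b q))" by (rule finite_hecke_factorizations)
qed (auto simp: hecke_factorizations_def)

lemma wt_double [simp]: "wt (\<mu> + \<mu>) = 2 * wt \<mu>"
  by (simp add: wt_def)

lemma stable_coset_type_image:
  "(\<lambda>w. stable (coset_type n w)) ` {w. w permutes {1..2 * n}} = {\<nu> \<in> partitions. wt \<nu> \<le> n}"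
proof (intro equalityI subsetI)
  fix \<nu> assume "\<nu> \<in> (\<lambda>w. stable (coset_type n w)) ` {w. w permutes {1..2 * n}}"
  then obtain w where w: "w permutes {1..2 * n}" "\<nu> = stable (coset_type n w)" by blast
  then have s: "stype (hecke_perm n w) = \<nu> + \<nu>" using stype_hecke_perm by blast
  have hp: "hecke_perm n w permutes {1..2 * n}" by (rule hecke_perm_permutes[OF w(1)])
  have "\<nu> + \<nu> \<in> partitions" using stype_partition[OF permutes_nat_permutation[OF hp]] s by simp
  moreover have "wt (\<nu> + \<nu>) \<le> 2 * n" using wt_stype_le[OF hp] s by simp
  ultimately show "\<nu> \<in> {\<nu> \<in> partitions. wt \<nu> \<le> n}" by (simp add: partitions_def)
next
  fix \<nu> assume "\<nu> \<in> {\<nu> \<in> partitions. wt \<nu> \<le> n}"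
  then obtain z where z: "z permutes {1..n}" "stype z = \<nu>" using ex_stype_le[of \<nu> n] by auto
  obtain w where w: "w permutes {1..2 * n}" "hecke_perm n w = spread z (inv' z)"
    using ex_hecke_perm[OF reversible_spread[OF z(1)] spread_permutes[OF z(1) permutes_inv[OF z(1)]]] by blast
  then have "stable (coset_type n w) = \<nu>"
    using stable_coset_type_iff[OF w(1)] stype_double[OF z(1)] z(2) by simp
  then show "\<nu> \<in> (\<lambda>w. stable (coset_type n w)) ` {w. w permutes {1..2 * n}}" using w(1) by blast
qed

lemma b_num_eq:
  assumes "reversible q" "q permutes {1..2 * n}" "stype q = \<nu> + \<nu>"
  shows "b_num n \<alpha> \<mu> \<nu> = int (card (hecke_factorizations n \<alpha> \<mu> q))"
proof -
  obtain w where w: "w permutes {1..2 * n}" "hecke_perm n w = q" using ex_hecke_perm[OF assms(1,2)] by blast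
  let ?u = "hecke_mult n (double_coset_fun n \<alpha>) (double_coset_fun n \<mu>)"
  have "basis_coeffs n (double_coset_fun n) ?u (stable (coset_type n w)) = ?u w"
  proof (rule basis_coeffs_eq[where S = "{x. x permutes {1..2 * n}}" and ty = "\<lambda>w. stable (coset_type n w)"])
    show "finite ((\<lambda>w. stable (coset_type n w)) ` {x. x permutes {1..2 * n}})"
      by (simp add: finite_permutations)
    have le: "card (hecke_factorizations n \<alpha> \<mu> (hecke_perm n x)) \<le> card (hecke_factorizations n \<alpha> \<mu> (hecke_perm n y))"
      if "x permutes {1..2 * n}" "y permutes {1..2 * n}" "stable (coset_type n x) = stable (coset_type n y)" for x y
    proof -
      have "stype (hecke_perm n x) = stype (hecke_perm n y)"
        using stype_hecke_perm[OF that(1)] stype_hecke_perm[OF that(2)] that(3) by simp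
      then have "\<exists>b. b permutes {1..2 * n} \<and> (\<forall>i. b (partner i) = partner (b i)) \<and>
          hecke_perm n y = conjugate b (hecke_perm n x)"
        by (intro reversible_conj reversible_hecke_perm hecke_perm_permutes that)
      then show ?thesis
        using card_hecke_factorizations_conjugate[OF _ _ hecke_perm_permutes[OF that(1)], of _ \<alpha> \<mu>] by auto
    qed
    show "?u x = ?u y" if "x \<in> {x. x permutes {1..2 * n}}" "y \<in> {x. x permutes {1..2 * n}}"
        "stable (coset_type n x) = stable (coset_type n y)" for x y
      using that le[of x y] le[of y x] by (simp add: hecke_mult_double_coset_fun)
    show "w \<in> {x. x permutes {1..2 * n}}" using w by simp
    show "?u x = 0" if "x \<notin> {x. x permutes {1..2 * n}}" for x
      using that by (simp add: hecke_mult_double_coset_fun)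
    show "double_coset_fun n \<nu> = (\<lambda>x. if x \<in> {x. x permutes {1..2 * n}} \<and>
        stable (coset_type n x) = \<nu> then 1 else 0)" for \<nu>
      by (simp add: double_coset_fun_def sym_group_carrier)
  qed (rule stable_coset_type_image)
  moreover have "stable (coset_type n w) = \<nu>" using stable_coset_type_iff[OF w(1)] w(2) assms(3) by simp
  ultimately show ?thesis using w by (simp add: b_num_def hecke_mult_double_coset_fun)
qed

section \<open>Structure constants of the Hecke rings\<close>

text \<open>Same scheme as for the centers, with supports measured in pairs {2k - 1, 2k}, so that
  the permutations counted for n are those of {1..2n}.\<close>

lemma f_poly_interpolates:
  assumes "\<nu> \<in> partitions"
  shows "f_poly \<alpha> \<mu> \<nu> \<in> int_valued"
    and "n \<ge> wt \<nu> \<Longrightarrow> poly (f_poly \<alpha> \<mu> \<nu>) (of_nat n) = of_int (b_num n \<alpha> \<mu> \<nu>)"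
proof -
  define s where "s = wt \<nu>"
  obtain z where z: "z permutes {1..s}" "stype z = \<nu>" using ex_stype[OF assms] s_def by blast
  define q where "q = spread z (inv' z)"
  have q: "q permutes {1..2 * s}" "reversible q" "stype q = \<nu> + \<nu>"
    using spread_permutes[OF z(1) permutes_inv[OF z(1)]] reversible_spread[OF z(1)]
      stype_double[OF z(1)] z(2) by (simp_all add: q_def)
  have pq: "permutation q" using q(1) by (rule permutes_nat_permutation)
  define Y where "Y = {p. permutation p \<and> p 0 = 0 \<and> reversible p \<and>
    stype (q \<circ> inv' p) = \<alpha> + \<alpha> \<and> stype p = \<mu> + \<mu>}"
  \<comment> \<open>(i + 1) div 2 is the index k of the pair containing i; 0 goes to 0.\<close>
  define D where "D = (\<lambda>p. (\<lambda>i. (i + 1) div 2) ` {i::nat. p i \<noteq> i})"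
  have D_sub: "D p \<subseteq> {1..n} \<longleftrightarrow> {i. p i \<noteq> i} \<subseteq> {1..2 * n}" for p n
  proof -
    have "(i + 1) div 2 \<in> {1..n} \<longleftrightarrow> i \<in> {1..2 * n}" for i :: nat by auto
    then show ?thesis unfolding D_def by blast
  qed
  have Yn: "{p \<in> Y. D p \<subseteq> {1..n}} = hecke_factorizations n \<alpha> \<mu> q" for n
    unfolding D_sub unfolding Y_def hecke_factorizations_def permutes_nat_iff by blast
  have "\<exists>P\<in>int_valued. \<forall>n\<ge>s. poly P (of_nat n) = of_nat (card {p \<in> Y. D p \<subseteq> {1..n}})"
  proof (rule ex_int_valued_count)
    show "finite {p \<in> Y. D p \<subseteq> {1..n}}" for n
      unfolding Yn by (rule finite_hecke_factorizations)
    show "finite (D p) \<and> 0 \<notin> D p \<and> card (D p) \<le> 2 * wt \<mu>" if "p \<in> Y" for p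
    proof -
      have p: "permutation p" "p 0 = 0" "stype p = \<mu> + \<mu>" using that by (auto simp: Y_def)
      have f: "finite {i. p i \<noteq> i}" using p(1) by (simp add: permutation)
      have "card (D p) \<le> card {i. p i \<noteq> i}" unfolding D_def using f by (rule card_image_le)
      also have "\<dots> = 2 * wt \<mu>" using wt_stype[OF p(1)] p(3) by simp
      finally have c: "card (D p) \<le> 2 * wt \<mu>" .
      have "0 \<notin> D p"
      proof
        assume "0 \<in> D p"
        then obtain i where "p i \<noteq> i" "(i + 1) div 2 = 0" by (auto simp: D_def)
        then show False using p(2) by (cases i) auto
      qed
      then show ?thesis using f c by (simp add: D_def)
    qed
    fix c m assume c: "c permutes {1..m::nat}" "\<forall>i\<in>{1..s}. c i = i"
    \<comment> \<open>c acts by permuting the pairs. This commutes with \<open>partner\<close>, and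
      it keeps q because c fixes the indices of all pairs that q can move.\<close>
    define b where "b = spread c c"
    have b: "b permutes {1..2 * m}" unfolding b_def by (rule spread_permutes[OF c(1) c(1)])
    have bb: "bij b" "permutation b" "b 0 = 0" "\<And>i. b (partner i) = partner (b i)"
      using permutes_bij[OF b] permutes_nat_permutation[OF b] permutes_not_in[OF b, of 0]
        partner_spread[OF c(1) c(1)] by (simp_all add: b_def)
    have "b i = i" if "i \<in> {1..2 * s}" for i
      using that
    proof (cases i rule: nat_pair_cases)
      case (2 k)
      then have "k \<in> {1..s}" using that by auto
      then show ?thesis using 2 c(2) by (simp add: b_def spread_simps)
    next
      case (3 k)
      then have "k \<in> {1..s}" using that by auto
      then show ?thesis using 3 c(2) by (simp add: b_def spread_simps)
    qed simp
    then have cq: "conjugate b q = q" by (rule conjugate_fixed[OF bb(1) q(1)])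
    have bY: "conjugate b p \<in> Y" if "p \<in> Y" for p
    proof -
      have p: "permutation p" "bij p" "p 0 = 0" "reversible p"
        using that permutation_bij by (auto simp: Y_def)
      have "q \<circ> inv' (conjugate b p) = conjugate b (q \<circ> inv' p)"
        using p(2) bb(1) cq by (simp add: conjugate_comp conjugate_inv)
      moreover have "conjugate b p 0 = 0" using conjugate_apply[OF bb(1), of p 0] p(3) bb(3) by simp
      moreover have "permutation (q \<circ> inv' p)"
        using pq p(1) by (intro permutation_compose permutation_inverse)
      ultimately show ?thesis
        using that p bb reversible_conjugate[OF bb(1,4) p(4) bb(3)]
        by (simp add: Y_def stype_conjugate conjugate_permutation)
    qed
    have "(b i + 1) div 2 = c ((i + 1) div 2)" for i
    proof (cases i rule: nat_pair_cases)
      case 1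
      then show ?thesis using bb(3) permutes_not_in[OF c(1), of 0] by simp
    next
      case (2 k)
      then show ?thesis using permutes_nat_pos[OF c(1), of k] by (simp add: b_def spread_simps)
    next
      case (3 k)
      then show ?thesis by (simp add: b_def spread_simps)
    qed
    then have "D (conjugate b p) = c ` D p" for p
      unfolding D_def moved_conjugate[OF bb(1)] image_image by simp
    then show "\<exists>f. inj_on f Y \<and> f ` Y \<subseteq> Y \<and> (\<forall>p\<in>Y. D (f p) = c ` D p)"
      using inj_conjugate[OF bb(1)] bY by (intro exI[of _ "conjugate b"]) (auto intro: inj_on_subset)
  qed
  then obtain P where P: "P \<in> int_valued"
      "\<And>n. n \<ge> s \<Longrightarrow> poly P (of_nat n) = of_nat (card (hecke_factorizations n \<alpha> \<mu> q))"
    unfolding Yn by blast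
  have pb: "poly P (of_nat n) = of_int (b_num n \<alpha> \<mu> \<nu>)" if "n \<ge> s" for n
  proof -
    have "q permutes {1..2 * n}" using q(1) by (rule permutes_subset) (use that in auto)
    then show ?thesis using P(2)[OF that] b_num_eq[OF q(2) _ q(3)] by simp
  qed
  have "f_poly \<alpha> \<mu> \<nu> = P"
    unfolding f_poly_def using pb P(1) s_def by (intro interpolant_eq) auto
  then show "f_poly \<alpha> \<mu> \<nu> \<in> int_valued"
    and "n \<ge> wt \<nu> \<Longrightarrow> poly (f_poly \<alpha> \<mu> \<nu>) (of_nat n) = of_int (b_num n \<alpha> \<mu> \<nu>)"
    using P(1) pb s_def by auto
qed

text \<open>The second component \<open>inv' z \<circ> y\<close> is the inverse of a conjugate of
  \<open>z \<circ> inv' y\<close>, so both components contribute the same type.\<close>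

lemma hecke_quotient_spread:
  assumes "z permutes {1..n}" "y permutes {1..n}"
  shows "stype (spread z (inv' z) \<circ> inv' (spread y (inv' y))) = stype (z \<circ> inv' y) + stype (z \<circ> inv' y)"
proof -
  note iz = permutes_inv[OF assms(1)] and iy = permutes_inv[OF assms(2)]
  have zy: "z \<circ> inv' y permutes {1..n}" "inv' z \<circ> y permutes {1..n}" "inv' y \<circ> z permutes {1..n}"
    by (intro permutes_compose iz iy assms)+
  have "inv' (spread y (inv' y)) = spread (inv' y) y"
    unfolding inv_spread[OF assms(2) iy] by (simp add: permutes_inv_inv[OF assms(2)])
  then have "spread z (inv' z) \<circ> inv' (spread y (inv' y)) = spread (z \<circ> inv' y) (inv' z \<circ> y)"
    by (simp add: spread_comp[OF iy assms(2)])
  then have "stype (spread z (inv' z) \<circ> inv' (spread y (inv' y))) = stype (z \<circ> inv' y) + stype (inv' z \<circ> y)"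
    by (simp add: stype_spread[OF zy(1,2)])
  also have "inv' z \<circ> y = inv' (inv' y \<circ> z)"
    using permutes_bij[OF iy] permutes_bij[OF assms(1)]
    by (simp add: o_inv_distrib permutes_inv_inv[OF assms(2)])
  also have "stype (inv' (inv' y \<circ> z)) = stype (inv' y \<circ> z)"
    by (rule stype_inv[OF permutes_nat_permutation[OF zy(3)]])
  also have "\<dots> = stype (conjugate y (inv' y \<circ> z))"
    by (rule stype_conjugate[OF permutes_nat_permutation[OF zy(3)] permutes_bij[OF assms(2)], symmetric])
  also have "conjugate y (inv' y \<circ> z) = z \<circ> inv' y"
    by (simp add: conjugate_def fun_eq_iff permutes_inverses[OF assms(2)])
  finally show ?thesis .
qed

text \<open>A factor \<open>p\<close> of \<open>spread z z\<^sup>-\<^sup>1\<close> for which the lengths add up preserves the set of odd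
  numbers, so the matching it encodes joins odd numbers to even numbers and amounts to a
  permutation of \<open>{1..n}\<close>.\<close>

lemma card_hecke_factorizations_geodesic:
  assumes z: "z permutes {1..n}" and deg: "sum_mset (stype z) = sum_mset \<alpha> + sum_mset \<mu>"
  shows "card (hecke_factorizations n \<alpha> \<mu> (spread z (inv' z))) = card (factorizations n \<alpha> \<mu> z)"
proof -
  let ?V = "{1..2 * n}"
  let ?d = "\<lambda>y. spread y (inv' y)"
  have "bij_betw ?d (factorizations n \<alpha> \<mu> z) (hecke_factorizations n \<alpha> \<mu> (?d z))"
    unfolding bij_betw_def
  proof (intro conjI equalityI subsetI)
    show "inj_on ?d (factorizations n \<alpha> \<mu> z)"
    proof (rule inj_onI)
      fix x y assume xy: "x \<in> factorizations n \<alpha> \<mu> z" "y \<in> factorizations n \<alpha> \<mu> z" "?d x = ?d y"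
      show "x = y"
      proof
        fix k
        \<comment> \<open>Positivity is what makes the truncated \<open>2 * x k - 1\<close>
          determine \<open>x k\<close>.\<close>
        have pos: "x i > 0 \<longleftrightarrow> i > 0" "y i > 0 \<longleftrightarrow> i > 0" for i
          using xy(1,2) permutes_nat_pos by (auto simp: factorizations_def)
        show "x k = y k"
        proof (cases "k = 0")
          case True
          then show ?thesis using pos[of 0] by simp
        next
          case False
          then have "2 * x k - 1 = 2 * y k - 1" using fun_cong[OF xy(3), of "2 * k - 1"] spread_simps(2) by simp
          then show ?thesis using pos[of k] False by simp
        qed
      qed
    qed
    show "p \<in> hecke_factorizations n \<alpha> \<mu> (?d z)" if pd: "p \<in> ?d ` factorizations n \<alpha> \<mu> z" for p
    proof -
      obtain y where y: "y permutes {1..n}" "stype (z \<circ> inv' y) = \<alpha>" "stype y = \<mu>" "p = ?d y"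
        using pd by (auto simp: factorizations_def)
      show ?thesis
        using spread_permutes[OF y(1) permutes_inv[OF y(1)]] reversible_spread[OF y(1)]
          hecke_quotient_spread[OF z y(1)] stype_double[OF y(1)] y(2,3)
        by (simp add: hecke_factorizations_def y(4))
    qed
    fix p assume "p \<in> hecke_factorizations n \<alpha> \<mu> (?d z)"
    then have p: "p permutes ?V" "reversible p" "stype (?d z \<circ> inv' p) = \<alpha> + \<alpha>" "stype p = \<mu> + \<mu>"
      by (auto simp: hecke_factorizations_def)
    have dz: "?d z permutes ?V" by (rule spread_permutes[OF z permutes_inv[OF z]])
    define odds where "odds = {i \<in> ?V. odd i}"
    have fac: "(?d z \<circ> inv' p) \<circ> p = ?d z" by (simp add: fun_eq_iff permutes_inverses[OF p(1)])
    have zO: "?d z i \<in> odds \<longleftrightarrow> i \<in> odds" for i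
    proof -
      have "odd (?d z i) \<longleftrightarrow> odd i"
      proof (cases i rule: nat_pair_cases)
        case (2 k)
        then show ?thesis using permutes_nat_pos[OF z, of k] by (simp add: spread_simps)
      qed (simp_all add: spread_simps)
      then show ?thesis using permutes_in_image[OF dz, of i] by (simp only: odds_def mem_Collect_eq)
    qed
    \<comment> \<open>Doubling all types doubles the lengths, so \<open>deg\<close> is exactly the
      additivity of lengths for this factorization.\<close>
    have pO: "p i \<in> odds \<longleftrightarrow> i \<in> odds" for i
    proof (rule invariant_of_geodesic[where V = ?V and x = "?d z \<circ> inv' p"])
      show "?d z \<circ> inv' p permutes ?V" by (intro permutes_compose permutes_inv dz p)
      show "sum_mset (stype (?d z \<circ> inv' p \<circ> p)) = sum_mset (stype (?d z \<circ> inv' p)) + sum_mset (stype p)"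
        unfolding fac p(3,4) stype_double[OF z] using deg by simp
      show "odds \<subseteq> ?V" by (auto simp: odds_def)
      show "(?d z \<circ> inv' p \<circ> p) a \<in> odds \<longleftrightarrow> a \<in> odds" for a unfolding fac by (rule zO)
      show "p permutes ?V" by (rule p(1))
    qed simp
    define y where "y k = (if k \<in> {1..n} then (p (2 * k - 1) + 1) div 2 else k)" for k
    have py: "p (2 * k - 1) = 2 * y k - 1" and yin: "y k \<in> {1..n}" if k: "k \<in> {1..n}" for k
    proof -
      have "2 * k - 1 \<in> odds" using k by (auto simp: odds_def)
      then have "p (2 * k - 1) \<in> odds" by (simp only: pO)
      then have o: "p (2 * k - 1) \<in> ?V" "odd (p (2 * k - 1))" unfolding odds_def by blast+
      obtain j where j: "p (2 * k - 1) = 2 * j + 1" using o(2) by (rule oddE)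
      have "y k = j + 1" using k j by (simp add: y_def)
      then show "p (2 * k - 1) = 2 * y k - 1" "y k \<in> {1..n}" using j o(1) by simp_all
    qed
    have y: "y permutes {1..n}"
    proof (rule bij_imp_permutes)
      have "inj_on y {1..n}"
      proof (rule inj_onI)
        fix k l assume kl: "k \<in> {1..n}" "l \<in> {1..n}" "y k = y l"
        then have "p (2 * k - 1) = p (2 * l - 1)" using py by metis
        then have "2 * k - 1 = 2 * l - 1" using permutes_inj[OF p(1)] by (simp only: inj_eq)
        then show "k = l" using kl(1,2) by auto
      qed
      moreover have "y ` {1..n} \<subseteq> {1..n}" using yin by blast
      ultimately show "bij_betw y {1..n} {1..n}" by (simp add: bij_betw_def endo_inj_surj)
    qed (auto simp: y_def)
    have "p i = ?d y i" for i
    proof (cases "i \<in> ?V")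
      case True
      then show ?thesis
      proof (cases i rule: nat_pair_cases)
        case (2 k)
        then have "k \<in> {1..n}" using True by auto
        then show ?thesis using 2 py[of k] by (simp add: spread_simps)
      next
        case (3 k)
        then have k: "k \<in> {1..n}" using True by auto
        define j where "j = inv' y k"
        have j: "j \<in> {1..n}" "y j = k"
          using permutes_in_image[OF permutes_inv[OF y], of k] k permutes_inverses(1)[OF y]
          by (auto simp: j_def)
        \<comment> \<open>Reversibility forces the values on even numbers from those on odd numbers,
          and makes them the inverse of y.\<close>
        have "p (partner (p (2 * j - 1))) = partner (2 * j - 1)" by (rule reversible_swap[OF p(2)])
        then have "p i = 2 * j" using py[OF j(1)] j 3 by simp
        then show ?thesis using 3 by (simp add: spread_simps j_def)
      qed simp
    next
      case False
      then show ?thesis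
        using permutes_not_in[OF p(1) False]
          permutes_not_in[OF spread_permutes[OF y permutes_inv[OF y]] False] by simp
    qed
    then have pd: "p = ?d y" by blast
    have "stype y = \<mu>" "stype (z \<circ> inv' y) = \<alpha>"
      using p(3,4) hecke_quotient_spread[OF z y] stype_double[OF y] by (simp_all add: pd)
    then show "p \<in> ?d ` factorizations n \<alpha> \<mu> z" using y pd by (auto simp: factorizations_def)
  qed
  then show ?thesis by (simp add: bij_betw_same_card)
qed

text \<open>Evaluating the Hecke constant at \<open>spread z (inv' z)\<close>, with z of type \<nu>,
  makes the two counts agree for every n \<ge> \<open>wt \<nu>\<close>, and these values determine
  the polynomials.\<close>

lemma f_poly_eq_a_poly:
  assumes "\<nu> \<in> partitions" "sum_mset \<nu> = sum_mset \<alpha> + sum_mset \<mu>"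
  shows "f_poly \<alpha> \<mu> \<nu> = a_poly \<alpha> \<mu> \<nu>"
proof (rule poly_eq_of_nat_eq)
  fix n assume n: "n \<ge> wt \<nu>"
  obtain z where z: "z permutes {1..n}" "stype z = \<nu>" using ex_stype_le[OF assms(1) n] by blast
  have "b_num n \<alpha> \<mu> \<nu> = a_num n \<alpha> \<mu> \<nu>"
    using b_num_eq[OF reversible_spread[OF z(1)] spread_permutes[OF z(1) permutes_inv[OF z(1)]]]
      stype_double[OF z(1)] a_num_stype[OF z(1)] card_hecke_factorizations_geodesic[OF z(1)] z(2) assms(2)
    by simp
  then show "poly (f_poly \<alpha> \<mu> \<nu>) (of_nat n) = poly (a_poly \<alpha> \<mu> \<nu>) (of_nat n)"
    using f_poly_interpolates(2)[OF assms(1) n] a_poly_interpolates(2)[OF assms(1) n] by simp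
qed

section \<open>Associated graded rings\<close>

abbreviation cf :: "univ \<Rightarrow> nat multiset \<Rightarrow> rat poly" where
  "cf \<equiv> Poly_Mapping.lookup"

lemma cf_scale [simp]: "cf (scale p f) \<kappa> = p * cf f \<kappa>"
  by (simp add: scale_def Poly_Mapping.map.rep_eq when_def)

lemma cf_symb [simp]: "cf (symb \<mu>) \<nu> = (if \<mu> = \<nu> then 1 else 0)"
  by (simp add: symb_def lookup_single when_def)

lemma C_to_K_eq [simp]: "C_to_K f = f"
proof (rule poly_mapping_eqI)
  fix \<kappa>
  have "cf (C_to_K f) \<kappa> = (\<Sum>\<mu>\<in>Poly_Mapping.keys f. cf f \<mu> * (if \<mu> = \<kappa> then 1 else 0))"
    by (simp add: C_to_K_def lookup_sum)
  also have "\<dots> = (\<Sum>\<mu>\<in>Poly_Mapping.keys f. if \<kappa> = \<mu> then cf f \<mu> else 0)"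
    by (intro sum.cong) auto
  also have "\<dots> = cf f \<kappa>" by (simp add: in_keys_iff)
  finally show "cf (C_to_K f) \<kappa> = cf f \<kappa>" .
qed

lemma univ_carrier_iff:
  "f \<in> univ_carrier \<longleftrightarrow> (\<forall>\<mu>. cf f \<mu> \<in> int_valued \<and> (\<mu> \<notin> partitions \<longrightarrow> cf f \<mu> = 0))"
  by (auto simp: univ_carrier_def in_keys_iff subset_iff)

lemma univ_filt_iff:
  "f \<in> univ_filt k \<longleftrightarrow> f \<in> univ_carrier \<and> (\<forall>\<mu>. sum_mset \<mu> > k \<longrightarrow> cf f \<mu> = 0)"
  by (auto simp: univ_filt_def in_keys_iff not_le[symmetric])

lemma univ_carrier_add: "f \<in> univ_carrier \<Longrightarrow> g \<in> univ_carrier \<Longrightarrow> f + g \<in> univ_carrier"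
  by (simp add: univ_carrier_iff lookup_add int_valued_add)

lemma univ_carrier_uminus: "f \<in> univ_carrier \<Longrightarrow> - f \<in> univ_carrier"
  by (simp add: univ_carrier_iff int_valued_uminus)

lemma univ_carrier_diff: "f \<in> univ_carrier \<Longrightarrow> g \<in> univ_carrier \<Longrightarrow> f - g \<in> univ_carrier"
  using univ_carrier_add[OF _ univ_carrier_uminus, of f g] by simp

lemma univ_carrier_0 [simp]: "0 \<in> univ_carrier"
  by (simp add: univ_carrier_iff)

lemma symb_carrier [simp]: "\<mu> \<in> partitions \<Longrightarrow> symb \<mu> \<in> univ_carrier"
  by (auto simp: univ_carrier_iff)

lemma univ_carrier_sum: "(\<And>i. i \<in> I \<Longrightarrow> f i \<in> univ_carrier) \<Longrightarrow> sum f I \<in> univ_carrier"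
  by (induction I rule: infinite_finite_induct) (auto intro: univ_carrier_add)

text \<open>The basis splits the filtration; this component is the canonical representative of a
  class in degree k.\<close>

definition hom_part :: "nat \<Rightarrow> univ \<Rightarrow> univ" where
  "hom_part k f = (\<Sum>\<mu> | \<mu> \<in> Poly_Mapping.keys f \<and> sum_mset \<mu> = k. scale (cf f \<mu>) (symb \<mu>))"

lemma cf_hom_part: "cf (hom_part k f) \<kappa> = (if sum_mset \<kappa> = k then cf f \<kappa> else 0)"
proof -
  have "cf (hom_part k f) \<kappa>
      = (\<Sum>\<mu> | \<mu> \<in> Poly_Mapping.keys f \<and> sum_mset \<mu> = k. if \<mu> = \<kappa> then cf f \<mu> else 0)"
    unfolding hom_part_def lookup_sum by (intro sum.cong) auto
  also have "\<dots> = (if \<kappa> \<in> {\<mu> \<in> Poly_Mapping.keys f. sum_mset \<mu> = k} then cf f \<kappa> else 0)"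
    by (rule sum.delta) simp
  finally show ?thesis by (auto simp: in_keys_iff)
qed

lemma hom_part_filt: "f \<in> univ_carrier \<Longrightarrow> hom_part k f \<in> univ_filt k"
  by (auto simp: univ_filt_iff univ_carrier_iff cf_hom_part)

lemma hom_part_carrier: "f \<in> univ_carrier \<Longrightarrow> hom_part k f \<in> univ_carrier"
  by (auto simp: univ_carrier_iff cf_hom_part)

text \<open>The class in \<open>F\<^sub>k / F\<^sub>k\<^sub>-\<^sub>1\<close> of the part of \<open>f\<close> in degree \<open>k\<close>, for \<open>f\<close> of any degree.\<close>

definition part_class :: "nat \<Rightarrow> univ \<Rightarrow> univ set" where
  "part_class k f = {g \<in> univ_filt k. \<forall>\<kappa>. sum_mset \<kappa> = k \<longrightarrow> cf g \<kappa> = cf f \<kappa>}"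

lemma hom_part_in_part_class: "f \<in> univ_carrier \<Longrightarrow> hom_part k f \<in> part_class k f"
  by (simp add: part_class_def hom_part_filt cf_hom_part)

lemma part_class_eq_iff:
  assumes "f \<in> univ_carrier" "g \<in> univ_carrier"
  shows "part_class k f = part_class k g \<longleftrightarrow> (\<forall>\<kappa>. sum_mset \<kappa> = k \<longrightarrow> cf f \<kappa> = cf g \<kappa>)"
proof
  assume "part_class k f = part_class k g"
  then have "hom_part k f \<in> part_class k g" using hom_part_in_part_class[OF assms(1), of k] by simp
  then show "\<forall>\<kappa>. sum_mset \<kappa> = k \<longrightarrow> cf f \<kappa> = cf g \<kappa>"
    by (auto simp: part_class_def cf_hom_part)
qed (simp add: part_class_def)

lemma part_class_cong:
  "(\<And>\<kappa>. sum_mset \<kappa> = k \<Longrightarrow> cf f \<kappa> = cf g \<kappa>) \<Longrightarrow> part_class k f = part_class k g"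
  by (simp add: part_class_def)

lemma univ_ring_simps [simp]:
  "carrier (univ_ring c) = univ_carrier" "add (univ_ring c) = (+)" "\<zero>\<^bsub>univ_ring c\<^esub> = 0"
  "\<one>\<^bsub>univ_ring c\<^esub> = symb {#}"
  by (simp_all add: univ_ring_def)

text \<open>An element of degree at most k without coefficients in degree k has degree at most k -
  1, and for k = 0 it vanishes, in accordance with F_(-1) = 0. All cosets can then be written with
  \<open>part_class\<close>.\<close>

lemma filt_pred_eq: "filt_pred (univ_ring c) univ_filt k = part_class k 0"
proof (cases k)
  case 0
  have "f = 0" if "f \<in> univ_filt 0" "\<forall>\<kappa>. sum_mset \<kappa> = 0 \<longrightarrow> cf f \<kappa> = 0" for f
  proof (rule poly_mapping_eqI)
    fix \<kappa> show "cf f \<kappa> = cf 0 \<kappa>"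
    proof (cases "sum_mset \<kappa> = 0")
      case True
      then show ?thesis using that(2) by (simp only: lookup_zero)
    next
      case False
      then have "0 < sum_mset \<kappa>" by (simp only: neq0_conv)
      then show ?thesis using that(1) unfolding univ_filt_iff by (simp only: lookup_zero)
    qed
  qed
  moreover have "0 \<in> univ_filt 0" by (simp add: univ_filt_iff)
  ultimately show ?thesis unfolding 0 filt_pred_def part_class_def by (auto simp: lookup_zero)
next
  case (Suc j)
  have "f \<in> univ_filt j \<longleftrightarrow> f \<in> univ_filt (Suc j) \<and> (\<forall>\<kappa>. sum_mset \<kappa> = Suc j \<longrightarrow> cf f \<kappa> = 0)" for f
  proof -
    have *: "j < m \<longleftrightarrow> Suc j < m \<or> m = Suc j" for m by linarith
    show ?thesis unfolding univ_filt_iff * by blast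
  qed
  then have "univ_filt j = {f \<in> univ_filt (Suc j). \<forall>\<kappa>. sum_mset \<kappa> = Suc j \<longrightarrow> cf f \<kappa> = 0}" by blast
  then show ?thesis unfolding Suc filt_pred_def part_class_def by (simp only: nat.case lookup_zero)
qed

lemma part_class_coset:
  assumes "f \<in> univ_filt k"
  shows "part_class k 0 +>\<^bsub>univ_ring c\<^esub> f = part_class k f"
proof (intro equalityI subsetI)
  fix g assume "g \<in> part_class k 0 +>\<^bsub>univ_ring c\<^esub> f"
  then obtain h where h: "h \<in> part_class k 0" "g = h + f" by (auto simp: a_r_coset_def')
  then show "g \<in> part_class k f"
    using assms by (auto simp: part_class_def univ_filt_iff lookup_add univ_carrier_add)
next
  fix g assume g: "g \<in> part_class k f"
  have "g - f \<in> univ_carrier"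
    using g assms by (intro univ_carrier_diff) (auto simp: part_class_def univ_filt_iff)
  then have "g - f \<in> part_class k 0"
    using g assms by (auto simp: part_class_def univ_filt_iff lookup_minus)
  then show "g \<in> part_class k 0 +>\<^bsub>univ_ring c\<^esub> f"
    unfolding a_r_coset_def' by (auto intro!: bexI[of _ "g - f"])
qed

lemma part_class_add:
  assumes "f \<in> univ_carrier" "g \<in> univ_carrier"
  shows "part_class k f <+>\<^bsub>univ_ring c\<^esub> part_class k g = part_class k (f + g)"
proof (intro equalityI subsetI)
  fix h assume "h \<in> part_class k f <+>\<^bsub>univ_ring c\<^esub> part_class k g"
  then obtain a b where "a \<in> part_class k f" "b \<in> part_class k g" "h = a + b"
    by (auto simp: set_add_def')
  then show "h \<in> part_class k (f + g)"
    by (auto simp: part_class_def univ_filt_iff lookup_add univ_carrier_add)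
next
  fix h assume h: "h \<in> part_class k (f + g)"
  let ?a = "hom_part k f"
  have "h - ?a \<in> univ_carrier"
    using h hom_part_carrier[OF assms(1)]
    by (intro univ_carrier_diff) (auto simp: part_class_def univ_filt_iff)
  then have "h - ?a \<in> part_class k g"
    using h by (auto simp: part_class_def univ_filt_iff lookup_minus cf_hom_part lookup_add)
  then have "?a + (h - ?a) \<in> part_class k f <+>\<^bsub>univ_ring c\<^esub> part_class k g"
    using hom_part_in_part_class[OF assms(1), of k] unfolding set_add_def' univ_ring_simps by blast
  then show "h \<in> part_class k f <+>\<^bsub>univ_ring c\<^esub> part_class k g" by simp
qed

lemma gr_piece_simps:
  "carrier (gr_piece (univ_ring c) univ_filt k) = part_class k ` univ_carrier"
  "\<one>\<^bsub>gr_piece (univ_ring c) univ_filt k\<^esub> = part_class k 0"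
  "\<lbrakk>f \<in> univ_carrier; g \<in> univ_carrier\<rbrakk> \<Longrightarrow>
    part_class k f \<otimes>\<^bsub>gr_piece (univ_ring c) univ_filt k\<^esub> part_class k g = part_class k (f + g)"
proof -
  have "carrier (gr_piece (univ_ring c) univ_filt k)
      = (\<lambda>a. part_class k 0 +>\<^bsub>univ_ring c\<^esub> a) ` univ_filt k"
    by (auto simp: gr_piece_def A_FactGroup_def' A_RCOSETS_def' filt_pred_eq a_r_coset_def')
  also have "\<dots> = part_class k ` univ_filt k"
    by (intro image_cong) (simp_all add: part_class_coset)
  also have "\<dots> = part_class k ` univ_carrier"
  proof (intro equalityI subsetI)
    fix A assume "A \<in> part_class k ` univ_carrier"
    then obtain f where f: "f \<in> univ_carrier" "A = part_class k f" by blast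
    have "A = part_class k (hom_part k f)"
      unfolding f(2) by (rule part_class_cong) (simp add: cf_hom_part)
    then show "A \<in> part_class k ` univ_filt k" using hom_part_filt[OF f(1)] by blast
  qed (auto simp: univ_filt_iff)
  finally show "carrier (gr_piece (univ_ring c) univ_filt k) = part_class k ` univ_carrier" .
  show "\<one>\<^bsub>gr_piece (univ_ring c) univ_filt k\<^esub> = part_class k 0"
    by (simp add: gr_piece_def A_FactGroup_def' filt_pred_eq)
  assume "f \<in> univ_carrier" "g \<in> univ_carrier"
  then show "part_class k f \<otimes>\<^bsub>gr_piece (univ_ring c) univ_filt k\<^esub> part_class k g = part_class k (f + g)"
    using part_class_add[where k = k and c = c and f = f and g = g]
    by (simp add: gr_piece_def A_FactGroup_def' set_add_def')
qed

lemma gr_piece_comm_group: "comm_group (gr_piece (univ_ring c) univ_filt k)"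
proof (rule comm_groupI)
  let ?G = "gr_piece (univ_ring c) univ_filt k"
  show "\<one>\<^bsub>?G\<^esub> \<in> carrier ?G" by (simp add: gr_piece_simps)
  fix x y z assume "x \<in> carrier ?G" "y \<in> carrier ?G" "z \<in> carrier ?G"
  then obtain f g h where fgh: "f \<in> univ_carrier" "g \<in> univ_carrier" "h \<in> univ_carrier"
    "x = part_class k f" "y = part_class k g" "z = part_class k h"
    by (auto simp: gr_piece_simps)
  show "x \<otimes>\<^bsub>?G\<^esub> y \<in> carrier ?G"
    and "x \<otimes>\<^bsub>?G\<^esub> y \<otimes>\<^bsub>?G\<^esub> z = x \<otimes>\<^bsub>?G\<^esub> (y \<otimes>\<^bsub>?G\<^esub> z)"
    and "x \<otimes>\<^bsub>?G\<^esub> y = y \<otimes>\<^bsub>?G\<^esub> x"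
    using fgh by (simp_all add: gr_piece_simps univ_carrier_add add_ac)
next
  let ?G = "gr_piece (univ_ring c) univ_filt k"
  fix x assume "x \<in> carrier ?G"
  then obtain f where f: "f \<in> univ_carrier" "x = part_class k f" by (auto simp: gr_piece_simps)
  then show "\<one>\<^bsub>?G\<^esub> \<otimes>\<^bsub>?G\<^esub> x = x" by (simp add: gr_piece_simps)
  have "part_class k (- f) \<otimes>\<^bsub>?G\<^esub> x = \<one>\<^bsub>?G\<^esub>"
    using f by (simp add: gr_piece_simps univ_carrier_uminus)
  moreover have "part_class k (- f) \<in> carrier ?G"
    unfolding gr_piece_simps using univ_carrier_uminus[OF f(1)] by (rule imageI)
  ultimately show "\<exists>y\<in>carrier ?G. y \<otimes>\<^bsub>?G\<^esub> x = \<one>\<^bsub>?G\<^esub>" by blast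
qed

lemma finprod_part_class:
  assumes "finite A" "\<And>i. i \<in> A \<Longrightarrow> f i \<in> univ_carrier"
  shows "finprod (gr_piece (univ_ring c) univ_filt k) (\<lambda>i. part_class k (f i)) A = part_class k (sum f A)"
proof -
  interpret comm_group "gr_piece (univ_ring c) univ_filt k" by (rule gr_piece_comm_group)
  show ?thesis
    using assms
  proof (induction A rule: finite_induct)
    case empty
    then show ?case by (simp add: gr_piece_simps)
  next
    case (insert a A)
    then have "(\<lambda>i. part_class k (f i)) \<in> A \<rightarrow> carrier (gr_piece (univ_ring c) univ_filt k)"
      by (auto simp: gr_piece_simps)
    then show ?case
      using insert by (simp add: finprod_insert) (simp add: gr_piece_simps univ_carrier_sum)
  qed
qed

text \<open>An additive bijection from the universal module onto the graded ring, available because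
  the basis splits the filtration. It need not respect the original product; the product transported
  back is \<open>top_mult\<close>.\<close>

definition gr_of :: "univ \<Rightarrow> nat \<Rightarrow> univ set" where
  "gr_of f = (\<lambda>k. part_class k f)"

lemma inj_gr_of: "inj_on gr_of univ_carrier"
proof (rule inj_onI)
  fix f g assume fg: "f \<in> univ_carrier" "g \<in> univ_carrier" "gr_of f = gr_of g"
  show "f = g"
  proof (rule poly_mapping_eqI)
    fix \<kappa>
    have "part_class (sum_mset \<kappa>) f = part_class (sum_mset \<kappa>) g"
      using fun_cong[OF fg(3), of "sum_mset \<kappa>"] by (simp add: gr_of_def)
    then show "cf f \<kappa> = cf g \<kappa>" using part_class_eq_iff[OF fg(1,2)] by blast
  qed
qed

lemma gr_piece_group: "group (gr_piece (univ_ring c) univ_filt k)"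
  using gr_piece_comm_group comm_group.axioms(2) by blast

lemma carrier_gr_ring: "carrier (gr_ring (univ_ring c) univ_filt) = gr_of ` univ_carrier"
proof -
  have "carrier (gr_ring (univ_ring c) univ_filt)
      = {x. (\<forall>k. x k \<in> part_class k ` univ_carrier) \<and> finite {k. x k \<noteq> part_class k 0}}"
    by (auto simp: gr_ring_def carrier_sum_group gr_piece_group gr_piece_simps PiE_iff)
  also have "\<dots> = gr_of ` univ_carrier"
  proof (intro equalityI subsetI)
    fix x assume x: "x \<in> {x. (\<forall>k. x k \<in> part_class k ` univ_carrier) \<and> finite {k. x k \<noteq> part_class k 0}}"
    then have "\<forall>k. \<exists>f. f \<in> univ_carrier \<and> x k = part_class k f" by blast
    then obtain f where f: "\<And>k. f k \<in> univ_carrier" "\<And>k. x k = part_class k (f k)" by metis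
    define K where "K = {k. x k \<noteq> part_class k 0}"
    \<comment> \<open>Finite support of x is what allows its components to be summed into a single
      element.\<close>
    define g where "g = (\<Sum>k\<in>K. hom_part k (f k))"
    have K: "finite K" using x K_def by simp
    have g: "g \<in> univ_carrier" unfolding g_def by (intro univ_carrier_sum hom_part_carrier f)
    have cg: "cf g \<kappa> = (if sum_mset \<kappa> \<in> K then cf (f (sum_mset \<kappa>)) \<kappa> else 0)" for \<kappa>
      using K by (simp add: g_def lookup_sum cf_hom_part)
    have "x k = part_class k g" for k
    proof (cases "k \<in> K")
      case True
      then show ?thesis unfolding f(2) by (intro part_class_cong) (simp add: cg)
    next
      case False
      then have "x k = part_class k 0" by (simp add: K_def)
      also have "\<dots> = part_class k g" using False by (intro part_class_cong) (simp add: cg)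
      finally show ?thesis .
    qed
    then show "x \<in> gr_of ` univ_carrier" using g by (auto simp: gr_of_def)
  next
    fix x assume "x \<in> gr_of ` univ_carrier"
    then obtain f where f: "f \<in> univ_carrier" "x = gr_of f" by blast
    have "{k. part_class k f \<noteq> part_class k 0} \<subseteq> sum_mset ` Poly_Mapping.keys f"
    proof
      fix k assume "k \<in> {k. part_class k f \<noteq> part_class k 0}"
      then have "\<exists>\<kappa>. sum_mset \<kappa> = k \<and> cf f \<kappa> \<noteq> 0" using part_class_cong[of k f 0] by auto
      then show "k \<in> sum_mset ` Poly_Mapping.keys f" by (auto simp: in_keys_iff)
    qed
    then have "finite {k. part_class k f \<noteq> part_class k 0}" by (rule finite_subset) simp
    then show "x \<in> {x. (\<forall>k. x k \<in> part_class k ` univ_carrier) \<and> finite {k. x k \<noteq> part_class k 0}}"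
      using f by (simp add: gr_of_def)
  qed
  finally show ?thesis .
qed

lemma gr_ring_add:
  assumes "f \<in> univ_carrier" "g \<in> univ_carrier"
  shows "gr_of f \<oplus>\<^bsub>gr_ring (univ_ring c) univ_filt\<^esub> gr_of g = gr_of (f + g)"
  using assms by (simp add: gr_ring_def gr_of_def gr_piece_simps restrict_def)

lemma gr_ring_zero: "\<zero>\<^bsub>gr_ring (univ_ring c) univ_filt\<^esub> = gr_of 0"
  by (simp add: gr_ring_def gr_of_def gr_piece_simps restrict_def)

lemma gr_class_symb:
  assumes "\<mu> \<in> partitions"
  shows "gr_class (univ_ring c) univ_filt (sum_mset \<mu>) (symb \<mu>) = gr_of (symb \<mu>)"
proof
  fix j
  have "symb \<mu> \<in> univ_filt (sum_mset \<mu>)" using assms by (auto simp: univ_filt_iff)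
  then show "gr_class (univ_ring c) univ_filt (sum_mset \<mu>) (symb \<mu>) j = gr_of (symb \<mu>) j"
    by (auto simp: gr_class_def gr_of_def filt_pred_eq part_class_coset intro!: part_class_cong)
qed

lemma empty_partition [simp]: "{#} \<in> partitions"
  by (simp add: partitions_def)

lemma gr_ring_one: "\<one>\<^bsub>gr_ring (univ_ring c) univ_filt\<^esub> = gr_of (symb {#})"
  using gr_class_symb[of "{#}" c] by (simp add: gr_ring_def)

text \<open>All elements of a class have the same image coset, so the union in \<open>gr_map\<close>
  is that one coset.\<close>

lemma gr_map_gr_of:
  assumes "f \<in> univ_carrier"
  shows "gr_map (univ_ring c) univ_filt C_to_K (gr_of f) = gr_of f"
proof
  fix k
  have "filt_pred (univ_ring c) univ_filt k +>\<^bsub>univ_ring c\<^esub> a = part_class k f" if "a \<in> part_class k f" for a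
  proof -
    have "part_class k a = part_class k f"
      using that by (intro part_class_cong) (simp add: part_class_def)
    moreover have "a \<in> univ_filt k" using that by (simp add: part_class_def)
    ultimately show ?thesis by (simp only: filt_pred_eq part_class_coset)
  qed
  then show "gr_map (univ_ring c) univ_filt C_to_K (gr_of f) k = gr_of f k"
    using hom_part_in_part_class[OF assms, of k] unfolding gr_map_def gr_of_def by auto
qed

lemma gr_deg_eq:
  "gr_deg (univ_ring c) univ_filt k = gr_of ` {f \<in> univ_carrier. \<forall>\<kappa>. sum_mset \<kappa> \<noteq> k \<longrightarrow> cf f \<kappa> = 0}"
proof -
  have "(\<forall>j. j \<noteq> k \<longrightarrow> gr_of f j = part_class j 0) \<longleftrightarrow> (\<forall>\<kappa>. sum_mset \<kappa> \<noteq> k \<longrightarrow> cf f \<kappa> = 0)"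
    if "f \<in> univ_carrier" for f
    unfolding gr_of_def using part_class_eq_iff[OF that univ_carrier_0] by auto
  then show ?thesis unfolding gr_deg_def carrier_gr_ring gr_piece_simps by auto
qed

section \<open>The top-degree product on the universal module\<close>

definition top_coeff ::
    "(nat multiset \<Rightarrow> nat multiset \<Rightarrow> nat multiset \<Rightarrow> rat poly) \<Rightarrow>
     nat multiset \<Rightarrow> nat multiset \<Rightarrow> nat multiset \<Rightarrow> rat poly" where
  "top_coeff c \<alpha> \<mu> \<kappa> = (if \<kappa> \<in> partitions \<and> sum_mset \<kappa> = sum_mset \<alpha> + sum_mset \<mu> then c \<alpha> \<mu> \<kappa> else 0)"

definition top_mult ::
    "(nat multiset \<Rightarrow> nat multiset \<Rightarrow> nat multiset \<Rightarrow> rat poly) \<Rightarrow> univ \<Rightarrow> univ \<Rightarrow> univ" where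
  "top_mult c f g = (\<Sum>\<alpha>\<in>Poly_Mapping.keys f. \<Sum>\<mu>\<in>Poly_Mapping.keys g.
     \<Sum>\<kappa> | \<kappa> \<in> partitions \<and> sum_mset \<kappa> \<le> sum_mset \<alpha> + sum_mset \<mu>.
       scale (cf f \<alpha> * cf g \<mu> * top_coeff c \<alpha> \<mu> \<kappa>) (symb \<kappa>))"

abbreviation Pt :: "nat \<Rightarrow> nat multiset set" where
  "Pt k \<equiv> {\<nu> \<in> partitions. sum_mset \<nu> \<le> k}"

lemma top_coeff_outside:
  "sum_mset \<kappa> \<noteq> sum_mset \<alpha> + sum_mset \<mu> \<Longrightarrow> top_coeff c \<alpha> \<mu> \<kappa> = 0"
  by (simp add: top_coeff_def)

lemma cf_top_mult_keys:
  "cf (top_mult c f g) \<kappa> = (\<Sum>\<alpha>\<in>Poly_Mapping.keys f. \<Sum>\<mu>\<in>Poly_Mapping.keys g.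
     cf f \<alpha> * cf g \<mu> * top_coeff c \<alpha> \<mu> \<kappa>)"
proof -
  have ins: "(\<Sum>\<nu> | \<nu> \<in> partitions \<and> sum_mset \<nu> \<le> m. x * top_coeff c \<alpha> \<mu> \<nu> * (if \<nu> = \<kappa> then 1 else 0))
      = x * top_coeff c \<alpha> \<mu> \<kappa>" if "m = sum_mset \<alpha> + sum_mset \<mu>" for x \<alpha> \<mu> m
  proof -
    have "(\<Sum>\<nu> | \<nu> \<in> partitions \<and> sum_mset \<nu> \<le> m. x * top_coeff c \<alpha> \<mu> \<nu> * (if \<nu> = \<kappa> then 1 else 0))
        = (\<Sum>\<nu> | \<nu> \<in> partitions \<and> sum_mset \<nu> \<le> m. if \<nu> = \<kappa> then x * top_coeff c \<alpha> \<mu> \<nu> else 0)"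
      by (intro sum.cong) auto
    also have "\<dots> = x * top_coeff c \<alpha> \<mu> \<kappa>"
      using that by (subst sum.delta[OF finite_partitions]) (auto simp: top_coeff_def)
    finally show ?thesis .
  qed
  show ?thesis unfolding top_mult_def lookup_sum cf_scale cf_symb by (intro sum.cong refl ins)
qed

text \<open>Replaces the index sets that depend on the arguments by one fixed finite set, so that
  sums can be exchanged. Sizes add up in top degree, so an index larger than k cannot reach a
  coefficient of size at most k.\<close>

lemma cf_top_mult:
  assumes "f \<in> univ_carrier" "g \<in> univ_carrier" "sum_mset \<kappa> \<le> k"
  shows "cf (top_mult c f g) \<kappa> = (\<Sum>\<alpha>\<in>Pt k. \<Sum>\<mu>\<in>Pt k. cf f \<alpha> * cf g \<mu> * top_coeff c \<alpha> \<mu> \<kappa>)"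
proof -
  let ?t = "\<lambda>\<alpha> \<mu>. cf f \<alpha> * cf g \<mu> * top_coeff c \<alpha> \<mu> \<kappa>"
  have z: "?t \<alpha> \<mu> = 0" if "sum_mset \<alpha> > k \<or> sum_mset \<mu> > k" for \<alpha> \<mu>
    using that assms(3) by (auto simp: top_coeff_def)
  have "cf (top_mult c f g) \<kappa> = (\<Sum>\<alpha>\<in>Poly_Mapping.keys f. \<Sum>\<mu>\<in>Poly_Mapping.keys g. ?t \<alpha> \<mu>)"
    by (rule cf_top_mult_keys)
  also have "\<dots> = (\<Sum>\<alpha>\<in>Poly_Mapping.keys f. \<Sum>\<mu>\<in>Pt k. ?t \<alpha> \<mu>)"
  proof (rule sum.cong[OF refl], rule sum.mono_neutral_cong)
    show "\<And>\<alpha> i. \<alpha> \<in> Poly_Mapping.keys f \<Longrightarrow> i \<in> Pt k - Poly_Mapping.keys g \<Longrightarrow> ?t \<alpha> i = 0"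
      by (auto simp: in_keys_iff)
    show "?t \<alpha> i = 0" if "i \<in> Poly_Mapping.keys g - Pt k" for \<alpha> i
    proof -
      have "sum_mset i > k" using that assms(2) by (auto simp: univ_carrier_def)
      then show ?thesis by (intro z) simp
    qed
  qed (use finite_partitions in auto)
  also have "\<dots> = (\<Sum>\<alpha>\<in>Pt k. \<Sum>\<mu>\<in>Pt k. ?t \<alpha> \<mu>)"
  proof (rule sum.mono_neutral_cong)
    show "\<And>i. i \<in> Pt k - Poly_Mapping.keys f \<Longrightarrow> (\<Sum>\<mu>\<in>Pt k. ?t i \<mu>) = 0"
      by (auto simp: in_keys_iff)
    show "(\<Sum>\<mu>\<in>Pt k. ?t i \<mu>) = 0" if "i \<in> Poly_Mapping.keys f - Pt k" for i
    proof -
      have "sum_mset i > k" using that assms(1) by (auto simp: univ_carrier_def)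
      then show ?thesis by (intro sum.neutral ballI z) simp
    qed
  qed (use finite_partitions in auto)
  finally show ?thesis .
qed

lemma cf_univ_mult:
  "cf (f \<otimes>\<^bsub>univ_ring c\<^esub> g) \<kappa> = (\<Sum>\<alpha>\<in>Poly_Mapping.keys f. \<Sum>\<mu>\<in>Poly_Mapping.keys g.
     cf f \<alpha> * cf g \<mu> * (if \<kappa> \<in> partitions \<and> sum_mset \<kappa> \<le> sum_mset \<alpha> + sum_mset \<mu> then c \<alpha> \<mu> \<kappa> else 0))"
proof -
  have "cf (symb_mult c \<alpha> \<mu>) \<kappa>
      = (if \<kappa> \<in> partitions \<and> sum_mset \<kappa> \<le> sum_mset \<alpha> + sum_mset \<mu> then c \<alpha> \<mu> \<kappa> else 0)" for \<alpha> \<mu>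
  proof -
    have "cf (symb_mult c \<alpha> \<mu>) \<kappa>
        = (\<Sum>\<nu> \<in> {\<nu> \<in> partitions. sum_mset \<nu> \<le> sum_mset \<alpha> + sum_mset \<mu>}. if \<nu> = \<kappa> then c \<alpha> \<mu> \<nu> else 0)"
      unfolding symb_mult_def lookup_sum by (intro sum.cong) auto
    also have "\<dots> = (if \<kappa> \<in> partitions \<and> sum_mset \<kappa> \<le> sum_mset \<alpha> + sum_mset \<mu> then c \<alpha> \<mu> \<kappa> else 0)"
      by (subst sum.delta[OF finite_partitions]) simp
    finally show ?thesis .
  qed
  then show ?thesis by (simp add: univ_ring_def lookup_sum)
qed

text \<open>What the graded ring asks of the constants, with associativity and unit laws in top
  degree only. Both \<open>a_poly\<close> and \<open>f_poly\<close> satisfy it, and no ring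
  structure on the universal module itself is presupposed.\<close>

locale structure_constants =
  fixes c :: "nat multiset \<Rightarrow> nat multiset \<Rightarrow> nat multiset \<Rightarrow> rat poly"
  assumes int_valued: "\<nu> \<in> partitions \<Longrightarrow> c \<alpha> \<mu> \<nu> \<in> int_valued"
    and assoc: "\<lbrakk>\<alpha> \<in> partitions; \<mu> \<in> partitions; \<kappa> \<in> partitions; \<tau> \<in> partitions;
        sum_mset \<tau> = sum_mset \<alpha> + sum_mset \<mu> + sum_mset \<kappa>\<rbrakk> \<Longrightarrow>
      (\<Sum>\<nu> | \<nu> \<in> partitions \<and> sum_mset \<nu> = sum_mset \<alpha> + sum_mset \<mu>. c \<alpha> \<mu> \<nu> * c \<nu> \<kappa> \<tau>)
      = (\<Sum>\<nu> | \<nu> \<in> partitions \<and> sum_mset \<nu> = sum_mset \<mu> + sum_mset \<kappa>. c \<mu> \<kappa> \<nu> * c \<alpha> \<nu> \<tau>)"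
    and unit: "\<lbrakk>\<mu> \<in> partitions; \<nu> \<in> partitions; sum_mset \<nu> = sum_mset \<mu>\<rbrakk> \<Longrightarrow>
      c {#} \<mu> \<nu> = (if \<nu> = \<mu> then 1 else 0) \<and> c \<mu> {#} \<nu> = (if \<nu> = \<mu> then 1 else 0)"
begin

lemma top_coeff_int_valued: "top_coeff c \<alpha> \<mu> \<kappa> \<in> int_valued"
  by (simp add: top_coeff_def int_valued)

lemma top_mult_carrier:
  assumes "f \<in> univ_carrier" "g \<in> univ_carrier"
  shows "top_mult c f g \<in> univ_carrier"
  unfolding top_mult_def
proof (intro univ_carrier_sum)
  fix \<alpha> \<mu> \<kappa> assume "\<kappa> \<in> {\<kappa> \<in> partitions. sum_mset \<kappa> \<le> sum_mset \<alpha> + sum_mset \<mu>}"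
  then show "scale (cf f \<alpha> * cf g \<mu> * top_coeff c \<alpha> \<mu> \<kappa>) (symb \<kappa>) \<in> univ_carrier"
    using assms top_coeff_int_valued by (auto simp: univ_carrier_iff intro!: int_valued_mult)
qed

text \<open>If \<tau> is a partition of the right size, both sums reduce to the locale axiom;
  otherwise every summand vanishes.\<close>

lemma top_coeff_assoc:
  assumes "\<alpha> \<in> partitions" "\<mu> \<in> partitions" "\<kappa> \<in> partitions" "sum_mset \<tau> \<le> k"
  shows "(\<Sum>\<nu>\<in>Pt k. top_coeff c \<alpha> \<mu> \<nu> * top_coeff c \<nu> \<kappa> \<tau>)
    = (\<Sum>\<nu>\<in>Pt k. top_coeff c \<mu> \<kappa> \<nu> * top_coeff c \<alpha> \<nu> \<tau>)"
proof (cases "\<tau> \<in> partitions \<and> sum_mset \<tau> = sum_mset \<alpha> + sum_mset \<mu> + sum_mset \<kappa>")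
  case True
  have "(\<Sum>\<nu>\<in>Pt k. top_coeff c \<alpha> \<mu> \<nu> * top_coeff c \<nu> \<kappa> \<tau>)
      = (\<Sum>\<nu> | \<nu> \<in> partitions \<and> sum_mset \<nu> = sum_mset \<alpha> + sum_mset \<mu>. c \<alpha> \<mu> \<nu> * c \<nu> \<kappa> \<tau>)"
    using True assms(4) by (intro sum.mono_neutral_cong_right finite_partitions) (auto simp: top_coeff_def)
  also have "\<dots> = (\<Sum>\<nu> | \<nu> \<in> partitions \<and> sum_mset \<nu> = sum_mset \<mu> + sum_mset \<kappa>. c \<mu> \<kappa> \<nu> * c \<alpha> \<nu> \<tau>)"
    using True by (intro assoc assms) auto
  also have "\<dots> = (\<Sum>\<nu>\<in>Pt k. top_coeff c \<mu> \<kappa> \<nu> * top_coeff c \<alpha> \<nu> \<tau>)"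
    using True assms(4) by (intro sum.mono_neutral_cong_left finite_partitions) (auto simp: top_coeff_def)
  finally show ?thesis .
next
  case False
  have "top_coeff c \<alpha> \<mu> \<nu> * top_coeff c \<nu> \<kappa> \<tau> = 0" "top_coeff c \<mu> \<kappa> \<nu> * top_coeff c \<alpha> \<nu> \<tau> = 0" for \<nu>
    using False by (auto simp: top_coeff_def)
  then show ?thesis by (simp only: sum.neutral_const)
qed

text \<open>All indices can be bounded by |\<tau>|, so the four finite sums commute and the identity
  for the constants applies to the innermost one.\<close>

lemma top_mult_assoc:
  assumes "f \<in> univ_carrier" "g \<in> univ_carrier" "h \<in> univ_carrier"
  shows "top_mult c (top_mult c f g) h = top_mult c f (top_mult c g h)"
proof (rule poly_mapping_eqI)
  fix \<tau> :: "nat multiset"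
  let ?P = "Pt (sum_mset \<tau>)" and ?d = "top_coeff c"
  let ?L = "\<lambda>\<alpha> \<mu> \<kappa> \<nu>. cf f \<alpha> * cf g \<mu> * cf h \<kappa> * (?d \<alpha> \<mu> \<nu> * ?d \<nu> \<kappa> \<tau>)"
  let ?R = "\<lambda>\<alpha> \<mu> \<kappa> \<nu>. cf f \<alpha> * cf g \<mu> * cf h \<kappa> * (?d \<mu> \<kappa> \<nu> * ?d \<alpha> \<nu> \<tau>)"
  have "cf (top_mult c (top_mult c f g) h) \<tau> = (\<Sum>\<nu>\<in>?P. \<Sum>\<kappa>\<in>?P. \<Sum>\<alpha>\<in>?P. \<Sum>\<mu>\<in>?P. ?L \<alpha> \<mu> \<kappa> \<nu>)"
    using assms by (simp add: cf_top_mult[where k = "sum_mset \<tau>"] top_mult_carrier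
        sum_distrib_left sum_distrib_right mult_ac)
  also have "\<dots> = (\<Sum>\<kappa>\<in>?P. \<Sum>\<nu>\<in>?P. \<Sum>\<alpha>\<in>?P. \<Sum>\<mu>\<in>?P. ?L \<alpha> \<mu> \<kappa> \<nu>)" by (rule sum.swap)
  also have "\<dots> = (\<Sum>\<kappa>\<in>?P. \<Sum>\<alpha>\<in>?P. \<Sum>\<nu>\<in>?P. \<Sum>\<mu>\<in>?P. ?L \<alpha> \<mu> \<kappa> \<nu>)"
    by (intro sum.cong[OF refl] sum.swap)
  also have "\<dots> = (\<Sum>\<kappa>\<in>?P. \<Sum>\<alpha>\<in>?P. \<Sum>\<mu>\<in>?P. \<Sum>\<nu>\<in>?P. ?L \<alpha> \<mu> \<kappa> \<nu>)"
    by (intro sum.cong[OF refl] sum.swap)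
  also have "\<dots> = (\<Sum>\<kappa>\<in>?P. \<Sum>\<alpha>\<in>?P. \<Sum>\<mu>\<in>?P. \<Sum>\<nu>\<in>?P. ?R \<alpha> \<mu> \<kappa> \<nu>)"
    unfolding sum_distrib_left[symmetric]
    by (intro sum.cong[OF refl] arg_cong2[where f = "(*)"] top_coeff_assoc) auto
  also have "\<dots> = (\<Sum>\<alpha>\<in>?P. \<Sum>\<kappa>\<in>?P. \<Sum>\<mu>\<in>?P. \<Sum>\<nu>\<in>?P. ?R \<alpha> \<mu> \<kappa> \<nu>)" by (rule sum.swap)
  also have "\<dots> = (\<Sum>\<alpha>\<in>?P. \<Sum>\<kappa>\<in>?P. \<Sum>\<nu>\<in>?P. \<Sum>\<mu>\<in>?P. ?R \<alpha> \<mu> \<kappa> \<nu>)"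
    by (intro sum.cong[OF refl] sum.swap)
  also have "\<dots> = (\<Sum>\<alpha>\<in>?P. \<Sum>\<nu>\<in>?P. \<Sum>\<kappa>\<in>?P. \<Sum>\<mu>\<in>?P. ?R \<alpha> \<mu> \<kappa> \<nu>)"
    by (intro sum.cong[OF refl] sum.swap)
  also have "\<dots> = (\<Sum>\<alpha>\<in>?P. \<Sum>\<nu>\<in>?P. \<Sum>\<mu>\<in>?P. \<Sum>\<kappa>\<in>?P. ?R \<alpha> \<mu> \<kappa> \<nu>)"
    by (intro sum.cong[OF refl] sum.swap)
  also have "\<dots> = cf (top_mult c f (top_mult c g h)) \<tau>"
    using assms by (simp add: cf_top_mult[where k = "sum_mset \<tau>"] top_mult_carrier
        sum_distrib_left sum_distrib_right mult_ac)
  finally show "cf (top_mult c (top_mult c f g) h) \<tau> = cf (top_mult c f (top_mult c g h)) \<tau>" .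
qed

lemma top_mult_distrib:
  assumes "f \<in> univ_carrier" "g \<in> univ_carrier" "h \<in> univ_carrier"
  shows "top_mult c (f + g) h = top_mult c f h + top_mult c g h"
    and "top_mult c h (f + g) = top_mult c h f + top_mult c h g"
  using assms
  by (auto intro!: poly_mapping_eqI
      simp: cf_top_mult[OF _ _ order_refl] univ_carrier_add lookup_add algebra_simps sum.distrib)

lemma top_mult_unit:
  assumes "f \<in> univ_carrier"
  shows "top_mult c (symb {#}) f = f" and "top_mult c f (symb {#}) = f"
proof -
  have d: "top_coeff c {#} \<mu> \<kappa> = (if \<mu> = \<kappa> then 1 else 0)" "top_coeff c \<mu> {#} \<kappa> = (if \<mu> = \<kappa> then 1 else 0)"
    if "\<mu> \<in> partitions" for \<mu> \<kappa>
    using that unit[of \<mu> \<kappa>] by (auto simp: top_coeff_def)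
  have e: "{#} \<in> Pt k" for k by simp
  have "cf (top_mult c (symb {#}) f) \<kappa> = cf f \<kappa> \<and> cf (top_mult c f (symb {#})) \<kappa> = cf f \<kappa>" for \<kappa>
  proof -
    let ?k = "sum_mset \<kappa>"
    have f0: "\<kappa> \<notin> Pt ?k \<Longrightarrow> cf f \<kappa> = 0" using assms by (simp add: univ_carrier_iff)
    have "cf (top_mult c (symb {#}) f) \<kappa>
        = (\<Sum>\<alpha>\<in>Pt ?k. if \<alpha> = {#} then (\<Sum>\<mu>\<in>Pt ?k. cf f \<mu> * top_coeff c {#} \<mu> \<kappa>) else 0)"
      using assms by (simp add: cf_top_mult[OF _ _ order_refl]) (intro sum.cong, auto)
    also have "\<dots> = (\<Sum>\<mu>\<in>Pt ?k. cf f \<mu> * top_coeff c {#} \<mu> \<kappa>)"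
      by (subst sum.delta[OF finite_partitions]) simp
    also have "\<dots> = (\<Sum>\<mu>\<in>Pt ?k. if \<mu> = \<kappa> then cf f \<mu> else 0)"
      by (intro sum.cong) (auto simp: d)
    also have "\<dots> = cf f \<kappa>" using f0 by (subst sum.delta[OF finite_partitions]) auto
    finally have 1: "cf (top_mult c (symb {#}) f) \<kappa> = cf f \<kappa>" .
    have "cf (top_mult c f (symb {#})) \<kappa>
        = (\<Sum>\<alpha>\<in>Pt ?k. \<Sum>\<mu>\<in>Pt ?k. if \<mu> = {#} then cf f \<alpha> * top_coeff c \<alpha> {#} \<kappa> else 0)"
      using assms by (simp add: cf_top_mult[OF _ _ order_refl]) (intro sum.cong, auto)
    also have "\<dots> = (\<Sum>\<alpha>\<in>Pt ?k. cf f \<alpha> * top_coeff c \<alpha> {#} \<kappa>)"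
      by (subst sum.delta[OF finite_partitions]) simp
    also have "\<dots> = (\<Sum>\<mu>\<in>Pt ?k. if \<mu> = \<kappa> then cf f \<mu> else 0)"
      by (intro sum.cong) (auto simp: d)
    also have "\<dots> = cf f \<kappa>" using f0 by (subst sum.delta[OF finite_partitions]) auto
    finally show ?thesis using 1 by simp
  qed
  then show "top_mult c (symb {#}) f = f" and "top_mult c f (symb {#}) = f"
    by (auto intro: poly_mapping_eqI)
qed

text \<open>A model of the graded ring on the universal module: the ring axioms are checked on
  coefficients and then transported along \<open>gr_of\<close>, which avoids computing with
  cosets.\<close>

definition top_ring :: "univ ring" where
  "top_ring = \<lparr>carrier = univ_carrier, monoid.mult = top_mult c, one = symb {#}, ring.zero = 0, add = (+)\<rparr>"

lemma top_ring_ring: "ring top_ring"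
proof (rule ringI)
  show "abelian_group top_ring"
  proof (rule abelian_groupI)
    fix x assume "x \<in> carrier top_ring"
    then show "\<exists>y\<in>carrier top_ring. y \<oplus>\<^bsub>top_ring\<^esub> x = \<zero>\<^bsub>top_ring\<^esub>"
      by (intro bexI[of _ "- x"]) (simp_all add: top_ring_def univ_carrier_uminus)
  qed (simp_all add: top_ring_def univ_carrier_add add.assoc add.commute)
  show "Group.monoid top_ring"
    by (rule Group.monoidI) (simp_all add: top_ring_def top_mult_carrier top_mult_assoc top_mult_unit)
qed (simp_all add: top_ring_def top_mult_distrib)

lemma univ_mult_filt:
  assumes "f \<in> univ_filt i" "g \<in> univ_filt j"
  shows "f \<otimes>\<^bsub>univ_ring c\<^esub> g \<in> univ_filt (i + j)"
proof -
  have fg: "f \<in> univ_carrier" "g \<in> univ_carrier" using assms by (auto simp: univ_filt_iff)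
  have "cf (f \<otimes>\<^bsub>univ_ring c\<^esub> g) \<kappa> \<in> int_valued" for \<kappa>
    unfolding cf_univ_mult using fg
    by (intro int_valued_sum int_valued_mult) (auto simp: univ_carrier_iff int_valued)
  moreover have "cf (f \<otimes>\<^bsub>univ_ring c\<^esub> g) \<kappa> = 0" if "\<kappa> \<notin> partitions" for \<kappa>
    using that by (simp add: cf_univ_mult)
  moreover have "cf (f \<otimes>\<^bsub>univ_ring c\<^esub> g) \<kappa> = 0" if "sum_mset \<kappa> > i + j" for \<kappa>
    unfolding cf_univ_mult
  proof (intro sum.neutral ballI)
    fix \<alpha> \<mu> assume "\<alpha> \<in> Poly_Mapping.keys f" "\<mu> \<in> Poly_Mapping.keys g"
    then have "sum_mset \<alpha> \<le> i" "sum_mset \<mu> \<le> j" using assms by (auto simp: univ_filt_def)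
    then show "cf f \<alpha> * cf g \<mu> * (if \<kappa> \<in> partitions \<and> sum_mset \<kappa> \<le> sum_mset \<alpha> + sum_mset \<mu> then c \<alpha> \<mu> \<kappa> else 0) = 0"
      using that by simp
  qed
  ultimately show ?thesis by (simp add: univ_filt_iff univ_carrier_iff)
qed

text \<open>Two sizes add up to i + j only if they are i and j or one of them exceeds its bound, and
  then the coefficient of a or b is zero. So the class of the product is independent of the
  representatives and sees only the leading parts.\<close>

lemma part_class_mult:
  assumes "f \<in> univ_carrier" "g \<in> univ_carrier" "a \<in> part_class i f" "b \<in> part_class j g"
  shows "part_class (i + j) (a \<otimes>\<^bsub>univ_ring c\<^esub> b) = part_class (i + j) (top_mult c (hom_part i f) (hom_part j g))"
proof (rule part_class_cong)
  fix \<kappa> assume k: "sum_mset \<kappa> = i + j"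
  have ab: "a \<in> univ_filt i" "b \<in> univ_filt j" using assms by (auto simp: part_class_def)
  have abc: "a \<in> univ_carrier" "b \<in> univ_carrier" using ab by (auto simp: univ_filt_iff)
  have "cf (a \<otimes>\<^bsub>univ_ring c\<^esub> b) \<kappa> = cf (top_mult c a b) \<kappa>"
    unfolding cf_univ_mult cf_top_mult_keys
  proof (intro sum.cong refl arg_cong2[where f = "(*)"])
    fix \<alpha> \<mu> assume "\<alpha> \<in> Poly_Mapping.keys a" "\<mu> \<in> Poly_Mapping.keys b"
    then have "sum_mset \<alpha> + sum_mset \<mu> \<le> sum_mset \<kappa>" using ab k by (auto simp: univ_filt_def intro: add_mono)
    then show "(if \<kappa> \<in> partitions \<and> sum_mset \<kappa> \<le> sum_mset \<alpha> + sum_mset \<mu> then c \<alpha> \<mu> \<kappa> else 0)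
        = top_coeff c \<alpha> \<mu> \<kappa>" by (auto simp: top_coeff_def)
  qed
  also have "\<dots> = (\<Sum>\<alpha>\<in>Pt (i + j). \<Sum>\<mu>\<in>Pt (i + j). cf a \<alpha> * cf b \<mu> * top_coeff c \<alpha> \<mu> \<kappa>)"
    using abc k by (intro cf_top_mult) simp_all
  also have "\<dots> = (\<Sum>\<alpha>\<in>Pt (i + j). \<Sum>\<mu>\<in>Pt (i + j). cf (hom_part i f) \<alpha> * cf (hom_part j g) \<mu> * top_coeff c \<alpha> \<mu> \<kappa>)"
  proof (intro sum.cong refl)
    fix \<alpha> \<mu>
    have *: "cf a \<alpha> = (if sum_mset \<alpha> = i then cf f \<alpha> else if sum_mset \<alpha> > i then 0 else cf a \<alpha>)"
      "cf b \<mu> = (if sum_mset \<mu> = j then cf g \<mu> else if sum_mset \<mu> > j then 0 else cf b \<mu>)"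
      using assms(3,4) by (auto simp: part_class_def univ_filt_iff)
    show "cf a \<alpha> * cf b \<mu> * top_coeff c \<alpha> \<mu> \<kappa> = cf (hom_part i f) \<alpha> * cf (hom_part j g) \<mu> * top_coeff c \<alpha> \<mu> \<kappa>"
    proof (cases "sum_mset \<alpha> + sum_mset \<mu> = i + j")
      case True
      then consider "sum_mset \<alpha> = i" "sum_mset \<mu> = j" | "sum_mset \<alpha> > i" "sum_mset \<mu> \<noteq> j"
        | "sum_mset \<mu> > j" "sum_mset \<alpha> \<noteq> i" by linarith
      then show ?thesis using * by cases (simp_all add: cf_hom_part)
    qed (use k in \<open>simp add: top_coeff_outside\<close>)
  qed
  also have "\<dots> = cf (top_mult c (hom_part i f) (hom_part j g)) \<kappa>"
    using assms k by (simp add: cf_top_mult[where k = "i + j"] hom_part_carrier)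
  finally show "cf (a \<otimes>\<^bsub>univ_ring c\<^esub> b) \<kappa> = cf (top_mult c (hom_part i f) (hom_part j g)) \<kappa>" .
qed

lemma gr_ring_mult:
  assumes "f \<in> univ_carrier" "g \<in> univ_carrier"
  shows "gr_of f \<otimes>\<^bsub>gr_ring (univ_ring c) univ_filt\<^esub> gr_of g = gr_of (top_mult c f g)"
proof
  fix k
  let ?m = "\<lambda>i. top_mult c (hom_part i f) (hom_part (k - i) g)"
  have m: "?m i \<in> univ_carrier" for i
    using assms by (intro top_mult_carrier hom_part_carrier)
  have r: "rcoset_mult (univ_ring c) (filt_pred (univ_ring c) univ_filt k) (gr_of f i) (gr_of g (k - i))
      = part_class k (?m i)" if "i \<in> {..k}" for i
  proof -
    have ik: "i + (k - i) = k" using that by simp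
    have "part_class k 0 +>\<^bsub>univ_ring c\<^esub> (a \<otimes>\<^bsub>univ_ring c\<^esub> b) = part_class k (?m i)"
      if ab: "a \<in> part_class i f" "b \<in> part_class (k - i) g" for a b
    proof -
      have "a \<otimes>\<^bsub>univ_ring c\<^esub> b \<in> univ_filt k"
        using univ_mult_filt[of a i b "k - i"] ab ik by (simp add: part_class_def)
      then show ?thesis using part_class_mult[OF assms ab] ik by (simp add: part_class_coset)
    qed
    then show ?thesis
      using hom_part_in_part_class[OF assms(1), of i] hom_part_in_part_class[OF assms(2), of "k - i"]
      unfolding rcoset_mult_def filt_pred_eq gr_of_def by auto
  qed
  have "(gr_of f \<otimes>\<^bsub>gr_ring (univ_ring c) univ_filt\<^esub> gr_of g) k
      = finprod (gr_piece (univ_ring c) univ_filt k) (\<lambda>i. part_class k (?m i)) {..k}"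
  proof -
    interpret comm_group "gr_piece (univ_ring c) univ_filt k" by (rule gr_piece_comm_group)
    have "finprod (gr_piece (univ_ring c) univ_filt k)
        (\<lambda>i. rcoset_mult (univ_ring c) (filt_pred (univ_ring c) univ_filt k) (gr_of f i) (gr_of g (k - i))) {..k}
      = finprod (gr_piece (univ_ring c) univ_filt k) (\<lambda>i. part_class k (?m i)) {..k}"
      using m r by (intro finprod_cong') (auto simp: gr_piece_simps)
    then show ?thesis by (simp add: gr_ring_def)
  qed
  also have "\<dots> = part_class k (\<Sum>i\<le>k. ?m i)"
    by (rule finprod_part_class) (use m in auto)
  also have "\<dots> = part_class k (top_mult c f g)"
  proof (rule part_class_cong)
    fix \<kappa> assume k: "sum_mset \<kappa> = k"
    have "cf (\<Sum>i\<le>k. ?m i) \<kappa> = (\<Sum>i\<le>k. \<Sum>\<alpha>\<in>Pt k. \<Sum>\<mu>\<in>Pt k.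
        cf (hom_part i f) \<alpha> * cf (hom_part (k - i) g) \<mu> * top_coeff c \<alpha> \<mu> \<kappa>)"
      using assms k by (simp add: lookup_sum cf_top_mult[where k = k] hom_part_carrier)
    also have "\<dots> = (\<Sum>\<alpha>\<in>Pt k. \<Sum>i\<le>k. \<Sum>\<mu>\<in>Pt k.
        cf (hom_part i f) \<alpha> * cf (hom_part (k - i) g) \<mu> * top_coeff c \<alpha> \<mu> \<kappa>)" by (rule sum.swap)
    also have "\<dots> = (\<Sum>\<alpha>\<in>Pt k. \<Sum>\<mu>\<in>Pt k. \<Sum>i\<le>k.
        cf (hom_part i f) \<alpha> * cf (hom_part (k - i) g) \<mu> * top_coeff c \<alpha> \<mu> \<kappa>)"
      by (intro sum.cong[OF refl] sum.swap)
    also have "\<dots> = (\<Sum>\<alpha>\<in>Pt k. \<Sum>\<mu>\<in>Pt k. cf f \<alpha> * cf g \<mu> * top_coeff c \<alpha> \<mu> \<kappa>)"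
    proof (intro sum.cong refl)
      fix \<alpha> \<mu> assume \<alpha>: "\<alpha> \<in> Pt k"
      \<comment> \<open>For given \<alpha> only i = |\<alpha>| contributes, and
        \<open>top_coeff\<close> forces |\<mu>| = k - i; the convolution over degrees collapses to
        one term.\<close>
      have "(\<Sum>i\<le>k. cf (hom_part i f) \<alpha> * cf (hom_part (k - i) g) \<mu> * top_coeff c \<alpha> \<mu> \<kappa>)
          = (\<Sum>i\<le>k. if i = sum_mset \<alpha> then cf f \<alpha> * cf g \<mu> * top_coeff c \<alpha> \<mu> \<kappa> else 0)"
        using k by (intro sum.cong refl) (auto simp: cf_hom_part top_coeff_def)
      also have "\<dots> = cf f \<alpha> * cf g \<mu> * top_coeff c \<alpha> \<mu> \<kappa>" using \<alpha> by simp
      finally show "(\<Sum>i\<le>k. cf (hom_part i f) \<alpha> * cf (hom_part (k - i) g) \<mu> * top_coeff c \<alpha> \<mu> \<kappa>)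
          = cf f \<alpha> * cf g \<mu> * top_coeff c \<alpha> \<mu> \<kappa>" .
    qed
    also have "\<dots> = cf (top_mult c f g) \<kappa>" using assms k by (simp add: cf_top_mult[where k = k])
    finally show "cf (\<Sum>i\<le>k. ?m i) \<kappa> = cf (top_mult c f g) \<kappa>" .
  qed
  finally show "(gr_of f \<otimes>\<^bsub>gr_ring (univ_ring c) univ_filt\<^esub> gr_of g) k = gr_of (top_mult c f g) k"
    by (simp add: gr_of_def)
qed

lemma gr_ring_ring: "ring (gr_ring (univ_ring c) univ_filt)"
proof -
  let ?S = "gr_ring (univ_ring c) univ_filt"
  have "gr_of \<in> ring_iso top_ring ?S"
  proof (rule ring_iso_memI)
    show "bij_betw gr_of (carrier top_ring) (carrier ?S)"
      using inj_gr_of by (simp add: bij_betw_def carrier_gr_ring top_ring_def)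
  qed (auto simp: top_ring_def carrier_gr_ring gr_ring_mult gr_ring_add gr_ring_one)
  \<comment> \<open>The transport theorem installs the image of zero as the new zero; it is the zero
    that \<open>?S\<close> already has.\<close>
  then have "ring (?S\<lparr>zero := gr_of \<zero>\<^bsub>top_ring\<^esub>\<rparr>)"
    by (rule ring.ring_iso_imp_img_ring[OF top_ring_ring])
  moreover have "?S\<lparr>zero := gr_of \<zero>\<^bsub>top_ring\<^esub>\<rparr> = ?S"
    using gr_ring_zero[of c] by (simp add: top_ring_def)
  ultimately show ?thesis by simp
qed

lemma finsum_gr_of:
  assumes "finite A" "\<And>i. i \<in> A \<Longrightarrow> f i \<in> univ_carrier"
  shows "finsum (gr_ring (univ_ring c) univ_filt) (\<lambda>i. gr_of (f i)) A = gr_of (sum f A)"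
proof -
  interpret ring "gr_ring (univ_ring c) univ_filt" by (rule gr_ring_ring)
  show ?thesis
    using assms
  proof (induction A rule: finite_induct)
    case empty
    then show ?case by (simp add: gr_ring_zero)
  next
    case (insert a A)
    then have "(\<lambda>i. gr_of (f i)) \<in> A \<rightarrow> carrier (gr_ring (univ_ring c) univ_filt)"
      by (auto simp: carrier_gr_ring)
    then show ?case
      using insert by (simp add: finsum_insert carrier_gr_ring gr_ring_add univ_carrier_sum)
  qed
qed

lemma gr_graded_ring: "graded_ring (gr_ring (univ_ring c) univ_filt) (gr_deg (univ_ring c) univ_filt)"
proof -
  let ?S = "gr_ring (univ_ring c) univ_filt" and ?D = "gr_deg (univ_ring c) univ_filt"
  let ?H = "\<lambda>k. {f \<in> univ_carrier. \<forall>\<kappa>. sum_mset \<kappa> \<noteq> k \<longrightarrow> cf f \<kappa> = 0}"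
  interpret S: ring ?S by (rule gr_ring_ring)
  have "additive_subgroup (?D k) ?S" for k
  proof (rule additive_subgroup.intro, rule group.subgroupI)
    show "group (add_monoid ?S)" by (rule S.a_group)
    show "?D k \<subseteq> carrier (add_monoid ?S)" by (auto simp: gr_deg_def)
    show "?D k \<noteq> {}" by (auto simp: gr_deg_eq intro!: exI[of _ 0])
    fix x y assume "x \<in> ?D k" "y \<in> ?D k"
    then obtain f g where fg: "f \<in> ?H k" "g \<in> ?H k" "x = gr_of f" "y = gr_of g"
      unfolding gr_deg_eq by blast
    then have "x \<oplus>\<^bsub>?S\<^esub> y = gr_of (f + g)" by (simp add: gr_ring_add)
    moreover have "f + g \<in> ?H k" using fg by (simp add: univ_carrier_add lookup_add)
    ultimately show "x \<otimes>\<^bsub>add_monoid ?S\<^esub> y \<in> ?D k" unfolding gr_deg_eq by auto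
    have "- f \<in> ?H k" using fg by (simp add: univ_carrier_uminus)
    moreover have "\<ominus>\<^bsub>?S\<^esub> x = gr_of (- f)"
      using fg by (intro S.minus_equality)
        (auto simp: gr_ring_add carrier_gr_ring gr_ring_zero univ_carrier_uminus)
    ultimately show "inv\<^bsub>add_monoid ?S\<^esub> x \<in> ?D k" unfolding gr_deg_eq a_inv_def by auto
  qed
  moreover have "x \<otimes>\<^bsub>?S\<^esub> y \<in> ?D (i + j)" if xy: "x \<in> ?D i" "y \<in> ?D j" for i j x y
  proof -
    obtain f g where fg: "f \<in> ?H i" "g \<in> ?H j" "x = gr_of f" "y = gr_of g"
      using xy unfolding gr_deg_eq by blast
    have "cf (top_mult c f g) \<kappa> = 0" if "sum_mset \<kappa> \<noteq> i + j" for \<kappa>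
    proof -
      have "cf f \<alpha> * cf g \<mu> * top_coeff c \<alpha> \<mu> \<kappa> = 0" for \<alpha> \<mu>
        using fg that by (cases "sum_mset \<alpha> = i \<and> sum_mset \<mu> = j") (auto simp: top_coeff_def)
      then show ?thesis using fg by (simp add: cf_top_mult[OF _ _ order_refl] del: mult_eq_0_iff)
    qed
    then have "top_mult c f g \<in> ?H (i + j)" using fg top_mult_carrier by auto
    then show ?thesis using fg unfolding gr_deg_eq by (auto simp: gr_ring_mult)
  qed
  moreover have "\<one>\<^bsub>?S\<^esub> \<in> ?D 0" unfolding gr_ring_one gr_deg_eq by auto
  moreover have "\<exists>!d. (\<forall>k. d k \<in> ?D k) \<and> finite {k. d k \<noteq> \<zero>\<^bsub>?S\<^esub>} \<and> x = finsum ?S d {k. d k \<noteq> \<zero>\<^bsub>?S\<^esub>}"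
    if "x \<in> carrier ?S" for x
  proof -
    obtain f where f: "f \<in> univ_carrier" "x = gr_of f" using \<open>x \<in> carrier ?S\<close> by (auto simp: carrier_gr_ring)
    have gr0: "gr_of g = \<zero>\<^bsub>?S\<^esub> \<longleftrightarrow> g = 0" if "g \<in> univ_carrier" for g
      unfolding gr_ring_zero using inj_on_eq_iff[OF inj_gr_of that univ_carrier_0] .
    have homH: "hom_part k f \<in> ?H k" for k using hom_part_carrier[OF f(1)] by (simp add: cf_hom_part)
    show ?thesis
    proof (rule ex1I[of _ "\<lambda>k. gr_of (hom_part k f)"])
      have set: "{k. gr_of (hom_part k f) \<noteq> \<zero>\<^bsub>?S\<^esub>} = {k. hom_part k f \<noteq> 0}"
        using gr0 hom_part_carrier[OF f(1)] by blast
      have "{k. hom_part k f \<noteq> 0} \<subseteq> sum_mset ` Poly_Mapping.keys f"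
      proof
        fix k assume "k \<in> {k. hom_part k f \<noteq> 0}"
        then obtain \<kappa> where "cf (hom_part k f) \<kappa> \<noteq> 0" by (metis lookup_zero mem_Collect_eq poly_mapping_eqI)
        then show "k \<in> sum_mset ` Poly_Mapping.keys f" by (auto simp: cf_hom_part in_keys_iff split: if_splits)
      qed
      then have fin: "finite {k. hom_part k f \<noteq> 0}" by (rule finite_subset) simp
      have "(\<Sum>k | hom_part k f \<noteq> 0. hom_part k f) = f"
      proof (rule poly_mapping_eqI)
        fix \<kappa>
        have "cf (\<Sum>k | hom_part k f \<noteq> 0. hom_part k f) \<kappa>
            = (if sum_mset \<kappa> \<in> {k. hom_part k f \<noteq> 0} then cf f \<kappa> else 0)"
          using fin by (simp add: lookup_sum cf_hom_part)
        also have "\<dots> = cf f \<kappa>" using cf_hom_part[of "sum_mset \<kappa>" f \<kappa>] by auto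
        finally show "cf (\<Sum>k | hom_part k f \<noteq> 0. hom_part k f) \<kappa> = cf f \<kappa>" .
      qed
      then show "(\<forall>k. gr_of (hom_part k f) \<in> ?D k) \<and> finite {k. gr_of (hom_part k f) \<noteq> \<zero>\<^bsub>?S\<^esub>} \<and>
          x = finsum ?S (\<lambda>k. gr_of (hom_part k f)) {k. gr_of (hom_part k f) \<noteq> \<zero>\<^bsub>?S\<^esub>}"
        unfolding set using finsum_gr_of[OF fin, of "\<lambda>k. hom_part k f"] hom_part_carrier[OF f(1)] fin homH f(2)
        by (auto simp: gr_deg_eq)
    next
      fix d assume d: "(\<forall>k. d k \<in> ?D k) \<and> finite {k. d k \<noteq> \<zero>\<^bsub>?S\<^esub>} \<and> x = finsum ?S d {k. d k \<noteq> \<zero>\<^bsub>?S\<^esub>}"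
      then have "\<forall>k. \<exists>g. g \<in> ?H k \<and> d k = gr_of g" unfolding gr_deg_eq by blast
      from choice[OF this] obtain g where gd: "\<forall>k. g k \<in> ?H k \<and> d k = gr_of (g k)" ..
      have g: "g k \<in> ?H k" "d k = gr_of (g k)" for k
        by (rule conjunct1[OF spec[OF gd]], rule conjunct2[OF spec[OF gd]])
      have gc: "g k \<in> univ_carrier" for k using g(1) by blast
      have set: "{k. d k \<noteq> \<zero>\<^bsub>?S\<^esub>} = {k. g k \<noteq> 0}" using gr0[OF gc] g(2) by simp
      have fin: "finite {k. g k \<noteq> 0}" using d set by simp
      have "gr_of f = finsum ?S (\<lambda>k. gr_of (g k)) {k. g k \<noteq> 0}"
      proof -
        have "d = (\<lambda>k. gr_of (g k))" by (rule ext) (rule g(2))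
        moreover have "gr_of f = finsum ?S d {k. d k \<noteq> \<zero>\<^bsub>?S\<^esub>}" using d f(2) by simp
        ultimately show ?thesis unfolding set by simp
      qed
      also have "\<dots> = gr_of (\<Sum>k | g k \<noteq> 0. g k)" using fin gc by (rule finsum_gr_of)
      finally have fs: "f = (\<Sum>k | g k \<noteq> 0. g k)"
        using inj_onD[OF inj_gr_of _ f(1) univ_carrier_sum[of _ g]] gc by simp
      show "d = (\<lambda>k. gr_of (hom_part k f))"
      proof
        fix k
        have "hom_part k f = g k"
        proof (rule poly_mapping_eqI)
          fix \<kappa>
          \<comment> \<open>Uniqueness: the component of degree j has coefficients only at size j,
            so the coefficient of f at \<kappa> comes from the component of degree |\<kappa>|
            alone.\<close>
          have "cf f \<kappa> = (\<Sum>j | g j \<noteq> 0. if j = sum_mset \<kappa> then cf (g j) \<kappa> else 0)"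
            unfolding fs lookup_sum using g(1) by (intro sum.cong) auto
          also have "\<dots> = cf (g (sum_mset \<kappa>)) \<kappa>" using fin by (subst sum.delta) auto
          finally show "cf (hom_part k f) \<kappa> = cf (g k) \<kappa>" using g(1)[of k] by (auto simp: cf_hom_part)
        qed
        then show "d k = gr_of (hom_part k f)" using g(2) by simp
      qed
    qed
  qed
  ultimately show ?thesis unfolding graded_ring_def using gr_ring_ring by blast
qed

end

section \<open>Comparison of the two graded rings\<close>

lemma top_mult_cong:
  assumes "\<And>\<alpha> \<mu> \<kappa>. \<kappa> \<in> partitions \<Longrightarrow> sum_mset \<kappa> = sum_mset \<alpha> + sum_mset \<mu> \<Longrightarrow> c \<alpha> \<mu> \<kappa> = c' \<alpha> \<mu> \<kappa>"
  shows "top_mult c = top_mult c'"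
proof -
  have "top_coeff c = top_coeff c'" using assms by (auto simp: top_coeff_def fun_eq_iff)
  then show ?thesis by (simp add: top_mult_def fun_eq_iff)
qed

text \<open>The carriers are the same set and the induced map is the identity on it. The rings can
  differ only in the product, which sees the constants through their top coefficients.\<close>

lemma gr_map_graded_ring_iso:
  assumes "structure_constants c" "structure_constants c'"
    and "\<And>\<alpha> \<mu> \<kappa>. \<kappa> \<in> partitions \<Longrightarrow> sum_mset \<kappa> = sum_mset \<alpha> + sum_mset \<mu> \<Longrightarrow> c \<alpha> \<mu> \<kappa> = c' \<alpha> \<mu> \<kappa>"
  shows "graded_ring_iso (gr_ring (univ_ring c) univ_filt) (gr_deg (univ_ring c) univ_filt)
    (gr_ring (univ_ring c') univ_filt) (gr_deg (univ_ring c') univ_filt)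
    (gr_map (univ_ring c') univ_filt C_to_K)"
  unfolding graded_ring_iso_def
proof (intro conjI allI)
  interpret Z: structure_constants c by fact
  interpret H: structure_constants c' by fact
  let ?Z = "gr_ring (univ_ring c) univ_filt" and ?H = "gr_ring (univ_ring c') univ_filt"
  let ?h = "gr_map (univ_ring c') univ_filt C_to_K"
  show "graded_ring ?Z (gr_deg (univ_ring c) univ_filt)" "graded_ring ?H (gr_deg (univ_ring c') univ_filt)"
    by (rule Z.gr_graded_ring H.gr_graded_ring)+
  have id: "?h x = x" if "x \<in> gr_of ` univ_carrier" for x
    using that gr_map_gr_of by blast
  show "?h \<in> ring_iso ?Z ?H"
  proof (rule ring_iso_memI)
    show "bij_betw ?h (carrier ?Z) (carrier ?H)"
      unfolding carrier_gr_ring using id by (auto simp: bij_betw_def inj_on_def)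
  qed (auto simp: carrier_gr_ring gr_map_gr_of Z.gr_ring_mult H.gr_ring_mult gr_ring_add gr_ring_one
      Z.top_mult_carrier univ_carrier_add top_mult_cong[OF assms(3)] H.top_mult_carrier)
  show "?h ` gr_deg (univ_ring c) univ_filt k = gr_deg (univ_ring c') univ_filt k" for k
  proof -
    have "?h ` gr_of ` A = gr_of ` A" if "A \<subseteq> univ_carrier" for A
      using that id by (force simp: image_image intro!: image_cong)
    then show ?thesis unfolding gr_deg_eq by blast
  qed
qed

lemma structure_constants_a_poly: "structure_constants a_poly"
proof
  fix \<mu> \<nu> :: "nat multiset"
  assume "\<mu> \<in> partitions" "\<nu> \<in> partitions"
  then show "a_poly {#} \<mu> \<nu> = (if \<nu> = \<mu> then 1 else 0) \<and> a_poly \<mu> {#} \<nu> = (if \<nu> = \<mu> then 1 else 0)"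
    by (simp add: a_poly_unit)
qed (rule a_poly_interpolates(1) a_poly_top_assoc; assumption)+

text \<open>Every constant in the two sums is of top degree, since |\<tau>| = |\<nu>| + |\<kappa>|
  in the first and |\<tau>| = |\<alpha>| + |\<nu>| in the second; associativity and unit laws are
  therefore inherited from the centers.\<close>

lemma structure_constants_f_poly: "structure_constants f_poly"
proof
  fix \<alpha> \<mu> \<kappa> \<tau> :: "nat multiset"
  assume part: "\<alpha> \<in> partitions" "\<mu> \<in> partitions" "\<kappa> \<in> partitions" "\<tau> \<in> partitions"
    and deg: "sum_mset \<tau> = sum_mset \<alpha> + sum_mset \<mu> + sum_mset \<kappa>"
  have "(\<Sum>\<nu> | \<nu> \<in> partitions \<and> sum_mset \<nu> = sum_mset \<alpha> + sum_mset \<mu>. f_poly \<alpha> \<mu> \<nu> * f_poly \<nu> \<kappa> \<tau>)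
      = (\<Sum>\<nu> | \<nu> \<in> partitions \<and> sum_mset \<nu> = sum_mset \<alpha> + sum_mset \<mu>. a_poly \<alpha> \<mu> \<nu> * a_poly \<nu> \<kappa> \<tau>)"
    using part deg by (intro sum.cong) (auto simp: f_poly_eq_a_poly)
  also have "\<dots> = (\<Sum>\<nu> | \<nu> \<in> partitions \<and> sum_mset \<nu> = sum_mset \<mu> + sum_mset \<kappa>. a_poly \<mu> \<kappa> \<nu> * a_poly \<alpha> \<nu> \<tau>)"
    using part deg by (rule a_poly_top_assoc)
  also have "\<dots> = (\<Sum>\<nu> | \<nu> \<in> partitions \<and> sum_mset \<nu> = sum_mset \<mu> + sum_mset \<kappa>. f_poly \<mu> \<kappa> \<nu> * f_poly \<alpha> \<nu> \<tau>)"
    using part deg by (intro sum.cong) (auto simp: f_poly_eq_a_poly)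
  finally show "(\<Sum>\<nu> | \<nu> \<in> partitions \<and> sum_mset \<nu> = sum_mset \<alpha> + sum_mset \<mu>. f_poly \<alpha> \<mu> \<nu> * f_poly \<nu> \<kappa> \<tau>)
      = (\<Sum>\<nu> | \<nu> \<in> partitions \<and> sum_mset \<nu> = sum_mset \<mu> + sum_mset \<kappa>. f_poly \<mu> \<kappa> \<nu> * f_poly \<alpha> \<nu> \<tau>)" .
next
  fix \<mu> \<nu> :: "nat multiset"
  assume "\<mu> \<in> partitions" "\<nu> \<in> partitions" "sum_mset \<nu> = sum_mset \<mu>"
  then show "f_poly {#} \<mu> \<nu> = (if \<nu> = \<mu> then 1 else 0) \<and> f_poly \<mu> {#} \<nu> = (if \<nu> = \<mu> then 1 else 0)"
    by (simp add: f_poly_eq_a_poly a_poly_unit)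
qed (rule f_poly_interpolates(1))

theorem theorem4p5:
  shows "(\<forall>k. C_to_K ` univ_filt k \<subseteq> univ_filt k) \<and>
    graded_ring_iso
      (gr_ring univ_Z univ_filt) (gr_deg univ_Z univ_filt)
      (gr_ring univ_H univ_filt) (gr_deg univ_H univ_filt)
      (gr_map univ_H univ_filt C_to_K) \<and>
    (\<forall>\<mu>\<in>partitions.
      gr_map univ_H univ_filt C_to_K (gr_class univ_Z univ_filt (sum_mset \<mu>) (symb \<mu>)) =
      gr_class univ_H univ_filt (sum_mset \<mu>) (symb \<mu>))"
proof (intro conjI allI ballI)
  show "C_to_K ` univ_filt k \<subseteq> univ_filt k" for k by auto
  show "graded_ring_iso (gr_ring univ_Z univ_filt) (gr_deg univ_Z univ_filt)
      (gr_ring univ_H univ_filt) (gr_deg univ_H univ_filt) (gr_map univ_H univ_filt C_to_K)"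
    unfolding univ_Z_def univ_H_def
    by (rule gr_map_graded_ring_iso[OF structure_constants_a_poly structure_constants_f_poly])
      (simp add: f_poly_eq_a_poly)
  show "gr_map univ_H univ_filt C_to_K (gr_class univ_Z univ_filt (sum_mset \<mu>) (symb \<mu>))
      = gr_class univ_H univ_filt (sum_mset \<mu>) (symb \<mu>)" if "\<mu> \<in> partitions" for \<mu>
    using that by (simp add: univ_Z_def univ_H_def gr_class_symb gr_map_gr_of)
qed

end
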